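(* Let $D=L^\infty(\mathbf{T}^2)$ with $\mathbf{T}^2=(\mathbf{R}/\mathbf{Z})^2$, let $\alpha:\mathbf{Z}\curvearrowright D$ be given by $\alpha(f)(r,s)=f(r-1/\sqrt2,\,s-1/\sqrt3)$, and let $M=D\rtimes_{\alpha*\alpha}\mathbf{F}_2$. For $\lambda,\mu,p,q\in\mathbf{R}$ let $\theta^{\lambda,\mu,p,q}$ be the flow on $M$ determined by $\theta^{\lambda,\mu,p,q}_t(f)(r,s)=f(r-pt,s-qt)$ for $f\in D$, $\theta^{\lambda,\mu,p,q}_t(\lambda_a)=e^{i\lambda t}\lambda_a$ and $\theta^{\lambda,\mu,p,q}_t(\lambda_b)=e^{i\mu t}\lambda_b$. Then, for the flows in this family which have the Rohlin property, cocycle conjugacy and strong cocycle conjugacy are different; that is, there exist two flows $\theta^{\lambda_1,\mu_1,p_1,q_1}$ and $\theta^{\lambda_2,\mu_2,p_2,q_2}$, both having the Rohlin property, which are cocycle conjugate but not strongly cocycle conjugate.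
   Context: A flow on a von Neumann algebra is a one-parameter group of automorphisms $\{\theta_t\}_{t\in\mathbf{R}}$ such that $t\mapsto\theta_t(x)$ is strongly continuous for each $x$. Let $a,b$ be the free generators of $\mathbf{F}_2$, and let $\alpha*\alpha:\mathbf{F}_2\curvearrowright D$ be the action with $(\alpha*\alpha)(a)=(\alpha*\alpha)(b)=\alpha$. $M=D\rtimes_{\alpha*\alpha}\mathbf{F}_2$ has implementing unitaries $\lambda_g$, $g\in\mathbf{F}_2$, with $\lambda_gx\lambda_g^*=(\alpha*\alpha)(g)(x)$ for $x\in D$. $M$ is a non-McDuff type $\mathrm{II}_1$ factor. (The real parameter $\lambda$ is not to be confused with the unitaries $\lambda_g$.) For a flow $\theta$ on $M$, a $\theta$-cocycle is a strongly continuous family of unitaries $u_t\in M$ with $u_{s+t}=u_s\theta_s(u_t)$. Two flows $\theta^1,\theta^2$ on $M$ are cocycle conjugate if there exist a $\theta^2$-cocycle $u$ and $\sigma\in\mathrm{Aut}(M)$ with $\mathrm{Ad}(u_t)\circ\theta^2_t=\sigma\circ\theta^1_t\circ\sigma^{-1}$ for all $t$; they are strongly cocycle conjugate if moreover $\sigma$ can be chosen in $\overline{\mathrm{Int}}(M)$, the group of approximately inner automorphisms of $M$ (closure of the inner automorphisms in $\mathrm{Aut}(M)$). Rohlin property. Fix a free ultrafilter $\omega$ on $\mathbf{N}$ and let $l^\infty(M)$ be the algebra of bounded sequences in $M$. Put $I_\omega=\{(x_n)\in l^\infty(M): x_n\to0\text{ *-strongly as }n\to\omega\}$ and $C_\omega=\{(x_n)\in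 l^\infty(M): \lim_{n\to\omega}\|[\phi,x_n]\|=0\text{ for all }\phi\in M_*\}$; then $M_\omega:=C_\omega/I_\omega$ is a von Neumann algebra on which automorphisms of $M$ act componentwise. For a flow $\theta$ on $M$, fix a faithful normal state $\varphi$ on $M$, put $\|x\|^\sharp_\varphi=\sqrt{\varphi(x^*x)+\varphi(xx^* )}$, and let $M_{\omega,\theta}$ be the von Neumann subalgebra of those $(x_n)\in M_\omega$ such that for every $\epsilon>0$ there is $\delta>0$ with $\{n: \|\theta_t(x_n)-x_n\|^\sharp_\varphi<\epsilon\text{ for }|t|<\delta\}\in\omega$. The flow $\theta$ has the Rohlin property if for every $p\in\mathbf{R}$ there is a unitary $u\in M_{\omega,\theta}$ with $\theta_t(u)=e^{-ipt}u$ for all $t\in\mathbf{R}$. *)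

theory Defs
  imports "HOL-Analysis.Analysis"
begin

section \<open>The torus\<close>

definition circle_rel :: "real \<Rightarrow> real \<Rightarrow> bool" where
  "circle_rel x y \<longleftrightarrow> x - y \<in> \<int>"

lemma equivp_circle_rel: "equivp circle_rel"
proof (rule equivpI)
  show "reflp circle_rel" by (simp add: reflp_def circle_rel_def)
  show "symp circle_rel"
    unfolding symp_def circle_rel_def by (metis Ints_minus minus_diff_eq)
  show "transp circle_rel"
    unfolding transp_def circle_rel_def by (metis Ints_add diff_add_cancel add_diff_eq)
qed

quotient_type circle = real / circle_rel
  morphisms rep_circle to_circle
  by (rule equivp_circle_rel)

lemma to_circle_eq_iff: "to_circle x = to_circle y \<longleftrightarrow> x - y \<in> \<int>"
  by (simp add: circle.abs_eq_iff circle_rel_def)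

instantiation circle :: ab_group_add
begin

lift_definition zero_circle :: circle is 0 .

lift_definition plus_circle :: "circle \<Rightarrow> circle \<Rightarrow> circle" is "(+)"
proof -
  fix a b c d :: real
  assume "circle_rel a b" "circle_rel c d"
  then have "(a - b) + (c - d) \<in> \<int>" by (auto simp: circle_rel_def)
  then show "circle_rel (a + c) (b + d)" by (simp add: circle_rel_def algebra_simps)
qed

lift_definition minus_circle :: "circle \<Rightarrow> circle \<Rightarrow> circle" is "(-)"
proof -
  fix a b c d :: real
  assume "circle_rel a b" "circle_rel c d"
  then have "(a - b) - (c - d) \<in> \<int>" by (auto simp: circle_rel_def)
  then show "circle_rel (a - c) (b - d)" by (simp add: circle_rel_def algebra_simps)
qed

lift_definition uminus_circle :: "circle \<Rightarrow> circle" is uminus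
proof -
  fix a b :: real
  assume "circle_rel a b"
  then have "- (a - b) \<in> \<int>" unfolding circle_rel_def by (rule Ints_minus)
  then show "circle_rel (- a) (- b)" by (simp add: circle_rel_def)
qed

instance
  by standard (transfer, simp add: circle_rel_def algebra_simps)+

end

lemma to_circle_add: "to_circle (x + y) = to_circle x + to_circle y"
  by (simp add: plus_circle.abs_eq)

lemma to_circle_diff: "to_circle (x - y) = to_circle x - to_circle y"
  by (simp add: minus_circle.abs_eq)

text \<open>The sigma-algebra is the quotient one; it is the Borel sigma-algebra of the quotient
  topology.\<close>

definition circle_algebra :: "circle measure" where
  "circle_algebra = sigma UNIV {A. to_circle -` A \<in> sets borel}"

definition circle_measure :: "circle measure" where
  "circle_measure = distr (restrict_space lborel {0..<1}) circle_algebra to_circle"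

type_synonym torus = "circle \<times> circle"

definition torus_measure :: "torus measure" where
  "torus_measure = circle_measure \<Otimes>\<^sub>M circle_measure"

lemma space_circle_algebra [simp]: "space circle_algebra = UNIV"
  by (simp add: circle_algebra_def)

lemma sets_circle_algebra: "sets circle_algebra = {A. to_circle -` A \<in> sets borel}"
proof -
  have "sigma_algebra UNIV {A. to_circle -` A \<in> sets borel}"
  proof (rule sigma_algebra_iff2[THEN iffD2], intro conjI allI impI ballI)
    fix A assume "A \<in> {A. to_circle -` A \<in> sets borel}"
    then have "- (to_circle -` A) \<in> sets borel" by auto
    then show "UNIV - A \<in> {A. to_circle -` A \<in> sets borel}"
      by (simp add: Compl_eq_Diff_UNIV vimage_Diff)
  next
    fix A :: "nat \<Rightarrow> circle set"
    assume "range A \<subseteq> {A. to_circle -` A \<in> sets borel}"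
    then have "(\<Union>i. to_circle -` A i) \<in> sets borel" by (intro sets.countable_UN) auto
    then show "(\<Union>i. A i) \<in> {A. to_circle -` A \<in> sets borel}"
      by (simp add: vimage_UN)
  qed auto
  then show ?thesis
    by (simp add: circle_algebra_def sigma_algebra.sigma_sets_eq)
qed

lemma sets_circle_measure [measurable_cong]: "sets circle_measure = sets circle_algebra"
  by (simp add: circle_measure_def)

lemma space_circle_measure [simp]: "space circle_measure = UNIV"
  by (simp add: circle_measure_def)

lemma space_torus_measure [simp]: "space torus_measure = UNIV"
  by (simp add: torus_measure_def space_pair_measure)

lemma measurable_to_circle: "to_circle \<in> borel \<rightarrow>\<^sub>M circle_algebra"
  by (rule measurableI) (auto simp: sets_circle_algebra)

lemma prob_space_circle_measure: "emeasure circle_measure UNIV = 1"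
proof -
  have "to_circle \<in> restrict_space lborel {0..<1} \<rightarrow>\<^sub>M circle_algebra"
    by (intro measurable_restrict_space1) (simp add: measurable_to_circle)
  then show ?thesis
    by (simp add: circle_measure_def emeasure_distr emeasure_restrict_space
        sets.top[of circle_algebra, simplified])
qed

lemma finite_circle_measure: "finite_measure circle_measure"
  by standard (simp add: prob_space_circle_measure)

lemma finite_torus_measure: "finite_measure torus_measure"
  unfolding torus_measure_def
  by (intro finite_measure_pair_measure finite_circle_measure)

lemma measurable_circle_translation: "(\<lambda>r. r - c) \<in> circle_measure \<rightarrow>\<^sub>M circle_measure"
proof (rule measurableI)
  fix A assume "A \<in> sets circle_measure"
  then have A: "to_circle -` A \<in> sets borel"
    by (simp add: sets_circle_measure sets_circle_algebra)
  obtain d where c: "c = to_circle d" using circle.abs_induct[of "\<lambda>c. \<exists>d. c = to_circle d" c] by blast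
  have "(\<lambda>x::real. x - d) -` (to_circle -` A) \<inter> space borel \<in> sets borel"
    using A by (intro measurable_sets[where A=borel]) auto
  also have "(\<lambda>x::real. x - d) -` (to_circle -` A) \<inter> space borel = to_circle -` ((\<lambda>r. r - c) -` A)"
    by (auto simp: c to_circle_diff)
  finally show "(\<lambda>r. r - c) -` A \<inter> space circle_measure \<in> sets circle_measure"
    by (simp add: sets_circle_measure sets_circle_algebra)
qed simp

lemma measurable_torus_translation [measurable]:
  "(\<lambda>x. x - c) \<in> torus_measure \<rightarrow>\<^sub>M torus_measure"
proof -
  obtain c1 c2 where c: "c = (c1, c2)" by force
  note measurable_circle_translation[measurable]
  have "(\<lambda>x. (fst x - c1, snd x - c2)) \<in> torus_measure \<rightarrow>\<^sub>M torus_measure"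
    unfolding torus_measure_def
    by (intro measurable_Pair measurable_compose[OF measurable_fst measurable_circle_translation]
        measurable_compose[OF measurable_snd measurable_circle_translation])
  then show ?thesis
    by (simp add: c minus_prod_def)
qed

section \<open>The free group of rank two\<close>

datatype gen = gen_a | gen_b

text \<open>A letter \<open>(x, True)\<close> stands for the generator \<open>x\<close> and \<open>(x, False)\<close> for its inverse; group
  elements are reduced words.\<close>

type_synonym letter = "gen \<times> bool"

definition letter_inv :: "letter \<Rightarrow> letter" where
  "letter_inv l = (fst l, \<not> snd l)"

lemma letter_inv_inv [simp]: "letter_inv (letter_inv l) = l"
  by (simp add: letter_inv_def)

lemma letter_inv_neq [simp]: "letter_inv l \<noteq> l" "l \<noteq> letter_inv l"
  by (auto simp: letter_inv_def prod_eq_iff)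

definition is_reduced :: "letter list \<Rightarrow> bool" where
  "is_reduced = successively (\<lambda>k l. l \<noteq> letter_inv k)"

definition lmult :: "letter \<Rightarrow> letter list \<Rightarrow> letter list" where
  "lmult l w = (case w of [] \<Rightarrow> [l] | k # v \<Rightarrow> if k = letter_inv l then v else l # w)"

lemma reduced_Nil [simp]: "is_reduced []" by (simp add: is_reduced_def)

lemma reduced_Cons: "is_reduced (l # w) \<longleftrightarrow> is_reduced w \<and> (w \<noteq> [] \<longrightarrow> hd w \<noteq> letter_inv l)"
  by (cases w) (auto simp: is_reduced_def)

lemma reduced_lmult: "is_reduced w \<Longrightarrow> is_reduced (lmult l w)"
  by (auto simp: lmult_def reduced_Cons split: list.split)

lemma reduced_foldr_lmult: "is_reduced w \<Longrightarrow> is_reduced (foldr lmult v w)"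
  by (induction v) (auto simp: reduced_lmult)

lemma lmult_lmult_inv: "is_reduced w \<Longrightarrow> lmult l (lmult (letter_inv l) w) = w"
  by (cases w; cases "tl w") (auto simp: lmult_def reduced_Cons)

lemma foldr_lmult_assoc:
  "is_reduced w \<Longrightarrow> is_reduced v \<Longrightarrow> foldr lmult (foldr lmult u v) w = foldr lmult u (foldr lmult v w)"
proof (induction u)
  case (Cons l u)
  let ?x = "foldr lmult u v"
  have "foldr lmult (lmult l ?x) w = lmult l (foldr lmult ?x w)"
  proof (cases ?x)
    case Nil
    then show ?thesis by (simp add: lmult_def)
  next
    case (Cons k y)
    then show ?thesis
      using lmult_lmult_inv[OF reduced_foldr_lmult[OF \<open>is_reduced w\<close>], of l y]
      by (auto simp: lmult_def)
  qed
  then show ?case using Cons by simp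
qed simp

lemma foldr_lmult_Nil: "is_reduced w \<Longrightarrow> foldr lmult w [] = w"
  by (induction w) (auto simp: reduced_Cons lmult_def split: list.split)

typedef f2 = "{w. is_reduced w}"
  morphisms word Abs_f2
  by (rule exI[of _ "[]"]) simp

lemma is_reduced_word [simp]: "is_reduced (word g)"
  using word[of g] by simp

setup_lifting type_definition_f2

lift_definition f2_a :: f2 is "[(gen_a, True)]" by (simp add: reduced_Cons)

lift_definition f2_b :: f2 is "[(gen_b, True)]" by (simp add: reduced_Cons)

instantiation f2 :: monoid_mult
begin

lift_definition one_f2 :: f2 is "[]" by simp

lift_definition times_f2 :: "f2 \<Rightarrow> f2 \<Rightarrow> f2" is "foldr lmult"
  by (rule reduced_foldr_lmult)

instance
  by standard (transfer, simp add: foldr_lmult_assoc foldr_lmult_Nil)+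

end

lift_definition f2_inv :: "f2 \<Rightarrow> f2" is "\<lambda>w. rev (map letter_inv w)"
proof -
  fix w assume "is_reduced w"
  have eq: "(\<lambda>k l. letter_inv k \<noteq> letter_inv (letter_inv l)) = (\<lambda>k l. k \<noteq> letter_inv l)"
    by (metis letter_inv_inv)
  have "successively (\<lambda>k l. k \<noteq> letter_inv l) (rev w)"
    using \<open>is_reduced w\<close> by (simp add: is_reduced_def)
  then show "is_reduced (rev (map letter_inv w))"
    unfolding is_reduced_def rev_map successively_map eq[symmetric]
    by (rule successively_mono) (metis letter_inv_inv)
qed

lemma foldr_lmult_inv: "is_reduced w \<Longrightarrow> foldr lmult (rev (map letter_inv v)) (foldr lmult v w) = w"
proof (induction v)
  case (Cons l v)
  have "lmult (letter_inv l) (lmult l x) = x" if "is_reduced x" for x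
    using lmult_lmult_inv[OF that, of "letter_inv l"] by simp
  with Cons show ?case by (simp add: reduced_foldr_lmult)
qed simp

lemma f2_left_inverse [simp]: "f2_inv g * g = 1"
proof (transfer)
  fix w assume "is_reduced w"
  then show "foldr lmult (rev (map letter_inv w)) w = []"
    using foldr_lmult_inv[of "[]" w] by (simp add: foldr_lmult_Nil)
qed

lemma f2_inv_inv [simp]: "f2_inv (f2_inv g) = g"
  by transfer (simp add: rev_map comp_def)

lemma f2_right_inverse [simp]: "g * f2_inv g = 1"
  using f2_left_inverse[of "f2_inv g"] by simp

instance gen :: countable
  by countable_datatype

lemma countable_f2: "countable (UNIV :: f2 set)"
proof -
  have "inj (\<lambda>g. to_nat (word g))" by (rule injI) (simp add: word_inject)
  then show ?thesis by (rule countableI)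
qed

text \<open>The homomorphism from the free group to the bijections of a set that sends the generators
  \<open>a\<close>, \<open>b\<close> to \<open>S\<close>, \<open>T\<close>.\<close>

definition letter_action :: "('d \<Rightarrow> 'd) \<Rightarrow> ('d \<Rightarrow> 'd) \<Rightarrow> letter \<Rightarrow> 'd \<Rightarrow> 'd" where
  "letter_action S T l = (case l of
      (gen_a, True) \<Rightarrow> S | (gen_a, False) \<Rightarrow> inv S
    | (gen_b, True) \<Rightarrow> T | (gen_b, False) \<Rightarrow> inv T)"

definition free_action :: "('d \<Rightarrow> 'd) \<Rightarrow> ('d \<Rightarrow> 'd) \<Rightarrow> f2 \<Rightarrow> 'd \<Rightarrow> 'd" where
  "free_action S T g = foldr (\<lambda>l. (\<circ>) (letter_action S T l)) (word g) id"

lemma free_action_gens: "free_action S T f2_a = S" "free_action S T f2_b = T"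
  by (simp_all add: free_action_def letter_action_def f2_a.rep_eq f2_b.rep_eq)

lemma free_action_mult:
  assumes "bij S" "bij T"
  shows "free_action S T (g * h) = free_action S T g \<circ> free_action S T h"
proof -
  let ?L = "letter_action S T"
  let ?F = "\<lambda>w. foldr (\<lambda>l. (\<circ>) (?L l)) w id"
  have canc: "?L l \<circ> ?L (letter_inv l) = id" for l
    using assms
    by (cases l; cases "fst l"; cases "snd l")
       (auto simp: letter_action_def letter_inv_def bij_is_inj bij_is_surj fun_eq_iff surj_f_inv_f)
  have lm: "?F (lmult l w) = ?L l \<circ> ?F w" for l w
  proof (cases w)
    case (Cons k v)
    have "?L l \<circ> (?L (letter_inv l) \<circ> ?F v) = ?F v"
      by (simp add: comp_assoc[symmetric] canc)
    then show ?thesis using Cons by (auto simp: lmult_def)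
  qed (simp add: lmult_def)
  have "?F (foldr lmult v w) = ?F v \<circ> ?F w" for v w
  proof (induction v)
    case (Cons l v)
    have "?F (foldr lmult (l # v) w) = ?F (lmult l (foldr lmult v w))" by simp
    also have "\<dots> = ?L l \<circ> (?F v \<circ> ?F w)" by (simp only: lm Cons.IH)
    also have "\<dots> = ?F (l # v) \<circ> ?F w" by (simp add: comp_assoc)
    finally show ?case .
  qed simp
  then show ?thesis by (simp add: free_action_def times_f2.rep_eq)
qed

section \<open>Complex Hilbert spaces\<close>

text \<open>The real inner product underlying the norm and the topology is the real part of the complex
  one, which is linear in its first argument.\<close>

class complex_hilbert = real_inner + complete_space +
  fixes scaleC :: "complex \<Rightarrow> 'a \<Rightarrow> 'a"  (infixr "*\<^sub>C" 75)
    and cinner :: "'a \<Rightarrow> 'a \<Rightarrow> complex"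
  assumes scaleC_add_right: "c *\<^sub>C (x + y) = c *\<^sub>C x + c *\<^sub>C y"
    and scaleC_add_left: "(c + d) *\<^sub>C x = c *\<^sub>C x + d *\<^sub>C x"
    and scaleC_scaleC: "c *\<^sub>C (d *\<^sub>C x) = (c * d) *\<^sub>C x"
    and scaleR_scaleC: "scaleR r x = of_real r *\<^sub>C x"
    and cinner_commute: "cinner x y = cnj (cinner y x)"
    and cinner_add_left: "cinner (x + y) z = cinner x z + cinner y z"
    and cinner_scaleC_left: "cinner (c *\<^sub>C x) y = c * cinner x y"
    and inner_cinner: "inner x y = Re (cinner x y)"

section \<open>Square integrable functions\<close>

definition sq_int :: "'a measure \<Rightarrow> ('a \<Rightarrow> complex) \<Rightarrow> bool" where
  "sq_int M f \<longleftrightarrow> f \<in> borel_measurable M \<and> integrable M (\<lambda>x. (cmod (f x))\<^sup>2)"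

lemma sq_int_0 [simp]: "sq_int M (\<lambda>x. 0)"
  by (simp add: sq_int_def)

lemma sq_int_bounded_by:
  assumes "sq_int M f" "g \<in> borel_measurable M" "AE x in M. cmod (g x) \<le> C * cmod (f x)"
  shows "sq_int M g"
  unfolding sq_int_def
proof (intro conjI)
  have "integrable M (\<lambda>x. C\<^sup>2 * (cmod (f x))\<^sup>2)" using assms(1) by (simp add: sq_int_def)
  then show "integrable M (\<lambda>x. (cmod (g x))\<^sup>2)"
  proof (rule Bochner_Integration.integrable_bound)
    show "(\<lambda>x. (cmod (g x))\<^sup>2) \<in> borel_measurable M" using assms(2) by measurable
    show "AE x in M. norm ((cmod (g x))\<^sup>2) \<le> norm (C\<^sup>2 * (cmod (f x))\<^sup>2)"
      using assms(3)
    proof eventually_elim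
      case (elim x)
      from power_mono[OF this, of 2] show ?case by (simp add: power_mult_distrib)
    qed
  qed
qed fact

lemma sq_int_cong_AE:
  assumes "sq_int M f" "g \<in> borel_measurable M" "AE x in M. f x = g x"
  shows "sq_int M g"
  using assms(1,2) by (rule sq_int_bounded_by[where C=1]) (use assms(3) in auto)

lemma sq_int_scale: "sq_int M f \<Longrightarrow> sq_int M (\<lambda>x. c * f x)"
  by (rule sq_int_bounded_by[where C="cmod c"]) (auto simp: sq_int_def norm_mult)

lemma sum_square_le: "(a + b)\<^sup>2 \<le> 2 * a\<^sup>2 + 2 * (b::real)\<^sup>2"
  using sum_squares_bound[of a b] by (simp add: power2_sum)

lemma sq_int_add:
  assumes f: "sq_int M f" and g: "sq_int M g"
  shows "sq_int M (\<lambda>x. f x + g x)"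
  unfolding sq_int_def
proof (intro conjI)
  have m: "f \<in> borel_measurable M" "g \<in> borel_measurable M"
    using f g by (auto simp: sq_int_def)
  then show "(\<lambda>x. f x + g x) \<in> borel_measurable M" by measurable
  have "integrable M (\<lambda>x. 2 * (cmod (f x))\<^sup>2 + 2 * (cmod (g x))\<^sup>2)"
    using f g by (simp add: sq_int_def)
  then show "integrable M (\<lambda>x. (cmod (f x + g x))\<^sup>2)"
  proof (rule Bochner_Integration.integrable_bound)
    show "(\<lambda>x. (cmod (f x + g x))\<^sup>2) \<in> borel_measurable M" using m by measurable
    have "(cmod (f x + g x))\<^sup>2 \<le> 2 * (cmod (f x))\<^sup>2 + 2 * (cmod (g x))\<^sup>2" for x
      using power_mono[OF norm_triangle_ineq[of "f x" "g x"], of 2] sum_square_le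
      by (meson norm_ge_zero order_trans)
    then show "AE x in M. norm ((cmod (f x + g x))\<^sup>2)
        \<le> norm (2 * (cmod (f x))\<^sup>2 + 2 * (cmod (g x))\<^sup>2)"
      by simp
  qed
qed

lemma sq_int_uminus: "sq_int M f \<Longrightarrow> sq_int M (\<lambda>x. - f x)"
  using sq_int_scale[of M f "-1"] by simp

lemma sq_int_diff: "sq_int M f \<Longrightarrow> sq_int M g \<Longrightarrow> sq_int M (\<lambda>x. f x - g x)"
  using sq_int_add[OF _ sq_int_uminus, of M f g] by simp

lemmas sq_int_intros = sq_int_add sq_int_diff sq_int_uminus sq_int_scale

lemma integrable_mult_sq_int:
  assumes f: "sq_int M f" and g: "sq_int M g"
  shows "integrable M (\<lambda>x. f x * cnj (g x))"
proof (rule Bochner_Integration.integrable_bound)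
  show "integrable M (\<lambda>x. (cmod (f x))\<^sup>2 + (cmod (g x))\<^sup>2)" using f g by (simp add: sq_int_def)
  have m [measurable]: "f \<in> borel_measurable M" "g \<in> borel_measurable M"
    using f g by (auto simp: sq_int_def)
  have "(\<lambda>x. cnj (g x)) \<in> borel_measurable M"
    by (rule borel_measurable_continuous_on[OF _ m(2)]) (intro continuous_intros)
  then show "(\<lambda>x. f x * cnj (g x)) \<in> borel_measurable M" by measurable
  have "cmod (f x) * cmod (g x) \<le> (cmod (f x))\<^sup>2 + (cmod (g x))\<^sup>2" for x
    using sum_squares_bound[of "cmod (f x)" "cmod (g x)"]
      mult_nonneg_nonneg[OF norm_ge_zero[of "f x"] norm_ge_zero[of "g x"]] by linarith
  then show "AE x in M. norm (f x * cnj (g x)) \<le> norm ((cmod (f x))\<^sup>2 + (cmod (g x))\<^sup>2)"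
    by (simp add: norm_mult)
qed

lemma Riesz_Fischer:
  assumes sq: "\<And>n::nat. sq_int M (f n)"
    and Cau: "\<And>e. e > 0 \<Longrightarrow> \<exists>N. \<forall>m\<ge>N. \<forall>n\<ge>N. (\<integral>x. (cmod (f m x - f n x))\<^sup>2 \<partial>M) < e"
  shows "\<exists>g. sq_int M g \<and> (\<forall>e>0. \<exists>N. \<forall>n\<ge>N. (\<integral>x. (cmod (f n x - g x))\<^sup>2 \<partial>M) \<le> e)"
proof -
  have m [measurable]: "f n \<in> borel_measurable M" for n
    using sq[of n] by (auto simp: sq_int_def)
  have dint: "integrable M (\<lambda>x. (cmod (f m x - f n x))\<^sup>2)" for m n
    using sq_int_diff[OF sq[of m] sq[of n]] by (simp add: sq_int_def)
  define Q where "Q k N \<longleftrightarrow> (\<forall>m\<ge>N. \<forall>n\<ge>N. (\<integral>x. (cmod (f m x - f n x))\<^sup>2 \<partial>M) < (1/4) ^ k)"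
    for k N :: nat
  have "\<exists>N. Q k N" for k
    unfolding Q_def using Cau[of "(1/4) ^ k"] by simp
  then obtain R where R: "\<And>k. Q k (R k)" by metis
  define r where "r k = (\<Sum>i\<le>k. R i) + k" for k
  have r_ge: "r k \<ge> k" for k by (simp add: r_def)
  have rmono: "r k \<ge> R k" for k
    unfolding r_def by (meson atMost_iff finite_atMost le_add1 member_le_sum order_refl order_trans zero_le)
  have rstep: "r (Suc k) \<ge> R k" for k
    using rmono[of k] by (simp add: r_def)
  define d where "d k x = f (r (Suc k)) x - f (r k) x" for k x
  have [measurable]: "d k \<in> borel_measurable M" for k unfolding d_def by measurable
  have dk: "(\<integral>x. (cmod (d k x))\<^sup>2 \<partial>M) \<le> (1/4) ^ k" for k
    using R[of k] rmono[of k] rstep[of k] unfolding Q_def d_def by (intro less_imp_le) blast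
  have nnd: "(\<integral>\<^sup>+ x. ennreal (2 ^ k * (cmod (d k x))\<^sup>2) \<partial>M) \<le> ennreal ((1/2) ^ k)" for k
  proof -
    have "(\<integral>\<^sup>+ x. ennreal (2 ^ k * (cmod (d k x))\<^sup>2) \<partial>M)
        = ennreal (\<integral>x. 2 ^ k * (cmod (d k x))\<^sup>2 \<partial>M)"
      using dint by (intro nn_integral_eq_integral) (auto simp: d_def)
    also have "(\<integral>x. 2 ^ k * (cmod (d k x))\<^sup>2 \<partial>M) \<le> 2 ^ k * (1/4) ^ k"
      using dk[of k] by simp
    also have "(2::real) ^ k * (1/4) ^ k = (1/2) ^ k"
      by (simp flip: power_mult_distrib)
    finally show ?thesis by (simp add: ennreal_leI)
  qed
  have "(\<integral>\<^sup>+ x. (\<Sum>k. ennreal (2 ^ k * (cmod (d k x))\<^sup>2)) \<partial>M)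
      = (\<Sum>k. \<integral>\<^sup>+ x. ennreal (2 ^ k * (cmod (d k x))\<^sup>2) \<partial>M)"
    by (intro nn_integral_suminf) measurable
  also have "\<dots> \<le> (\<Sum>k. ennreal ((1/2) ^ k))"
    by (intro suminf_le nnd) auto
  also have "\<dots> = ennreal (\<Sum>k. (1/2) ^ k)"
    by (intro suminf_ennreal2) (auto simp: summable_geometric)
  also have "\<dots> < \<infinity>" by simp
  finally have "(\<integral>\<^sup>+ x. (\<Sum>k. ennreal (2 ^ k * (cmod (d k x))\<^sup>2)) \<partial>M) \<noteq> \<infinity>" by simp
  then have ae: "AE x in M. (\<Sum>k. ennreal (2 ^ k * (cmod (d k x))\<^sup>2)) \<noteq> \<infinity>"
    by (intro nn_integral_PInf_AE) measurable
  define g where "g x = lim (\<lambda>k. f (r k) x)" for x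
  have g [measurable]: "g \<in> borel_measurable M"
    unfolding g_def by measurable
  have lim: "AE x in M. (\<lambda>k. f (r k) x) \<longlonglongrightarrow> g x"
    using ae
  proof eventually_elim
    case (elim x)
    have s: "summable (\<lambda>k. 2 ^ k * (cmod (d k x))\<^sup>2)"
      by (rule summable_suminf_not_top) (use elim in auto)
    have "summable (\<lambda>k. (1/2) ^ k + 2 ^ k * (cmod (d k x))\<^sup>2)"
      by (intro summable_add s) (simp add: summable_geometric)
    moreover have "cmod (d k x) \<le> (1/2) ^ k + 2 ^ k * (cmod (d k x))\<^sup>2" for k
    proof (cases "cmod (d k x) \<le> (1/2) ^ k")
      case False
      then have "(1/2) ^ k \<le> cmod (d k x)" by simp
      then have "2 ^ k * cmod (d k x) \<ge> 2 ^ k * (1/2) ^ k" by simp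
      also have "(2::real) ^ k * (1/2) ^ k = 1" by (simp flip: power_mult_distrib)
      finally have "1 * cmod (d k x) \<le> (2 ^ k * cmod (d k x)) * cmod (d k x)"
        by (intro mult_right_mono) auto
      then show ?thesis by (simp add: power2_eq_square mult.assoc add_increasing)
    qed (simp add: add_increasing2)
    ultimately have "summable (\<lambda>k. d k x)"
      by (rule summable_comparison_test'[where N=0])
    then have "convergent (\<lambda>n. f (r 0) x + (\<Sum>k<n. d k x))"
      by (intro convergent_add convergent_const) (simp add: summable_iff_convergent)
    moreover have "f (r 0) x + (\<Sum>k<n. d k x) = f (r n) x" for n
      unfolding d_def by (subst sum_lessThan_telescope) simp
    ultimately have "convergent (\<lambda>k. f (r k) x)" by simp
    then show ?case unfolding g_def by (simp add: convergent_LIMSEQ_iff)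
  qed
  have fatou: "integrable M (\<lambda>x. (cmod (f n x - g x))\<^sup>2) \<and> (\<integral>x. (cmod (f n x - g x))\<^sup>2 \<partial>M) \<le> e"
    if e: "\<forall>m\<ge>N. (\<integral>x. (cmod (f n x - f m x))\<^sup>2 \<partial>M) < e" for n N e
  proof -
    have e0: "e \<ge> 0"
    proof -
      have "0 \<le> (\<integral>x. (cmod (f n x - f N x))\<^sup>2 \<partial>M)" by (rule integral_nonneg_AE) simp
      also have "\<dots> \<le> e" using e[rule_format, of N] by simp
      finally show ?thesis .
    qed
    have "(\<integral>\<^sup>+ x. ennreal ((cmod (f n x - g x))\<^sup>2) \<partial>M)
        = (\<integral>\<^sup>+ x. liminf (\<lambda>k. ennreal ((cmod (f n x - f (r k) x))\<^sup>2)) \<partial>M)"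
    proof (rule nn_integral_cong_AE)
      show "AE x in M. ennreal ((cmod (f n x - g x))\<^sup>2)
          = liminf (\<lambda>k. ennreal ((cmod (f n x - f (r k) x))\<^sup>2))"
        using lim
      proof eventually_elim
        case (elim x)
        have "(\<lambda>k. ennreal ((cmod (f n x - f (r k) x))\<^sup>2)) \<longlonglongrightarrow> ennreal ((cmod (f n x - g x))\<^sup>2)"
          by (intro tendsto_ennrealI tendsto_intros elim)
        from lim_imp_Liminf[OF _ this] show ?case by (metis sequentially_bot)
      qed
    qed
    also have "\<dots> \<le> liminf (\<lambda>k. \<integral>\<^sup>+ x. ennreal ((cmod (f n x - f (r k) x))\<^sup>2) \<partial>M)"
      by (rule nn_integral_liminf) measurable
    also have "\<dots> \<le> limsup (\<lambda>k. \<integral>\<^sup>+ x. ennreal ((cmod (f n x - f (r k) x))\<^sup>2) \<partial>M)"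
      by (rule Liminf_le_Limsup) simp
    also have "\<dots> \<le> ennreal e"
    proof (rule Limsup_bounded)
      show "\<forall>\<^sub>F k in sequentially. (\<integral>\<^sup>+ x. ennreal ((cmod (f n x - f (r k) x))\<^sup>2) \<partial>M) \<le> ennreal e"
        unfolding eventually_sequentially
      proof (intro exI[of _ N] allI impI)
        fix k assume "N \<le> k"
        then have "N \<le> r k" using r_ge[of k] by simp
        then show "(\<integral>\<^sup>+ x. ennreal ((cmod (f n x - f (r k) x))\<^sup>2) \<partial>M) \<le> ennreal e"
          using e dint[of n "r k"]
          by (subst nn_integral_eq_integral) (auto intro!: ennreal_leI intro: less_imp_le)
      qed
    qed
    finally have le: "(\<integral>\<^sup>+ x. ennreal ((cmod (f n x - g x))\<^sup>2) \<partial>M) \<le> ennreal e" .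
    have int: "integrable M (\<lambda>x. (cmod (f n x - g x))\<^sup>2)"
    proof (rule integrableI_bounded)
      show "(\<integral>\<^sup>+ x. ennreal (norm ((cmod (f n x - g x))\<^sup>2)) \<partial>M) < \<infinity>"
        using le by (simp add: le_less_trans)
    qed measurable
    moreover have "ennreal (\<integral>x. (cmod (f n x - g x))\<^sup>2 \<partial>M) \<le> ennreal e"
      using le by (subst (asm) nn_integral_eq_integral[OF int]) auto
    ultimately show ?thesis using e0 by (simp add: ennreal_le_iff)
  qed
  have "sq_int M g"
  proof -
    obtain N where "\<forall>m\<ge>N. \<forall>n\<ge>N. (\<integral>x. (cmod (f m x - f n x))\<^sup>2 \<partial>M) < 1" using Cau[of 1] by auto
    with fatou[of N N 1] have "integrable M (\<lambda>x. (cmod (f N x - g x))\<^sup>2)" by blast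
    then have "sq_int M (\<lambda>x. f N x - g x)" by (simp add: sq_int_def)
    from sq_int_diff[OF sq[of N] this] show ?thesis by simp
  qed
  moreover have "\<exists>N. \<forall>n\<ge>N. (\<integral>x. (cmod (f n x - g x))\<^sup>2 \<partial>M) \<le> e" if "e > 0" for e
    using Cau[OF that] fatou by blast
  ultimately show ?thesis by blast
qed

section \<open>The Hilbert space of the crossed product\<close>

definition f2_torus_measure :: "(f2 \<times> torus) measure" where
  "f2_torus_measure = count_space UNIV \<Otimes>\<^sub>M torus_measure"

definition ltwo_rel :: "(f2 \<times> torus \<Rightarrow> complex) \<Rightarrow> (f2 \<times> torus \<Rightarrow> complex) \<Rightarrow> bool" where
  "ltwo_rel \<xi> \<eta> \<longleftrightarrow> sq_int f2_torus_measure \<xi> \<and> sq_int f2_torus_measure \<eta>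
     \<and> (AE z in f2_torus_measure. \<xi> z = \<eta> z)"

lemma ltwo_rel_eqI: "sq_int f2_torus_measure \<xi> \<Longrightarrow> \<xi> = \<eta> \<Longrightarrow> ltwo_rel \<xi> \<eta>"
  by (simp add: ltwo_rel_def)

lemma ltwo_relI_AE:
  assumes "sq_int f2_torus_measure \<xi>" "\<eta> \<in> borel_measurable f2_torus_measure"
    "AE z in f2_torus_measure. \<xi> z = \<eta> z"
  shows "ltwo_rel \<xi> \<eta>"
  using sq_int_cong_AE[OF assms] assms by (simp add: ltwo_rel_def)

text \<open>\<open>ltwo\<close> is the space of square integrable functions on the product of the free group and the
  torus, i.e. the tensor product of the square summable functions on the group and the square
  integrable functions on the torus.\<close>

quotient_type ltwo = "f2 \<times> torus \<Rightarrow> complex" / partial: ltwo_rel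
  morphisms rep_ltwo to_ltwo
proof (rule part_equivpI)
  show "\<exists>\<xi>. ltwo_rel \<xi> \<xi>" by (rule exI[of _ "\<lambda>z. 0"]) (simp add: ltwo_rel_def)
  show "symp ltwo_rel" by (auto simp: symp_def ltwo_rel_def)
  show "transp ltwo_rel" unfolding transp_def ltwo_rel_def by fastforce
qed

lemma ltwo_integral_cong:
  assumes "ltwo_rel \<xi> \<xi>'" "ltwo_rel \<eta> \<eta>'"
  shows "(\<integral>z. \<xi> z * cnj (\<eta> z) \<partial>f2_torus_measure) = (\<integral>z. \<xi>' z * cnj (\<eta>' z) \<partial>f2_torus_measure)"
proof (rule integral_cong_AE)
  show "(\<lambda>z. \<xi> z * cnj (\<eta> z)) \<in> borel_measurable f2_torus_measure"
    "(\<lambda>z. \<xi>' z * cnj (\<eta>' z)) \<in> borel_measurable f2_torus_measure"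
    using assms by (auto simp: ltwo_rel_def intro!: borel_measurable_integrable integrable_mult_sq_int)
  have "AE z in f2_torus_measure. \<xi> z = \<xi>' z" "AE z in f2_torus_measure. \<eta> z = \<eta>' z"
    using assms by (auto simp: ltwo_rel_def)
  then show "AE z in f2_torus_measure. \<xi> z * cnj (\<eta> z) = \<xi>' z * cnj (\<eta>' z)"
    by eventually_elim simp
qed

lemma Re_integral_commute: 
  "Re (\<integral>z. \<xi> z * cnj (\<eta> z) \<partial>M) = Re (\<integral>z. \<eta> z * cnj (\<xi> z) \<partial>M)"
proof -
  have "(\<integral>z. \<xi> z * cnj (\<eta> z) \<partial>M) = cnj (\<integral>z. \<eta> z * cnj (\<xi> z) \<partial>M)"
    by (simp flip: Bochner_Integration.integral_cnj add: mult.commute)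
  then show ?thesis by simp
qed

lemma Re_integral_self: "Re (\<integral>z. \<xi> z * cnj (\<xi> z) \<partial>M) = (\<integral>z. (cmod (\<xi> z))\<^sup>2 \<partial>M)"
  by (simp add: complex_norm_square[symmetric] flip: of_real_power)

lemma Re_integral_self_eq_0:
  assumes "sq_int M \<xi>"
  shows "(\<integral>z. (cmod (\<xi> z))\<^sup>2 \<partial>M) = 0 \<longleftrightarrow> (AE z in M. \<xi> z = 0)"
  using assms by (subst integral_nonneg_eq_0_iff_AE) (auto simp: sq_int_def)

instantiation ltwo :: real_inner
begin

lift_definition zero_ltwo :: ltwo is "\<lambda>z. 0" by (simp add: ltwo_rel_def)

lift_definition plus_ltwo :: "ltwo \<Rightarrow> ltwo \<Rightarrow> ltwo" is "\<lambda>\<xi> \<eta> z. \<xi> z + \<eta> z"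
  by (auto simp: ltwo_rel_def intro: sq_int_add)

lift_definition minus_ltwo :: "ltwo \<Rightarrow> ltwo \<Rightarrow> ltwo" is "\<lambda>\<xi> \<eta> z. \<xi> z - \<eta> z"
  by (auto simp: ltwo_rel_def intro: sq_int_diff)

lift_definition uminus_ltwo :: "ltwo \<Rightarrow> ltwo" is "\<lambda>\<xi> z. - \<xi> z"
  by (auto simp: ltwo_rel_def intro: sq_int_uminus)

lift_definition scaleR_ltwo :: "real \<Rightarrow> ltwo \<Rightarrow> ltwo" is "\<lambda>r \<xi> z. of_real r * \<xi> z"
  by (auto simp: ltwo_rel_def intro: sq_int_scale)

lift_definition inner_ltwo :: "ltwo \<Rightarrow> ltwo \<Rightarrow> real"
  is "\<lambda>\<xi> \<eta>. Re (\<integral>z. \<xi> z * cnj (\<eta> z) \<partial>f2_torus_measure)"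
  by (rule arg_cong[where f=Re]) (rule ltwo_integral_cong)

definition norm_ltwo :: "ltwo \<Rightarrow> real" where "norm_ltwo x = sqrt (inner x x)"

definition sgn_ltwo :: "ltwo \<Rightarrow> ltwo" where "sgn_ltwo x = scaleR (inverse (norm x)) x"

definition dist_ltwo :: "ltwo \<Rightarrow> ltwo \<Rightarrow> real" where "dist_ltwo x y = norm (x - y)"

definition uniformity_ltwo :: "(ltwo \<times> ltwo) filter" where
  "uniformity_ltwo = (INF e\<in>{0 <..}. principal {(x, y). dist x y < e})"

definition open_ltwo :: "ltwo set \<Rightarrow> bool" where
  "open_ltwo U = (\<forall>x\<in>U. eventually (\<lambda>(x', y). x' = x \<longrightarrow> y \<in> U) uniformity)"

instance
proof
  fix a b c :: ltwo and r s :: real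
  show "a + b + c = a + (b + c)"
    by (transfer, rule ltwo_rel_eqI, force simp: ltwo_rel_def intro: sq_int_intros,
        simp add: fun_eq_iff algebra_simps)
  show "a + b = b + a"
    by (transfer, rule ltwo_rel_eqI, force simp: ltwo_rel_def intro: sq_int_intros,
        simp add: fun_eq_iff algebra_simps)
  show "0 + a = a"
    by (transfer, rule ltwo_rel_eqI, force simp: ltwo_rel_def intro: sq_int_intros,
        simp add: fun_eq_iff algebra_simps)
  show "- a + a = 0"
    by (transfer, rule ltwo_rel_eqI, force simp: ltwo_rel_def intro: sq_int_intros,
        simp add: fun_eq_iff algebra_simps)
  show "a - b = a + - b"
    by (transfer, rule ltwo_rel_eqI, force simp: ltwo_rel_def intro: sq_int_intros,
        simp add: fun_eq_iff algebra_simps)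
  show "r *\<^sub>R (a + b) = r *\<^sub>R a + r *\<^sub>R b"
    by (transfer, rule ltwo_rel_eqI, force simp: ltwo_rel_def intro: sq_int_intros,
        simp add: fun_eq_iff algebra_simps)
  show "(r + s) *\<^sub>R a = r *\<^sub>R a + s *\<^sub>R a"
    by (transfer, rule ltwo_rel_eqI, force simp: ltwo_rel_def intro: sq_int_intros,
        simp add: fun_eq_iff algebra_simps)
  show "r *\<^sub>R s *\<^sub>R a = (r * s) *\<^sub>R a"
    by (transfer, rule ltwo_rel_eqI, force simp: ltwo_rel_def intro: sq_int_intros,
        simp add: fun_eq_iff algebra_simps)
  show "1 *\<^sub>R a = a"
    by (transfer, rule ltwo_rel_eqI, force simp: ltwo_rel_def intro: sq_int_intros,
        simp add: fun_eq_iff algebra_simps)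
  show "inner a b = inner b a"
    by transfer (rule Re_integral_commute; simp add: ltwo_rel_def)
  show "inner (a + b) c = inner a c + inner b c"
    by transfer (simp add: ltwo_rel_def algebra_simps integrable_mult_sq_int)
  show "inner (r *\<^sub>R a) b = r * inner a b"
    by transfer (simp add: ltwo_rel_def mult.assoc integrable_mult_sq_int)
  show "0 \<le> inner a a"
    by transfer (simp add: Re_integral_self ltwo_rel_def)
  show "(inner a a = 0) = (a = 0)"
    by transfer (simp add: Re_integral_self ltwo_rel_def Re_integral_self_eq_0)
qed (simp_all add: norm_ltwo_def sgn_ltwo_def dist_ltwo_def uniformity_ltwo_def open_ltwo_def)

end

lemma to_ltwo_eqI: "ltwo_rel \<xi> \<eta> \<Longrightarrow> to_ltwo \<xi> = to_ltwo \<eta>"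
  using Quotient_rel_abs[OF Quotient_ltwo] by blast

lemma ltwo_rel_rep: "ltwo_rel (rep_ltwo x) (rep_ltwo x)"
  using Quotient_rep_reflp[OF Quotient_ltwo] by blast

lemma sq_int_rep_ltwo: "sq_int f2_torus_measure (rep_ltwo x)"
  using ltwo_rel_rep[of x] by (simp add: ltwo_rel_def)

lemma to_ltwo_rep: "to_ltwo (rep_ltwo x) = x"
  using Quotient_abs_rep[OF Quotient_ltwo] by blast

lemma rep_to_ltwo: "sq_int f2_torus_measure \<xi> \<Longrightarrow> ltwo_rel (rep_ltwo (to_ltwo \<xi>)) \<xi>"
  by (rule Quotient_rep_abs[OF Quotient_ltwo]) (simp add: ltwo_rel_def)

lemma ltwo_rel_self: "sq_int f2_torus_measure \<xi> \<Longrightarrow> ltwo_rel \<xi> \<xi>"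
  by (simp add: ltwo_rel_def)

lemma minus_to_ltwo:
  assumes "sq_int f2_torus_measure \<xi>" "sq_int f2_torus_measure \<eta>"
  shows "to_ltwo \<xi> - to_ltwo \<eta> = to_ltwo (\<lambda>z. \<xi> z - \<eta> z)"
  using assms by (intro minus_ltwo.abs_eq ltwo_rel_self)

lemma norm_to_ltwo:
  assumes "sq_int f2_torus_measure \<xi>"
  shows "(norm (to_ltwo \<xi>))\<^sup>2 = (\<integral>z. (cmod (\<xi> z))\<^sup>2 \<partial>f2_torus_measure)"
  by (simp add: power2_norm_eq_inner inner_ltwo.abs_eq ltwo_rel_self assms Re_integral_self)

instantiation ltwo :: complex_hilbert
begin

lift_definition scaleC_ltwo :: "complex \<Rightarrow> ltwo \<Rightarrow> ltwo" is "\<lambda>c \<xi> z. c * \<xi> z"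
  by (auto simp: ltwo_rel_def intro: sq_int_scale)

lift_definition cinner_ltwo :: "ltwo \<Rightarrow> ltwo \<Rightarrow> complex"
  is "\<lambda>\<xi> \<eta>. \<integral>z. \<xi> z * cnj (\<eta> z) \<partial>f2_torus_measure"
  by (rule ltwo_integral_cong)

instance
proof
  fix a b x y z :: ltwo and c d :: complex and r :: real
  show "c *\<^sub>C (x + y) = c *\<^sub>C x + c *\<^sub>C y"
    by (transfer, rule ltwo_rel_eqI, force simp: ltwo_rel_def intro: sq_int_intros,
        simp add: fun_eq_iff algebra_simps)
  show "(c + d) *\<^sub>C x = c *\<^sub>C x + d *\<^sub>C x"
    by (transfer, rule ltwo_rel_eqI, force simp: ltwo_rel_def intro: sq_int_intros,
        simp add: fun_eq_iff algebra_simps)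
  show "c *\<^sub>C d *\<^sub>C x = (c * d) *\<^sub>C x"
    by (transfer, rule ltwo_rel_eqI, force simp: ltwo_rel_def intro: sq_int_intros,
        simp add: fun_eq_iff algebra_simps)
  show "r *\<^sub>R x = complex_of_real r *\<^sub>C x"
    by (transfer, rule ltwo_rel_eqI, force simp: ltwo_rel_def intro: sq_int_intros,
        simp add: fun_eq_iff algebra_simps)
  show "cinner x y = cnj (cinner y x)"
    by transfer (simp flip: Bochner_Integration.integral_cnj add: mult.commute)
  show "cinner (x + y) z = cinner x z + cinner y z"
    by transfer (simp add: ltwo_rel_def algebra_simps integrable_mult_sq_int)
  show "cinner (c *\<^sub>C x) y = c * cinner x y"
    by transfer (simp add: mult.assoc)
  show "inner x y = Re (cinner x y)"
    by transfer simp
next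
  fix X :: "nat \<Rightarrow> ltwo"
  assume X: "Cauchy X"
  define f where "f n = rep_ltwo (X n)" for n
  have sq: "sq_int f2_torus_measure (f n)" for n by (simp add: f_def sq_int_rep_ltwo)
  have Xf: "X n = to_ltwo (f n)" for n by (simp add: f_def to_ltwo_rep)
  have nrm: "(norm (X m - to_ltwo g))\<^sup>2 = (\<integral>z. (cmod (f m z - g z))\<^sup>2 \<partial>f2_torus_measure)"
    if "sq_int f2_torus_measure g" for m g
    using that sq by (simp add: Xf minus_to_ltwo norm_to_ltwo sq_int_diff)
  have "\<exists>N. \<forall>m\<ge>N. \<forall>n\<ge>N. (\<integral>z. (cmod (f m z - f n z))\<^sup>2 \<partial>f2_torus_measure) < e"
    if e: "e > 0" for e
  proof -
    obtain N where N: "\<forall>m\<ge>N. \<forall>n\<ge>N. dist (X m) (X n) < sqrt e"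
      using metric_CauchyD[OF X, of "sqrt e"] e by auto
    have "(norm (X m - X n))\<^sup>2 < e" if "m \<ge> N" "n \<ge> N" for m n
    proof -
      have "(norm (X m - X n))\<^sup>2 < (sqrt e)\<^sup>2"
        using N that by (intro power_strict_mono) (auto simp: dist_norm)
      then show ?thesis using e by simp
    qed
    moreover have "(norm (X m - X n))\<^sup>2 = (\<integral>z. (cmod (f m z - f n z))\<^sup>2 \<partial>f2_torus_measure)" for m n
      using nrm[OF sq, of m n] by (simp only: Xf[of n])
    ultimately show ?thesis by auto
  qed
  from Riesz_Fischer[OF sq this] obtain g where g: "sq_int f2_torus_measure g"
    and lim: "\<And>e. e > 0 \<Longrightarrow> \<exists>N. \<forall>n\<ge>N. (\<integral>z. (cmod (f n z - g z))\<^sup>2 \<partial>f2_torus_measure) \<le> e"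
    by blast
  have "X \<longlonglongrightarrow> to_ltwo g"
  proof (rule metric_LIMSEQ_I)
    fix e :: real assume e: "e > 0"
    then have "(e / 2)\<^sup>2 > 0" by simp
    from lim[OF this] obtain N where N: "\<forall>n\<ge>N. (norm (X n - to_ltwo g))\<^sup>2 \<le> (e / 2)\<^sup>2"
      unfolding nrm[OF g] by blast
    have "norm (X n - to_ltwo g) \<le> e / 2" if "n \<ge> N" for n
      by (rule power2_le_imp_le) (use N that e in auto)
    then have "dist (X n) (to_ltwo g) < e" if "n \<ge> N" for n
      using e le_less_trans[of "norm (X n - to_ltwo g)" "e / 2" e] that unfolding dist_norm by simp
    then show "\<exists>N. \<forall>n\<ge>N. dist (X n) (to_ltwo g) < e" by blast
  qed
  then show "convergent X" by (rule convergentI)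
qed

end

section \<open>Operators and von Neumann algebras\<close>

lemma scaleC_zero_right [simp]: "c *\<^sub>C (0 :: 'h :: complex_hilbert) = 0"
  using scaleC_add_right[of c "0 :: 'h" 0] by simp

lemma cinner_scaleC_right: "cinner (x :: 'h :: complex_hilbert) (c *\<^sub>C y) = cnj c * cinner x y"
  by (metis cinner_commute cinner_scaleC_left complex_cnj_mult)

lemma cinner_self: "cinner (x :: 'h :: complex_hilbert) x = of_real ((norm x)\<^sup>2)"
proof -
  have "Im (cinner x x) = - Im (cinner x x)"
    using arg_cong[OF cinner_commute[of x x], of Im] by simp
  then show ?thesis
    by (intro complex_eqI) (simp_all add: power2_norm_eq_inner inner_cinner)
qed

lemma norm_scaleC: "norm (c *\<^sub>C (x :: 'h :: complex_hilbert)) = cmod c * norm x"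
proof -
  have "of_real ((norm (c *\<^sub>C x))\<^sup>2) = (c * cnj c) * of_real ((norm x)\<^sup>2)"
    by (simp only: cinner_self[symmetric] cinner_scaleC_left cinner_scaleC_right mult_ac)
  also have "\<dots> = complex_of_real ((cmod c * norm x)\<^sup>2)"
    by (simp add: complex_norm_square[symmetric] power_mult_distrib)
  finally have "(norm (c *\<^sub>C x))\<^sup>2 = (cmod c * norm x)\<^sup>2" by (simp only: of_real_eq_iff)
  then show ?thesis by (simp add: power2_eq_iff_nonneg)
qed

lemma bounded_linear_scaleC: "bounded_linear (\<lambda>x :: 'h :: complex_hilbert. c *\<^sub>C x)"
proof (rule bounded_linear_intro[where K="cmod c"])
  fix x y :: 'h and r :: real
  show "c *\<^sub>C (x + y) = c *\<^sub>C x + c *\<^sub>C y" by (rule scaleC_add_right)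
  show "c *\<^sub>C (r *\<^sub>R x) = r *\<^sub>R (c *\<^sub>C x)" by (simp add: scaleR_scaleC scaleC_scaleC mult.commute)
  show "norm (c *\<^sub>C x) \<le> norm x * cmod c" by (simp add: norm_scaleC)
qed

type_synonym 'h op = "'h \<Rightarrow>\<^sub>L 'h"

definition bounded_ops :: "'h::complex_hilbert op set" where
  "bounded_ops = {T. \<forall>c x. blinfun_apply T (c *\<^sub>C x) = c *\<^sub>C blinfun_apply T x}"

text \<open>The adjoint is unique by \<open>adj_eqI\<close> below, and exists for every element of \<open>bounded_ops\<close> by
  the Riesz representation theorem.\<close>

definition adj :: "'h::complex_hilbert op \<Rightarrow> 'h op" where
  "adj T = (THE S. \<forall>x y. cinner (blinfun_apply T x) y = cinner x (blinfun_apply S y))"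

definition cscale :: "complex \<Rightarrow> 'h::complex_hilbert op \<Rightarrow> 'h op" where
  "cscale c T = Blinfun (\<lambda>x. c *\<^sub>C blinfun_apply T x)"

lemma cinner_eqI:
  assumes "\<And>x :: 'h :: complex_hilbert. cinner x y = cinner x z"
  shows "y = z"
proof -
  have "inner (y - z) y = inner (y - z) z" by (simp add: inner_cinner assms)
  then have "inner (y - z) (y - z) = 0" by (simp add: inner_diff_right)
  then show ?thesis by simp
qed

lemma adj_eqI:
  assumes "\<And>x y. cinner (blinfun_apply T x) y = cinner x (blinfun_apply S y)"
  shows "adj T = S"
  unfolding adj_def
proof (rule the_equality)
  show "\<forall>x y. cinner (blinfun_apply T x) y = cinner x (blinfun_apply S y)" using assms by blast
next
  fix S' assume "\<forall>x y. cinner (blinfun_apply T x) y = cinner x (blinfun_apply S' y)"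
  then show "S' = S" by (intro blinfun_eqI cinner_eqI) (metis assms)
qed

lemma blinfun_apply_cscale [simp]: "blinfun_apply (cscale c T) x = c *\<^sub>C blinfun_apply T x"
  unfolding cscale_def
  by (subst bounded_linear_Blinfun_apply)
     (auto intro: bounded_linear_compose[OF bounded_linear_scaleC] blinfun.bounded_linear_right)

definition commutant :: "'h::complex_hilbert op set \<Rightarrow> 'h op set" where
  "commutant S = {T \<in> bounded_ops. \<forall>A\<in>S. T o\<^sub>L A = A o\<^sub>L T}"

definition von_neumann_algebra :: "'h::complex_hilbert op set \<Rightarrow> bool" where
  "von_neumann_algebra M \<longleftrightarrow>
     M \<subseteq> bounded_ops \<and> (\<forall>x\<in>M. adj x \<in> M) \<and> commutant (commutant M) = M"

definition vn_generated :: "'h::complex_hilbert op set \<Rightarrow> 'h op set" where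
  "vn_generated S = \<Inter>{M. von_neumann_algebra M \<and> S \<subseteq> M}"

definition unitaries :: "'h::complex_hilbert op set \<Rightarrow> 'h op set" where
  "unitaries M = {u \<in> M. adj u o\<^sub>L u = id_blinfun \<and> u o\<^sub>L adj u = id_blinfun}"

definition Ad :: "'h::complex_hilbert op \<Rightarrow> 'h op \<Rightarrow> 'h op" where
  "Ad u x = u o\<^sub>L x o\<^sub>L adj u"

text \<open>Maps on \<open>M\<close> are modelled by functions on all operators whose values outside \<open>M\<close> are
  irrelevant.\<close>

definition automorphisms :: "'h::complex_hilbert op set \<Rightarrow> ('h op \<Rightarrow> 'h op) set" where
  "automorphisms M = {\<sigma>. bij_betw \<sigma> M M
     \<and> (\<forall>x\<in>M. \<forall>y\<in>M. \<sigma> (x + y) = \<sigma> x + \<sigma> y \<and> \<sigma> (x o\<^sub>L y) = \<sigma> x o\<^sub>L \<sigma> y)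
     \<and> (\<forall>c. \<forall>x\<in>M. \<sigma> (cscale c x) = cscale c (\<sigma> x))
     \<and> (\<forall>x\<in>M. \<sigma> (adj x) = adj (\<sigma> x))}"

text \<open>The predual consists of the functionals that are continuous for the sigma-weak topology.\<close>

definition predual :: "'h::complex_hilbert op set \<Rightarrow> ('h op \<Rightarrow> complex) set" where
  "predual M = {\<phi>. \<exists>\<xi> \<eta> :: nat \<Rightarrow> 'h.
     summable (\<lambda>k. (norm (\<xi> k))\<^sup>2) \<and> summable (\<lambda>k. (norm (\<eta> k))\<^sup>2)
     \<and> (\<forall>x\<in>M. \<phi> x = (\<Sum>k. cinner (blinfun_apply x (\<xi> k)) (\<eta> k)))}"

definition functional_norm :: "'h::complex_hilbert op set \<Rightarrow> ('h op \<Rightarrow> complex) \<Rightarrow> real" where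
  "functional_norm M \<phi> = (SUP x\<in>{x \<in> M. norm x \<le> 1}. cmod (\<phi> x))"

definition faithful_normal_state ::
    "'h::complex_hilbert op set \<Rightarrow> ('h op \<Rightarrow> complex) \<Rightarrow> bool" where
  "faithful_normal_state M \<phi> \<longleftrightarrow> \<phi> \<in> predual M \<and> \<phi> id_blinfun = 1
     \<and> (\<forall>x\<in>M. \<phi> (adj x o\<^sub>L x) \<in> \<real>\<^sub>\<ge>\<^sub>0) \<and> (\<forall>x\<in>M. \<phi> (adj x o\<^sub>L x) = 0 \<longrightarrow> x = 0)"

definition sharp_norm :: "('h::complex_hilbert op \<Rightarrow> complex) \<Rightarrow> 'h op \<Rightarrow> real" where
  "sharp_norm \<phi> x = sqrt (Re (\<phi> (adj x o\<^sub>L x) + \<phi> (x o\<^sub>L adj x)))"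

text \<open>The closure of the inner automorphisms is taken in the usual topology of the automorphism
  group, that of pointwise norm convergence on the predual.\<close>

definition approximately_inner :: "'h::complex_hilbert op set \<Rightarrow> ('h op \<Rightarrow> 'h op) \<Rightarrow> bool" where
  "approximately_inner M \<sigma> \<longleftrightarrow> \<sigma> \<in> automorphisms M
     \<and> (\<forall>F \<epsilon>. finite F \<and> F \<subseteq> predual M \<and> \<epsilon> > 0 \<longrightarrow>
          (\<exists>u\<in>unitaries M. \<forall>\<phi>\<in>F. functional_norm M (\<lambda>x. \<phi> (\<sigma> x) - \<phi> (Ad u x)) < \<epsilon>))"

section \<open>Flows and cocycle conjugacy\<close>

definition flow :: "'h::complex_hilbert op set \<Rightarrow> (real \<Rightarrow> 'h op \<Rightarrow> 'h op) \<Rightarrow> bool" where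
  "flow M \<theta> \<longleftrightarrow> (\<forall>t. \<theta> t \<in> automorphisms M)
     \<and> (\<forall>s t. \<forall>x\<in>M. \<theta> (s + t) x = \<theta> s (\<theta> t x))
     \<and> (\<forall>x\<in>M. \<forall>\<xi>. continuous_on UNIV (\<lambda>t. blinfun_apply (\<theta> t x) \<xi>))"

definition cocycle ::
    "'h::complex_hilbert op set \<Rightarrow> (real \<Rightarrow> 'h op \<Rightarrow> 'h op) \<Rightarrow> (real \<Rightarrow> 'h op) \<Rightarrow> bool" where
  "cocycle M \<theta> u \<longleftrightarrow> (\<forall>t. u t \<in> unitaries M)
     \<and> (\<forall>s t. u (s + t) = u s o\<^sub>L \<theta> s (u t))
     \<and> (\<forall>\<xi>. continuous_on UNIV (\<lambda>t. blinfun_apply (u t) \<xi>))"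

definition conjugates :: "'h::complex_hilbert op set \<Rightarrow> (real \<Rightarrow> 'h op \<Rightarrow> 'h op)
    \<Rightarrow> (real \<Rightarrow> 'h op \<Rightarrow> 'h op) \<Rightarrow> (real \<Rightarrow> 'h op) \<Rightarrow> ('h op \<Rightarrow> 'h op) \<Rightarrow> bool" where
  "conjugates M \<theta>1 \<theta>2 u \<sigma> \<longleftrightarrow> cocycle M \<theta>2 u \<and> \<sigma> \<in> automorphisms M
     \<and> (\<forall>t. \<forall>x\<in>M. Ad (u t) (\<theta>2 t x) = \<sigma> (\<theta>1 t (inv_into M \<sigma> x)))"

definition cocycle_conjugate :: "'h::complex_hilbert op set \<Rightarrow> (real \<Rightarrow> 'h op \<Rightarrow> 'h op)
    \<Rightarrow> (real \<Rightarrow> 'h op \<Rightarrow> 'h op) \<Rightarrow> bool" where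
  "cocycle_conjugate M \<theta>1 \<theta>2 \<longleftrightarrow> (\<exists>u \<sigma>. conjugates M \<theta>1 \<theta>2 u \<sigma>)"

definition strongly_cocycle_conjugate :: "'h::complex_hilbert op set
    \<Rightarrow> (real \<Rightarrow> 'h op \<Rightarrow> 'h op) \<Rightarrow> (real \<Rightarrow> 'h op \<Rightarrow> 'h op) \<Rightarrow> bool" where
  "strongly_cocycle_conjugate M \<theta>1 \<theta>2 \<longleftrightarrow>
     (\<exists>u \<sigma>. conjugates M \<theta>1 \<theta>2 u \<sigma> \<and> approximately_inner M \<sigma>)"

section \<open>The central sequence algebra and the Rohlin property\<close>

text \<open>An ultrafilter is given by the filter of the properties that hold on one of its members.\<close>

definition free_ultrafilter :: "nat filter \<Rightarrow> bool" where
  "free_ultrafilter \<omega> \<longleftrightarrow> \<omega> \<noteq> bot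
     \<and> (\<forall>P. eventually P \<omega> \<or> eventually (\<lambda>n. \<not> P n) \<omega>)
     \<and> (\<forall>k. eventually (\<lambda>n. n \<noteq> k) \<omega>)"

definition bounded_seqs :: "'h::complex_hilbert op set \<Rightarrow> (nat \<Rightarrow> 'h op) set" where
  "bounded_seqs M = {x. range x \<subseteq> M \<and> bounded (range x)}"

definition null_seqs ::
    "nat filter \<Rightarrow> 'h::complex_hilbert op set \<Rightarrow> (nat \<Rightarrow> 'h op) set" where
  "null_seqs \<omega> M = {x \<in> bounded_seqs M. \<forall>\<xi>.
     ((\<lambda>n. blinfun_apply (x n) \<xi>) \<longlongrightarrow> 0) \<omega> \<and> ((\<lambda>n. blinfun_apply (adj (x n)) \<xi>) \<longlongrightarrow> 0) \<omega>}"

text \<open>\<open>[\<phi>, x]\<close> is the functional sending \<open>y\<close> to \<open>\<phi> (x y) - \<phi> (y x)\<close>.\<close>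

definition central_seqs ::
    "nat filter \<Rightarrow> 'h::complex_hilbert op set \<Rightarrow> (nat \<Rightarrow> 'h op) set" where
  "central_seqs \<omega> M = {x \<in> bounded_seqs M. \<forall>\<phi>\<in>predual M.
     ((\<lambda>n. functional_norm M (\<lambda>y. \<phi> (x n o\<^sub>L y) - \<phi> (y o\<^sub>L x n))) \<longlongrightarrow> 0) \<omega>}"

text \<open>Elements of the quotient are classes of sequences; operations are performed on
  representatives.\<close>

definition seq_class ::
    "nat filter \<Rightarrow> 'h::complex_hilbert op set \<Rightarrow> (nat \<Rightarrow> 'h op) \<Rightarrow> (nat \<Rightarrow> 'h op) set" where
  "seq_class \<omega> M x = {y \<in> central_seqs \<omega> M. (\<lambda>n. y n - x n) \<in> null_seqs \<omega> M}"

definition central_algebra ::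
    "nat filter \<Rightarrow> 'h::complex_hilbert op set \<Rightarrow> (nat \<Rightarrow> 'h op) set set" where
  "central_algebra \<omega> M = seq_class \<omega> M ` central_seqs \<omega> M"

definition class_one :: "nat filter \<Rightarrow> 'h::complex_hilbert op set \<Rightarrow> (nat \<Rightarrow> 'h op) set" where
  "class_one \<omega> M = seq_class \<omega> M (\<lambda>n. id_blinfun)"

definition class_mult :: "nat filter \<Rightarrow> 'h::complex_hilbert op set
    \<Rightarrow> (nat \<Rightarrow> 'h op) set \<Rightarrow> (nat \<Rightarrow> 'h op) set \<Rightarrow> (nat \<Rightarrow> 'h op) set" where
  "class_mult \<omega> M U V = (\<Union>x\<in>U. \<Union>y\<in>V. seq_class \<omega> M (\<lambda>n. x n o\<^sub>L y n))"

text \<open>For a map \<open>f\<close> on operators, e.g. the adjoint, a scalar multiplication or an automorphism.\<close>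

definition class_map :: "nat filter \<Rightarrow> 'h::complex_hilbert op set \<Rightarrow> ('h op \<Rightarrow> 'h op)
    \<Rightarrow> (nat \<Rightarrow> 'h op) set \<Rightarrow> (nat \<Rightarrow> 'h op) set" where
  "class_map \<omega> M f U = (\<Union>x\<in>U. seq_class \<omega> M (\<lambda>n. f (x n)))"

definition class_unitaries ::
    "nat filter \<Rightarrow> 'h::complex_hilbert op set \<Rightarrow> (nat \<Rightarrow> 'h op) set set" where
  "class_unitaries \<omega> M = {U \<in> central_algebra \<omega> M.
     class_mult \<omega> M (class_map \<omega> M adj U) U = class_one \<omega> M
     \<and> class_mult \<omega> M U (class_map \<omega> M adj U) = class_one \<omega> M}"

text \<open>The condition below does not depend on the representative \<open>x\<close> of the class, nor on the choice
  of the faithful normal state \<open>\<phi>\<close>.\<close>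

definition equicontinuous_part :: "nat filter \<Rightarrow> ('h::complex_hilbert op \<Rightarrow> complex) \<Rightarrow> 'h op set
    \<Rightarrow> (real \<Rightarrow> 'h op \<Rightarrow> 'h op) \<Rightarrow> (nat \<Rightarrow> 'h op) set set" where
  "equicontinuous_part \<omega> \<phi> M \<theta> = {U \<in> central_algebra \<omega> M. \<exists>x\<in>U.
     \<forall>\<epsilon>>0. \<exists>\<delta>>0. \<forall>\<^sub>F n in \<omega>. \<forall>t. \<bar>t\<bar> < \<delta> \<longrightarrow> sharp_norm \<phi> (\<theta> t (x n) - x n) < \<epsilon>}"

definition rohlin_property :: "nat filter \<Rightarrow> ('h::complex_hilbert op \<Rightarrow> complex) \<Rightarrow> 'h op set
    \<Rightarrow> (real \<Rightarrow> 'h op \<Rightarrow> 'h op) \<Rightarrow> bool" where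
  "rohlin_property \<omega> \<phi> M \<theta> \<longleftrightarrow>
     (\<forall>p::real. \<exists>U \<in> equicontinuous_part \<omega> \<phi> M \<theta> \<inter> class_unitaries \<omega> M.
        \<forall>t. class_map \<omega> M (\<theta> t) U = class_map \<omega> M (cscale (exp (- \<i> * of_real (p * t)))) U)"

section \<open>The crossed product and its flows\<close>

text \<open>Every class in \<open>L\<^sup>\<infinity>\<close> of the torus has a representative that is bounded everywhere.\<close>

definition linf :: "(torus \<Rightarrow> complex) set" where
  "linf = {f \<in> borel_measurable torus_measure. bounded (range f)}"

definition alpha :: "(torus \<Rightarrow> complex) \<Rightarrow> torus \<Rightarrow> complex" where
  "alpha f = (\<lambda>(r, s). f (r - to_circle (1 / sqrt 2), s - to_circle (1 / sqrt 3)))"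

text \<open>The covariant representation on \<open>ltwo\<close>: \<open>f\<close> in \<open>linf\<close> acts by
  \<open>(\<pi>(f) \<xi>)(g, x) = ((\<alpha>*\<alpha>)(g\<inverse>)(f))(x) \<xi>(g, x)\<close>, and \<open>h\<close> in the group by
  \<open>(\<lambda>\<^sub>h \<xi>)(g, x) = \<xi>(h\<inverse> g, x)\<close>.\<close>

definition cp_pi :: "(torus \<Rightarrow> complex) \<Rightarrow> ltwo op" where
  "cp_pi f = Blinfun (\<lambda>\<xi>. to_ltwo (\<lambda>(g, x).
     free_action alpha alpha (f2_inv g) f x * rep_ltwo \<xi> (g, x)))"

definition cp_lambda :: "f2 \<Rightarrow> ltwo op" where
  "cp_lambda h = Blinfun (\<lambda>\<xi>. to_ltwo (\<lambda>(g, x). rep_ltwo \<xi> (f2_inv h * g, x)))"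

definition crossed_product :: "ltwo op set" where
  "crossed_product = vn_generated (cp_pi ` linf \<union> range cp_lambda)"

text \<open>The two generators, and functions on the torus, generate the crossed product, and automorphisms
  of von Neumann algebras are normal; hence \<open>theta_flow\<close> determines \<open>\<theta>\<close> on the crossed product. The
  parameters \<open>l\<close>, \<open>m\<close> are the phase speeds \<open>\<lambda>\<close>, \<open>\<mu>\<close> on \<open>a\<close>, \<open>b\<close>.\<close>

definition theta_flow ::
    "real \<Rightarrow> real \<Rightarrow> real \<Rightarrow> real \<Rightarrow> (real \<Rightarrow> ltwo op \<Rightarrow> ltwo op) \<Rightarrow> bool" where
  "theta_flow l m p q \<theta> \<longleftrightarrow> flow crossed_product \<theta>
     \<and> (\<forall>t. (\<forall>f\<in>linf. \<theta> t (cp_pi f)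
              = cp_pi (\<lambda>(r, s). f (r - to_circle (p * t), s - to_circle (q * t))))
          \<and> \<theta> t (cp_lambda f2_a) = cscale (exp (\<i> * of_real (l * t))) (cp_lambda f2_a)
          \<and> \<theta> t (cp_lambda f2_b) = cscale (exp (\<i> * of_real (m * t))) (cp_lambda f2_b))"

subsection \<open>The operators are well defined and covariant\<close>

lemma alpha_translation:
  "alpha f = (\<lambda>x. f (x - (to_circle (1 / sqrt 2), to_circle (1 / sqrt 3))))"
  by (auto simp: alpha_def fun_eq_iff)

lemma bij_alpha: "bij alpha"
proof (rule o_bij[where g="\<lambda>f x. f (x + (to_circle (1 / sqrt 2), to_circle (1 / sqrt 3)))"])
qed (simp_all add: alpha_translation fun_eq_iff)

lemma inv_alpha:
  "inv alpha = (\<lambda>f x. f (x + (to_circle (1 / sqrt 2), to_circle (1 / sqrt 3))))"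
  by (rule inv_equality) (simp_all add: alpha_translation)

lemma free_action_alpha_translation: "\<exists>c. free_action alpha alpha g = (\<lambda>f x. f (x - c))"
proof -
  let ?c = "(to_circle (1 / sqrt 2), to_circle (1 / sqrt 3))"
  have a: "alpha = (\<lambda>f x. f (x - ?c))" by (simp add: alpha_translation fun_eq_iff)
  have letter: "\<exists>c. letter_action alpha alpha l = (\<lambda>f x. f (x - c))" for l
  proof (cases "snd l")
    case True
    then have "letter_action alpha alpha l = alpha"
      by (cases l; cases "fst l") (auto simp: letter_action_def)
    with a show ?thesis by metis
  next
    case False
    then have "letter_action alpha alpha l = inv alpha"
      by (cases l; cases "fst l") (auto simp: letter_action_def)
    also have "\<dots> = (\<lambda>f x. f (x - (- ?c)))" by (simp only: inv_alpha diff_minus_eq_add)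
    finally show ?thesis by blast
  qed
  have "\<exists>c. foldr (\<lambda>l. (\<circ>) (letter_action alpha alpha l)) w id = (\<lambda>f x. f (x - c))" for w
  proof (induction w)
    case Nil
    show ?case by (rule exI[of _ 0]) (simp add: fun_eq_iff)
  next
    case (Cons l w)
    then obtain c where c: "foldr (\<lambda>l. (\<circ>) (letter_action alpha alpha l)) w id = (\<lambda>f x. f (x - c))"
      by blast
    obtain d where d: "letter_action alpha alpha l = (\<lambda>f x. f (x - d))" using letter by blast
    have "foldr (\<lambda>l. (\<circ>) (letter_action alpha alpha l)) (l # w) id = (\<lambda>f x. f (x - (c + d)))"
      unfolding foldr.simps comp_apply c by (simp add: d fun_eq_iff algebra_simps)
    then show ?case by blast
  qed
  then show ?thesis by (simp add: free_action_def)
qed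

lemma free_action_linf:
  assumes "f \<in> linf"
  shows "free_action alpha alpha g f \<in> linf"
proof -
  obtain c where c: "free_action alpha alpha g = (\<lambda>f x. f (x - c))"
    using free_action_alpha_translation by blast
  have "f \<in> borel_measurable torus_measure" "bounded (range f)" using assms by (auto simp: linf_def)
  then have "(\<lambda>x. f (x - c)) \<in> borel_measurable torus_measure" "bounded (range (\<lambda>x. f (x - c)))"
    by (measurable, auto elim: bounded_subset)
  then show ?thesis by (simp add: c linf_def)
qed

lemma bounded_linear_mult_ltwo:
  assumes F [measurable]: "F \<in> borel_measurable f2_torus_measure" and C: "\<And>z. cmod (F z) \<le> C"
  shows "bounded_linear (\<lambda>\<xi>. to_ltwo (\<lambda>z. F z * rep_ltwo \<xi> z))"
    and "sq_int f2_torus_measure \<xi> \<Longrightarrow> sq_int f2_torus_measure (\<lambda>z. F z * \<xi> z)"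
    and "sq_int f2_torus_measure \<xi> \<Longrightarrow>
      to_ltwo (\<lambda>z. F z * rep_ltwo (to_ltwo \<xi>) z) = to_ltwo (\<lambda>z. F z * \<xi> z)"
proof -
  show sq: "sq_int f2_torus_measure (\<lambda>z. F z * \<xi> z)" if "sq_int f2_torus_measure \<xi>" for \<xi>
  proof (rule sq_int_bounded_by[OF that])
    have [measurable]: "\<xi> \<in> borel_measurable f2_torus_measure" using that by (simp add: sq_int_def)
    show "(\<lambda>z. F z * \<xi> z) \<in> borel_measurable f2_torus_measure" by measurable
    show "AE x in f2_torus_measure. cmod (F x * \<xi> x) \<le> C * cmod (\<xi> x)"
      using C by (simp add: norm_mult mult_right_mono)
  qed
  show ap: "to_ltwo (\<lambda>z. F z * rep_ltwo (to_ltwo \<xi>) z) = to_ltwo (\<lambda>z. F z * \<xi> z)"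
    if "sq_int f2_torus_measure \<xi>" for \<xi>
  proof (rule to_ltwo_eqI)
    have "ltwo_rel (rep_ltwo (to_ltwo \<xi>)) \<xi>" by (rule rep_to_ltwo[OF that])
    then show "ltwo_rel (\<lambda>z. F z * rep_ltwo (to_ltwo \<xi>) z) (\<lambda>z. F z * \<xi> z)"
      unfolding ltwo_rel_def by (auto intro: sq)
  qed
  have C0: "C \<ge> 0" using C[of undefined] norm_ge_zero order_trans by blast
  have ex: "\<exists>\<xi>. x = to_ltwo \<xi> \<and> sq_int f2_torus_measure \<xi>" for x
    by (metis to_ltwo_rep sq_int_rep_ltwo)
  show "bounded_linear (\<lambda>\<xi>. to_ltwo (\<lambda>z. F z * rep_ltwo \<xi> z))"
  proof (rule bounded_linear_intro[where K=C])
    fix x y :: ltwo and r :: real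
    obtain \<xi> \<eta> where x: "x = to_ltwo \<xi>" "sq_int f2_torus_measure \<xi>"
      and y: "y = to_ltwo \<eta>" "sq_int f2_torus_measure \<eta>" using ex by metis
    show "to_ltwo (\<lambda>z. F z * rep_ltwo (x + y) z)
        = to_ltwo (\<lambda>z. F z * rep_ltwo x z) + to_ltwo (\<lambda>z. F z * rep_ltwo y z)"
      using x(2) y(2)
      by (simp add: x(1) y(1) ap sq plus_ltwo.abs_eq ltwo_rel_self sq_int_add distrib_left)
    show "to_ltwo (\<lambda>z. F z * rep_ltwo (r *\<^sub>R x) z) = r *\<^sub>R to_ltwo (\<lambda>z. F z * rep_ltwo x z)"
      using x(2)
      by (simp add: x(1) ap sq scaleR_ltwo.abs_eq ltwo_rel_self sq_int_scale mult.left_commute)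
    have "(norm (to_ltwo (\<lambda>z. F z * \<xi> z)))\<^sup>2 \<le> (norm (to_ltwo \<xi>) * C)\<^sup>2"
    proof -
      have "(\<integral>z. (cmod (F z * \<xi> z))\<^sup>2 \<partial>f2_torus_measure) \<le> (\<integral>z. C\<^sup>2 * (cmod (\<xi> z))\<^sup>2 \<partial>f2_torus_measure)"
      proof (rule integral_mono)
        show "integrable f2_torus_measure (\<lambda>z. (cmod (F z * \<xi> z))\<^sup>2)"
          "integrable f2_torus_measure (\<lambda>z. C\<^sup>2 * (cmod (\<xi> z))\<^sup>2)"
          using sq[OF x(2)] x(2) by (auto simp: sq_int_def)
        fix z
        show "(cmod (F z * \<xi> z))\<^sup>2 \<le> C\<^sup>2 * (cmod (\<xi> z))\<^sup>2"
          using power_mono[OF C, of z 2] by (simp add: norm_mult power_mult_distrib mult_right_mono)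
      qed
      then show ?thesis
        using x(2) by (simp add: norm_to_ltwo sq power_mult_distrib mult.commute)
    qed
    then show "norm (to_ltwo (\<lambda>z. F z * rep_ltwo x z)) \<le> norm x * C"
      unfolding x(1) ap[OF x(2)] by (rule power2_le_imp_le) (simp add: C0)
  qed
qed

lemma cp_pi_symbol:
  assumes "f \<in> linf"
  shows "(\<lambda>z. free_action alpha alpha (f2_inv (fst z)) f (snd z)) \<in> borel_measurable f2_torus_measure"
    and "\<exists>C. \<forall>z. cmod (free_action alpha alpha (f2_inv (fst z)) f (snd z)) \<le> C"
proof -
  show "(\<lambda>z. free_action alpha alpha (f2_inv (fst z)) f (snd z)) \<in> borel_measurable f2_torus_measure"
    unfolding f2_torus_measure_def
    using free_action_linf[OF assms]
    by (intro measurable_pair_measure_countable1 countable_f2) (simp add: linf_def)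
  obtain C where C: "\<And>x. cmod (f x) \<le> C" using assms by (auto simp: linf_def bounded_iff)
  have "cmod (free_action alpha alpha g f x) \<le> C" for g x
  proof -
    obtain c where "free_action alpha alpha g = (\<lambda>f x. f (x - c))"
      using free_action_alpha_translation by blast
    then show ?thesis using C[of "x - c"] by simp
  qed
  then show "\<exists>C. \<forall>z. cmod (free_action alpha alpha (f2_inv (fst z)) f (snd z)) \<le> C" by blast
qed

lemma cp_pi_apply:
  assumes f: "f \<in> linf" and \<xi>: "sq_int f2_torus_measure \<xi>"
  shows "blinfun_apply (cp_pi f) (to_ltwo \<xi>)
      = to_ltwo (\<lambda>(g, x). free_action alpha alpha (f2_inv g) f x * \<xi> (g, x))"
    and "sq_int f2_torus_measure (\<lambda>(g, x). free_action alpha alpha (f2_inv g) f x * \<xi> (g, x))"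
proof -
  obtain C where C: "\<And>z. cmod (free_action alpha alpha (f2_inv (fst z)) f (snd z)) \<le> C"
    using cp_pi_symbol(2)[OF f] by blast
  note B = bounded_linear_mult_ltwo[OF cp_pi_symbol(1)[OF f] C]
  have "blinfun_apply (cp_pi f)
      = (\<lambda>\<xi>. to_ltwo (\<lambda>z. free_action alpha alpha (f2_inv (fst z)) f (snd z) * rep_ltwo \<xi> z))"
    unfolding cp_pi_def using bounded_linear_Blinfun_apply[OF B(1)]
    by (simp add: case_prod_unfold)
  then show "blinfun_apply (cp_pi f) (to_ltwo \<xi>)
      = to_ltwo (\<lambda>(g, x). free_action alpha alpha (f2_inv g) f x * \<xi> (g, x))"
    using B(3)[OF \<xi>] by (simp add: case_prod_unfold)
  show "sq_int f2_torus_measure (\<lambda>(g, x). free_action alpha alpha (f2_inv g) f x * \<xi> (g, x))"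
    using B(2)[OF \<xi>] by (simp add: case_prod_unfold)
qed

lemma distr_translation:
  "distr f2_torus_measure f2_torus_measure (\<lambda>(g, x). (h * g, x)) = f2_torus_measure"
proof -
  have "bij ((*) h)"
    by (rule o_bij[where g="(*) (f2_inv h)"])
      (simp_all only: fun_eq_iff comp_apply id_apply mult.assoc[symmetric] f2_left_inverse
        f2_right_inverse mult_1_left simp_thms)
  then have d: "distr (count_space UNIV) (count_space UNIV) ((*) h) = count_space UNIV"
    by (rule distr_bij_count_space)
  have "sigma_finite_measure (distr torus_measure torus_measure (\<lambda>x. x))"
    using finite_torus_measure by (simp add: distr_id2 finite_measure_def)
  from pair_measure_distr[OF _ _ this, of "(*) h" "count_space UNIV" "count_space UNIV"] d
  show ?thesis by (simp add: f2_torus_measure_def distr_id2)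
qed

lemma measurable_translation: "(\<lambda>(g, x). (h * g, x)) \<in> f2_torus_measure \<rightarrow>\<^sub>M f2_torus_measure"
  unfolding f2_torus_measure_def case_prod_unfold
  by (intro measurable_Pair measurable_snd measurable_compose[OF measurable_fst]) simp

lemma translation_ltwo:
  fixes h :: f2
  defines "T \<equiv> \<lambda>(g, x :: torus). (h * g, x)"
  shows "sq_int f2_torus_measure \<xi> \<Longrightarrow> sq_int f2_torus_measure (\<lambda>z. \<xi> (T z))"
    and "sq_int f2_torus_measure \<xi> \<Longrightarrow> norm (to_ltwo (\<lambda>z. \<xi> (T z))) = norm (to_ltwo \<xi>)"
    and "ltwo_rel \<xi> \<eta> \<Longrightarrow> ltwo_rel (\<lambda>z. \<xi> (T z)) (\<lambda>z. \<eta> (T z))"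
proof -
  have T [measurable]: "T \<in> f2_torus_measure \<rightarrow>\<^sub>M f2_torus_measure"
    unfolding T_def by (rule measurable_translation)
  have dT: "distr f2_torus_measure f2_torus_measure T = f2_torus_measure"
    unfolding T_def by (rule distr_translation)
  show sq: "sq_int f2_torus_measure (\<lambda>z. \<xi> (T z))" if "sq_int f2_torus_measure \<xi>" for \<xi>
  proof -
    have m [measurable]: "\<xi> \<in> borel_measurable f2_torus_measure" using that by (simp add: sq_int_def)
    have "integrable (distr f2_torus_measure f2_torus_measure T) (\<lambda>z. (cmod (\<xi> z))\<^sup>2)"
      using that by (simp add: dT sq_int_def)
    then have "integrable f2_torus_measure (\<lambda>z. (cmod (\<xi> (T z)))\<^sup>2)"
      by (subst (asm) integrable_distr_eq) measurable
    then show ?thesis by (simp add: sq_int_def)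
  qed
  show "norm (to_ltwo (\<lambda>z. \<xi> (T z))) = norm (to_ltwo \<xi>)" if "sq_int f2_torus_measure \<xi>"
  proof -
    have m [measurable]: "\<xi> \<in> borel_measurable f2_torus_measure" using that by (simp add: sq_int_def)
    have "(\<integral>z. (cmod (\<xi> z))\<^sup>2 \<partial>distr f2_torus_measure f2_torus_measure T)
        = (\<integral>z. (cmod (\<xi> (T z)))\<^sup>2 \<partial>f2_torus_measure)"
      by (rule integral_distr) measurable
    then have "(norm (to_ltwo (\<lambda>z. \<xi> (T z))))\<^sup>2 = (norm (to_ltwo \<xi>))\<^sup>2"
      using that by (simp add: dT norm_to_ltwo sq)
    then show ?thesis by (simp add: power2_eq_iff_nonneg)
  qed
  show "ltwo_rel (\<lambda>z. \<xi> (T z)) (\<lambda>z. \<eta> (T z))" if r: "ltwo_rel \<xi> \<eta>"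
  proof -
    have m [measurable]: "\<xi> \<in> borel_measurable f2_torus_measure" "\<eta> \<in> borel_measurable f2_torus_measure"
      using r by (auto simp: sq_int_def ltwo_rel_def)
    have "AE z in distr f2_torus_measure f2_torus_measure T. \<xi> z = \<eta> z"
      unfolding dT using r by (simp add: ltwo_rel_def)
    then have "AE z in f2_torus_measure. \<xi> (T z) = \<eta> (T z)"
      by (subst (asm) AE_distr_iff) measurable
    then show ?thesis using r by (simp add: ltwo_rel_def sq)
  qed
qed

lemma cp_lambda_apply:
  assumes \<xi>: "sq_int f2_torus_measure \<xi>"
  shows "blinfun_apply (cp_lambda h) (to_ltwo \<xi>) = to_ltwo (\<lambda>(g, x). \<xi> (f2_inv h * g, x))"
    and "sq_int f2_torus_measure (\<lambda>(g, x). \<xi> (f2_inv h * g, x))"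
proof -
  define T where "T = (\<lambda>(g, x :: torus). (f2_inv h * g, x))"
  note tr = translation_ltwo[where h="f2_inv h", folded T_def]
  have ap: "to_ltwo (\<lambda>z. rep_ltwo (to_ltwo \<xi>) (T z)) = to_ltwo (\<lambda>z. \<xi> (T z))"
    if "sq_int f2_torus_measure \<xi>" for \<xi>
    by (intro to_ltwo_eqI tr(3) rep_to_ltwo that)
  have ex: "\<exists>\<xi>. x = to_ltwo \<xi> \<and> sq_int f2_torus_measure \<xi>" for x
    by (metis to_ltwo_rep sq_int_rep_ltwo)
  have "bounded_linear (\<lambda>\<xi>. to_ltwo (\<lambda>z. rep_ltwo \<xi> (T z)))"
  proof (rule bounded_linear_intro[where K=1])
    fix x y :: ltwo and r :: real
    obtain \<xi> \<eta> where x: "x = to_ltwo \<xi>" "sq_int f2_torus_measure \<xi>"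
      and y: "y = to_ltwo \<eta>" "sq_int f2_torus_measure \<eta>" using ex by metis
    show "to_ltwo (\<lambda>z. rep_ltwo (x + y) (T z))
        = to_ltwo (\<lambda>z. rep_ltwo x (T z)) + to_ltwo (\<lambda>z. rep_ltwo y (T z))"
      using x(2) y(2) by (simp add: x(1) y(1) ap tr(1) plus_ltwo.abs_eq ltwo_rel_self sq_int_add)
    show "to_ltwo (\<lambda>z. rep_ltwo (r *\<^sub>R x) (T z)) = r *\<^sub>R to_ltwo (\<lambda>z. rep_ltwo x (T z))"
      using x(2) by (simp add: x(1) ap tr(1) scaleR_ltwo.abs_eq ltwo_rel_self sq_int_scale)
    show "norm (to_ltwo (\<lambda>z. rep_ltwo x (T z))) \<le> norm x * 1"
      using x(2) by (simp add: x(1) ap tr(2))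
  qed
  from bounded_linear_Blinfun_apply[OF this]
  have "blinfun_apply (cp_lambda h) = (\<lambda>\<xi>. to_ltwo (\<lambda>z. rep_ltwo \<xi> (T z)))"
    by (simp add: cp_lambda_def T_def case_prod_unfold)
  then show "blinfun_apply (cp_lambda h) (to_ltwo \<xi>) = to_ltwo (\<lambda>(g, x). \<xi> (f2_inv h * g, x))"
    using ap[OF \<xi>] by (simp add: T_def case_prod_unfold)
  show "sq_int f2_torus_measure (\<lambda>(g, x). \<xi> (f2_inv h * g, x))"
    using tr(1)[OF \<xi>] by (simp add: T_def case_prod_unfold)
qed

lemma f2_inv_mult: "f2_inv (g * h) = f2_inv h * f2_inv g"
proof -
  have "f2_inv (g * h) = f2_inv (g * h) * ((g * h) * (f2_inv h * f2_inv g))"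
    by (metis f2_right_inverse mult.assoc mult.right_neutral)
  also have "\<dots> = f2_inv h * f2_inv g"
    by (metis f2_left_inverse mult.assoc mult.left_neutral)
  finally show ?thesis .
qed

lemma cp_lambda_mult: "cp_lambda (g * h) = cp_lambda g o\<^sub>L cp_lambda h"
proof (rule blinfun_eqI)
  fix x :: ltwo
  obtain \<xi> where x: "x = to_ltwo \<xi>" "sq_int f2_torus_measure \<xi>"
    by (metis to_ltwo_rep sq_int_rep_ltwo)
  note 1 = cp_lambda_apply[OF x(2), of h]
  show "blinfun_apply (cp_lambda (g * h)) x = blinfun_apply (cp_lambda g o\<^sub>L cp_lambda h) x"
    unfolding x(1) blinfun_apply_blinfun_compose 1(1) cp_lambda_apply(1)[OF 1(2)]
      cp_lambda_apply(1)[OF x(2)]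
    by (simp only: case_prod_conv f2_inv_mult mult.assoc)
qed

lemma cp_lambda_one: "cp_lambda 1 = id_blinfun"
proof (rule blinfun_eqI)
  fix x :: ltwo
  obtain \<xi> where x: "x = to_ltwo \<xi>" "sq_int f2_torus_measure \<xi>"
    by (metis to_ltwo_rep sq_int_rep_ltwo)
  have "f2_inv 1 = 1" using f2_left_inverse[of 1] by (simp only: mult_1_right)
  then show "blinfun_apply (cp_lambda 1) x = blinfun_apply id_blinfun x"
    unfolding x(1) cp_lambda_apply(1)[OF x(2)] by simp
qed

lemma cp_covariance:
  assumes f: "f \<in> linf"
  shows "cp_lambda h o\<^sub>L cp_pi f o\<^sub>L cp_lambda (f2_inv h) = cp_pi (free_action alpha alpha h f)"
proof (rule blinfun_eqI)
  fix x :: ltwo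
  obtain \<xi> where x: "x = to_ltwo \<xi>" "sq_int f2_torus_measure \<xi>"
    by (metis to_ltwo_rep sq_int_rep_ltwo)
  have assoc: "free_action alpha alpha (f2_inv (f2_inv h * g)) f
      = free_action alpha alpha (f2_inv g) (free_action alpha alpha h f)" for g
    by (simp only: f2_inv_mult f2_inv_inv free_action_mult[OF bij_alpha bij_alpha] comp_apply)
  have canc: "h * (f2_inv h * g) = g" for g
    by (simp only: mult.assoc[symmetric] f2_right_inverse mult_1_left)
  note 1 = cp_lambda_apply[OF x(2), of "f2_inv h", unfolded f2_inv_inv]
  note 2 = cp_pi_apply[OF f 1(2)]
  note 3 = cp_lambda_apply(1)[OF 2(2), of h]
  note 4 = cp_pi_apply(1)[OF free_action_linf[OF f, of h] x(2)]
  show "blinfun_apply (cp_lambda h o\<^sub>L cp_pi f o\<^sub>L cp_lambda (f2_inv h)) x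
      = blinfun_apply (cp_pi (free_action alpha alpha h f)) x"
    unfolding x(1) 4 blinfun_apply_blinfun_compose 1(1) 2(1) 3
    by (simp only: case_prod_conv assoc canc)
qed

end

theory Submission
  imports Defs
begin

text \<open>
  The two flows are \<open>\<theta>\<close> with parameters \<open>(0, 0, p, q)\<close>, where \<open>(p, q) = (\<surd>3, 1)\<close>, and its reversal
  \<open>t \<mapsto> \<theta>\<^sub>-\<^sub>t\<close>, which has the parameters \<open>(0, 0, -p, -q)\<close>. The reflection \<open>x \<mapsto> -x\<close> of the torus
  together with the automorphism \<open>a \<mapsto> a\<inverse>\<close>, \<open>b \<mapsto> b\<inverse>\<close> of the free group induces an automorphism of
  the crossed product that conjugates one flow to the other, so the trivial cocycle shows that
  they are cocycle conjugate (\<open>cocycle_conjugate_reverse\<close>).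

  Let \<open>x\<^sub>k = \<pi>(\<chi>\<^sub>k)\<close>, where the characters \<open>\<chi>\<^sub>k\<close> of the torus become invariant under the rotation as
  \<open>k \<rightarrow> \<infinity>\<close>. In the regular representation \<open>x\<^sub>k = R\<^sub>k P\<^sub>k\<close>, where \<open>R\<^sub>k\<close> multiplies by \<open>\<chi>\<^sub>k\<close> in the torus
  coordinate only and therefore lies in the commutant, and \<open>P\<^sub>k\<close> multiplies by phases depending on
  the group coordinate only, which tend to 1. Hence \<open>(x\<^sub>k)\<close> is a central sequence
  (\<open>char_op_central\<close>). The flow multiplies a character by \<open>e\<^sup>-\<^sup>i\<^sup>f\<^sup>t\<close>, where \<open>f\<close> is its frequency, and
  by Kronecker's theorem the frequencies of almost invariant characters can tend to any prescribed
  real number (\<open>ex_almost_invariant\<close>). This is the Rohlin property, for \<open>\<theta>\<close> and for its reversal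
  (\<open>rohlin_theta\<close>).

  Strong cocycle conjugacy fails because an approximately inner automorphism \<open>\<sigma>\<close> cannot move these
  central sequences: \<open>\<sigma>(x\<^sub>k) - x\<^sub>k\<close> tends to 0 in the 2-norm of the trace
  (\<open>approximately_inner_char_tendsto\<close>). If \<open>u\<close> and \<open>v\<close> are unitaries such that \<open>Ad u\<close> and \<open>Ad v\<close>
  both approximate \<open>\<sigma>\<close> on \<open>\<lambda>\<^sub>a\<close> and \<open>\<lambda>\<^sub>b\<close>, then \<open>w = u\<^sup>* v\<close> almost commutes with \<open>\<lambda>\<^sub>a\<close> and \<open>\<lambda>\<^sub>b\<close>, and
  the nonamenability of the free group (\<open>spectral_gap\<close>) makes \<open>w\<close> close to the functions on the
  torus. So \<open>w\<close> almost commutes with all characters at once, and on all characters \<open>\<sigma>\<close> is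
  uniformly close to the single inner automorphism \<open>Ad u\<close>, which asymptotically fixes \<open>x\<^sub>k\<close>.

  Suppose now that \<open>Ad u\<^sub>t \<circ> \<theta>\<^sub>-\<^sub>t = \<sigma> \<circ> \<theta>\<^sub>t \<circ> \<sigma>\<inverse>\<close> with such a \<open>\<sigma>\<close>, and evaluate both sides at
  \<open>\<sigma>(x\<^sub>k)\<close>. With \<open>\<theta>\<^sub>t(x\<^sub>k) = z\<^sub>k x\<^sub>k\<close> the right side is close to \<open>z\<^sub>k x\<^sub>k\<close> and the left side to the
  conjugate of \<open>z\<^sub>k\<close> times \<open>x\<^sub>k\<close>. If the frequencies tend to 1 and \<open>t = \<pi>/2\<close>, then \<open>z\<^sub>k\<close> tends to
  \<open>-i\<close>, a contradiction (\<open>not_strongly_cocycle_conjugate_reverse\<close>).\<close>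

section \<open>Orthogonality and adjoints in Hilbert spaces\<close>

lemma cinner_add_right: "cinner (x :: 'h :: complex_hilbert) (y + z) = cinner x y + cinner x z"
  by (metis cinner_add_left cinner_commute complex_cnj_add)

lemma scaleC_minus1: "(- 1) *\<^sub>C (x :: 'h :: complex_hilbert) = - x"
  using scaleR_scaleC[of "-1" x] by simp

lemma scaleC_one [simp]: "1 *\<^sub>C (x :: 'h :: complex_hilbert) = x"
  using scaleR_scaleC[of 1 x] by simp

lemma scaleC_diff_right: "c *\<^sub>C (x - y) = c *\<^sub>C x - c *\<^sub>C (y :: 'h :: complex_hilbert)"
  by (metis add_diff_cancel diff_add_cancel scaleC_add_right)

lemma scaleC_diff_left: "(c - d) *\<^sub>C (x :: 'h :: complex_hilbert) = c *\<^sub>C x - d *\<^sub>C x"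
  by (metis add_diff_cancel diff_add_cancel scaleC_add_left)

lemma cinner_minus_left: "cinner (- x) (y :: 'h :: complex_hilbert) = - cinner x y"
  using cinner_scaleC_left[of "-1" x y] by (simp add: scaleC_minus1)

lemma cinner_minus_right: "cinner x (- y :: 'h :: complex_hilbert) = - cinner x y"
  using cinner_scaleC_right[of x "-1" y] by (simp add: scaleC_minus1)

lemma cinner_diff_left: "cinner (x - y) (z :: 'h :: complex_hilbert) = cinner x z - cinner y z"
  using cinner_add_left[of x "- y" z] by (simp add: cinner_minus_left)

lemma cinner_diff_right: "cinner x (y - z :: 'h :: complex_hilbert) = cinner x y - cinner x z"
  using cinner_add_right[of x y "- z"] by (simp add: cinner_minus_right)

lemma cinner_zero [simp]:
  "cinner 0 (y :: 'h :: complex_hilbert) = 0" "cinner y (0 :: 'h :: complex_hilbert) = 0"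
  using cinner_diff_left[of 0 0 y] cinner_diff_right[of y 0 0] by simp_all

lemma cmod_cinner_le: "cmod (cinner x (y :: 'h :: complex_hilbert)) \<le> norm x * norm y"
proof (cases "cinner x y = 0")
  case False
  define z where "z = cinner x y"
  define c where "c = cnj (sgn z)"
  have c: "cmod c = 1" using False by (simp add: c_def z_def norm_sgn)
  have "cinner (c *\<^sub>C x) y = of_real (cmod z)"
    unfolding cinner_scaleC_left c_def z_def[symmetric]
    using complex_norm_square[of z] False
    by (simp add: sgn_eq z_def field_simps power2_eq_square)
  then have "cmod z = inner (c *\<^sub>C x) y" by (simp add: inner_cinner)
  also have "\<dots> \<le> norm (c *\<^sub>C x) * norm y" by (rule norm_cauchy_schwarz)
  finally show ?thesis by (simp add: norm_scaleC c z_def)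
qed simp

lemma norm_sub_square:
  "(norm (x - y :: 'h :: complex_hilbert))\<^sup>2 = (norm x)\<^sup>2 + (norm y)\<^sup>2 - 2 * Re (cinner x y)"
  by (simp add: power2_norm_eq_inner inner_diff inner_commute flip: inner_cinner)

text \<open>A minimizing sequence for the distance from \<open>a\<close> to \<open>K\<close> is Cauchy by the parallelogram law.\<close>

lemma orthogonal_projection:
  fixes K :: "'a :: {real_inner, complete_space} set"
  assumes cl: "closed K" and sub: "subspace K"
  shows "\<exists>p\<in>K. \<forall>k\<in>K. inner k (a - p) = 0"
proof -
  define d where "d = (INF k\<in>K. norm (a - k))"
  have ne: "K \<noteq> {}" using subspace_0[OF sub] by blast
  have bdd: "bdd_below ((\<lambda>k. norm (a - k)) ` K)" by (rule bdd_belowI2[of _ 0]) simp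
  have d_le: "d \<le> norm (a - k)" if "k \<in> K" for k
    unfolding d_def by (rule cINF_lower[OF bdd that])
  have d0: "d \<ge> 0" unfolding d_def by (rule cINF_greatest[OF ne]) simp
  have "\<exists>k\<in>K. norm (a - k) < d + 1 / real (Suc n)" for n
    using cINF_less_iff[OF ne bdd, of "d + 1 / real (Suc n)"] by (simp add: d_def)
  then obtain k where kK: "\<And>n. k n \<in> K" and kd: "\<And>n. norm (a - k n) < d + 1 / real (Suc n)"
    by metis
  have "(\<lambda>n. norm (a - k n)) \<longlonglongrightarrow> d"
  proof (rule tendsto_sandwich[where f="\<lambda>_. d" and h="\<lambda>n. d + 1 / real (Suc n)"])
    show "(\<lambda>n. d + 1 / real (Suc n)) \<longlonglongrightarrow> d"
      using tendsto_add[OF tendsto_const lim_1_over_n[THEN LIMSEQ_Suc], of d] by simp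
  qed (use d_le kK kd in \<open>auto intro!: always_eventually less_imp_le\<close>)
  then have lim: "(\<lambda>n. (norm (a - k n))\<^sup>2) \<longlonglongrightarrow> d\<^sup>2" by (rule tendsto_power)
  have par: "(norm (k m - k n))\<^sup>2 \<le> 2 * (norm (a - k m))\<^sup>2 + 2 * (norm (a - k n))\<^sup>2 - 4 * d\<^sup>2" for m n
  proof -
    have "(1/2) *\<^sub>R (k m + k n) \<in> K" by (intro subspace_scale subspace_add sub kK)
    from d_le[OF this] d0 have "d\<^sup>2 \<le> (norm (a - (1/2) *\<^sub>R (k m + k n)))\<^sup>2"
      by (intro power_mono)
    moreover have "(norm (k m - k n))\<^sup>2 + 4 * (norm (a - (1/2) *\<^sub>R (k m + k n)))\<^sup>2
        = 2 * (norm (a - k m))\<^sup>2 + 2 * (norm (a - k n))\<^sup>2"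
      unfolding power2_norm_eq_inner
      by (simp add: inner_diff inner_add inner_commute algebra_simps)
    ultimately show ?thesis by linarith
  qed
  have "Cauchy k"
  proof (rule metric_CauchyI)
    fix e :: real assume e: "e > 0"
    from order_tendstoD(2)[OF lim, of "d\<^sup>2 + e\<^sup>2 / 4"] e
    obtain N where N: "\<And>n. n \<ge> N \<Longrightarrow> (norm (a - k n))\<^sup>2 < d\<^sup>2 + e\<^sup>2 / 4"
      by (auto simp: eventually_sequentially)
    have "norm (k m - k n) < e" if "m \<ge> N" "n \<ge> N" for m n
    proof (rule power2_less_imp_less)
      show "(norm (k m - k n))\<^sup>2 < e\<^sup>2" using par[of m n] N[OF that(1)] N[OF that(2)] by linarith
    qed (use e in simp)
    then show "\<exists>M. \<forall>m\<ge>M. \<forall>n\<ge>M. dist (k m) (k n) < e" unfolding dist_norm by blast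
  qed
  then obtain p where p: "k \<longlonglongrightarrow> p" using Cauchy_convergent convergent_def by blast
  have pK: "p \<in> K" using closed_sequentially[OF cl _ p] kK by blast
  have "(\<lambda>n. (norm (a - k n))\<^sup>2) \<longlonglongrightarrow> (norm (a - p))\<^sup>2" by (intro tendsto_intros p)
  with lim have pd: "(norm (a - p))\<^sup>2 = d\<^sup>2" using LIMSEQ_unique by blast
  have "inner j (a - p) = 0" if j: "j \<in> K" for j
  proof (cases "j = 0")
    case False
    define t where "t = inner j (a - p) / inner j j"
    have jj: "inner j j > 0" using False by simp
    have "p + t *\<^sub>R j \<in> K" by (intro subspace_add subspace_scale sub pK j)
    from d_le[OF this] d0 have "d\<^sup>2 \<le> (norm (a - (p + t *\<^sub>R j)))\<^sup>2" by (intro power_mono)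
    also have "\<dots> = (norm (a - p))\<^sup>2 - 2 * t * inner j (a - p) + t * t * inner j j"
      unfolding power2_norm_eq_inner by (simp add: inner_diff inner_add inner_commute algebra_simps)
    also have "\<dots> = d\<^sup>2 - (inner j (a - p))\<^sup>2 / inner j j"
      unfolding pd using jj by (simp add: t_def power2_eq_square)
    finally have "(inner j (a - p))\<^sup>2 / inner j j \<le> 0" by simp
    with jj show ?thesis by (auto simp: divide_le_0_iff simp del: inner_gt_zero_iff)
  qed simp
  with pK show ?thesis by blast
qed

lemma closed_subspace_eq_UNIV:
  fixes K :: "'a :: {real_inner, complete_space} set"
  assumes "closed K" "subspace K" "\<And>z. (\<And>k. k \<in> K \<Longrightarrow> inner k z = 0) \<Longrightarrow> z = 0"
  shows "x \<in> K"
  using orthogonal_projection[OF assms(1,2), of x] assms(3)[of "x - p" for p] by force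

text \<open>The representing vector is the multiple of the component of \<open>a\<close> orthogonal to the kernel
  of \<open>f\<close> that has the right value of \<open>f\<close>.\<close>

lemma Riesz_representation:
  fixes f :: "'a :: {real_inner, complete_space} \<Rightarrow> real"
  assumes "bounded_linear f"
  shows "\<exists>z. \<forall>x. f x = inner x z"
proof (cases "\<forall>x. f x = 0")
  case True
  then show ?thesis by (intro exI[of _ 0]) simp
next
  case False
  then obtain a where a: "f a \<noteq> 0" by blast
  interpret f: bounded_linear f by fact
  define K where "K = {x. f x = 0}"
  have "closed K"
    unfolding K_def by (intro closed_Collect_eq continuous_intros f.continuous_on)
  moreover have "subspace K"
    by (auto simp: K_def subspace_def f.add f.scaleR f.zero)
  ultimately obtain p where p: "p \<in> K" "\<And>k. k \<in> K \<Longrightarrow> inner k (a - p) = 0"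
    using orthogonal_projection by blast
  define w where "w = a - p"
  have fw: "f w = f a" using p(1) by (simp add: w_def f.diff K_def)
  have w0: "inner w w \<noteq> 0" using fw a by (auto simp: f.zero)
  have "f x = inner x ((f a / inner w w) *\<^sub>R w)" for x
  proof -
    have "x - (f x / f a) *\<^sub>R w \<in> K" using a by (simp add: K_def f.diff f.scaleR fw)
    from p(2)[OF this] have "inner x w = f x / f a * inner w w"
      by (simp add: w_def[symmetric] inner_diff_left)
    then show ?thesis using w0 a by simp
  qed
  then show ?thesis by blast
qed

lemma bounded_opsD: "T \<in> bounded_ops \<Longrightarrow> blinfun_apply T (c *\<^sub>C x) = c *\<^sub>C blinfun_apply T x"
  by (simp add: bounded_ops_def)

text \<open>The vector that represents the real part of the functional represents the functional
  itself, because the imaginary part at \<open>x\<close> is the real part at \<open>-i x\<close>.\<close>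

lemma ex_adjoint_vector:
  fixes T :: "'h :: complex_hilbert op"
  assumes T: "T \<in> bounded_ops"
  shows "\<exists>z. \<forall>x. cinner (blinfun_apply T x) y = cinner x z"
proof -
  have "bounded_linear (\<lambda>x. inner (blinfun_apply T x) y)"
    by (intro bounded_linear_compose[OF bounded_linear_inner_left] blinfun.bounded_linear_right)
  then obtain z where z: "\<And>x. inner (blinfun_apply T x) y = inner x z"
    using Riesz_representation by blast
  have "cinner (blinfun_apply T x) y = cinner x z" for x
  proof (rule complex_eqI)
    show "Re (cinner (blinfun_apply T x) y) = Re (cinner x z)" using z[of x] by (simp add: inner_cinner)
    show "Im (cinner (blinfun_apply T x) y) = Im (cinner x z)"
      using z[of "(- \<i>) *\<^sub>C x"] by (simp add: inner_cinner bounded_opsD[OF T] cinner_scaleC_left)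
  qed
  then show ?thesis by blast
qed

text \<open>The adjoint is a definite description; this is the existence that gives it its meaning.\<close>

lemma cinner_adj:
  fixes T :: "'h :: complex_hilbert op"
  assumes T: "T \<in> bounded_ops"
  shows "cinner (blinfun_apply T x) y = cinner x (blinfun_apply (adj T) y)"
proof -
  obtain S where S: "\<And>x y. cinner (blinfun_apply T x) y = cinner x (S y)"
    using ex_adjoint_vector[OF T] by metis
  have "bounded_linear S"
  proof (rule bounded_linear_intro[where K="norm T"])
    fix u v :: 'h and r :: real
    show "S (u + v) = S u + S v"
      by (rule cinner_eqI) (simp add: S[symmetric] cinner_add_right)
    show "S (r *\<^sub>R u) = r *\<^sub>R S u"
      by (rule cinner_eqI) (simp add: S[symmetric] scaleR_scaleC cinner_scaleC_right)
    have "(norm (S u))\<^sup>2 = cmod (cinner (blinfun_apply T (S u)) u)"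
      unfolding S by (simp add: cinner_self norm_power)
    also have "\<dots> \<le> norm (blinfun_apply T (S u)) * norm u" by (rule cmod_cinner_le)
    also have "\<dots> \<le> (norm T * norm (S u)) * norm u"
      by (intro mult_right_mono norm_blinfun) simp
    finally have "norm (S u) * norm (S u) \<le> norm (S u) * (norm u * norm T)"
      by (simp add: power2_eq_square mult_ac)
    then show "norm (S u) \<le> norm u * norm T"
      by (cases "norm (S u) = 0") (auto simp: mult_le_cancel_left)
  qed
  then have "adj T = Blinfun S"
    by (intro adj_eqI) (simp add: bounded_linear_Blinfun_apply S)
  with \<open>bounded_linear S\<close> show ?thesis by (simp add: bounded_linear_Blinfun_apply S)
qed

lemma cinner_adj':
  "T \<in> bounded_ops \<Longrightarrow> cinner (blinfun_apply (adj T) x) y = cinner x (blinfun_apply T y)"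
  by (metis cinner_adj cinner_commute)

lemma adj_bounded_ops:
  assumes T: "T \<in> bounded_ops"
  shows "adj T \<in> bounded_ops"
proof -
  have "blinfun_apply (adj T) (c *\<^sub>C y) = c *\<^sub>C blinfun_apply (adj T) y" for c y
    by (rule cinner_eqI) (simp add: cinner_adj[OF T, symmetric] cinner_scaleC_right)
  then show ?thesis by (simp add: bounded_ops_def)
qed

lemma adj_adj: "T \<in> bounded_ops \<Longrightarrow> adj (adj T) = T"
  by (rule adj_eqI) (rule cinner_adj')

lemma adj_compose:
  "S \<in> bounded_ops \<Longrightarrow> T \<in> bounded_ops \<Longrightarrow> adj (S o\<^sub>L T) = adj T o\<^sub>L adj S"
  by (rule adj_eqI) (simp add: cinner_adj)

lemma adj_add: "S \<in> bounded_ops \<Longrightarrow> T \<in> bounded_ops \<Longrightarrow> adj (S + T) = adj S + adj T"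
  by (rule adj_eqI) (simp add: cinner_adj blinfun.add_left cinner_add_left cinner_add_right)

lemma adj_diff: "S \<in> bounded_ops \<Longrightarrow> T \<in> bounded_ops \<Longrightarrow> adj (S - T) = adj S - adj T"
  by (rule adj_eqI) (simp add: cinner_adj blinfun.diff_left cinner_diff_left cinner_diff_right)

lemma adj_cscale: "T \<in> bounded_ops \<Longrightarrow> adj (cscale c T) = cscale (cnj c) (adj T)"
  by (rule adj_eqI) (simp add: cinner_adj cinner_scaleC_left cinner_scaleC_right)

lemma adj_id [simp]: "adj id_blinfun = (id_blinfun :: 'h :: complex_hilbert op)"
  by (rule adj_eqI) simp

lemma norm_adj_le:
  fixes T :: "'h :: complex_hilbert op"
  assumes T: "T \<in> bounded_ops"
  shows "norm (adj T) \<le> norm T"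
proof (rule norm_blinfun_bound)
  fix u :: 'h
  let ?S = "blinfun_apply (adj T) u"
  have "(norm ?S)\<^sup>2 = cmod (cinner (blinfun_apply T ?S) u)"
    by (simp add: cinner_adj[OF T] cinner_self norm_power)
  also have "\<dots> \<le> norm (blinfun_apply T ?S) * norm u" by (rule cmod_cinner_le)
  also have "\<dots> \<le> (norm T * norm ?S) * norm u"
    by (intro mult_right_mono norm_blinfun) simp
  finally have "norm ?S * norm ?S \<le> norm ?S * (norm T * norm u)"
    by (simp add: power2_eq_square mult_ac)
  then show "norm ?S \<le> norm T * norm u"
    by (cases "norm ?S = 0") (auto simp: mult_le_cancel_left)
qed simp

lemma norm_adj: "T \<in> bounded_ops \<Longrightarrow> norm (adj T) = norm T"
  using norm_adj_le[of T] norm_adj_le[of "adj T"] by (simp add: adj_adj adj_bounded_ops)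

lemma bounded_ops_id [simp]: "id_blinfun \<in> bounded_ops"
  by (simp add: bounded_ops_def)

lemma bounded_ops_compose: "S \<in> bounded_ops \<Longrightarrow> T \<in> bounded_ops \<Longrightarrow> S o\<^sub>L T \<in> bounded_ops"
  by (simp add: bounded_ops_def)

lemma bounded_ops_add: "S \<in> bounded_ops \<Longrightarrow> T \<in> bounded_ops \<Longrightarrow> S + T \<in> bounded_ops"
  by (simp add: bounded_ops_def blinfun.add_left scaleC_add_right)

lemma bounded_ops_diff: "S \<in> bounded_ops \<Longrightarrow> T \<in> bounded_ops \<Longrightarrow> S - T \<in> bounded_ops"
  by (simp add: bounded_ops_def blinfun.diff_left scaleC_diff_right)

lemma bounded_ops_cscale: "T \<in> bounded_ops \<Longrightarrow> cscale c T \<in> bounded_ops"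
  by (simp add: bounded_ops_def scaleC_scaleC mult.commute)

lemma cscale_compose_left: "cscale c S o\<^sub>L T = cscale c (S o\<^sub>L T)"
  by (rule blinfun_eqI) simp

lemma cscale_compose_right: "S \<in> bounded_ops \<Longrightarrow> S o\<^sub>L cscale c T = cscale c (S o\<^sub>L T)"
  by (rule blinfun_eqI) (simp add: bounded_opsD)

lemma cscale_cscale: "cscale c (cscale d T) = cscale (c * d) T"
  by (rule blinfun_eqI) (simp add: scaleC_scaleC)

lemma cscale_one [simp]: "cscale 1 T = T"
  by (rule blinfun_eqI) simp

lemma norm_cscale: "norm (cscale c T) = cmod c * norm T"
proof (rule antisym)
  have le: "norm (cscale c T) \<le> cmod c * norm T" for c :: complex and T :: "'a op"
  proof (rule norm_blinfun_bound)
    fix x show "norm (blinfun_apply (cscale c T) x) \<le> cmod c * norm T * norm x"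
      using mult_left_mono[OF norm_blinfun[of T x], of "cmod c"]
      by (simp add: norm_scaleC mult.assoc)
  qed simp
  show "norm (cscale c T) \<le> cmod c * norm T" by (rule le)
  show "cmod c * norm T \<le> norm (cscale c T)"
  proof (cases "c = 0")
    case False
    have "norm T = norm (cscale (inverse c) (cscale c T))" using False by (simp add: cscale_cscale)
    also have "\<dots> \<le> cmod (inverse c) * norm (cscale c T)" by (rule le)
    finally have "cmod c * norm T \<le> cmod c * (cmod (inverse c) * norm (cscale c T))"
      by (rule mult_left_mono) simp
    also have "\<dots> = norm (cscale c T)" using False by (simp add: norm_inverse)
    finally show ?thesis .
  qed simp
qed

lemma compose_assoc: "(A o\<^sub>L B) o\<^sub>L C = A o\<^sub>L (B o\<^sub>L C)"
  by (rule blinfun_eqI) simp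

lemma compose_id [simp]: "A o\<^sub>L id_blinfun = A" "id_blinfun o\<^sub>L A = A"
  by (rule blinfun_eqI, simp)+

lemma compose_diff_left: "(A - B) o\<^sub>L C = (A o\<^sub>L C) - (B o\<^sub>L C)"
  by (rule blinfun_eqI) (simp add: blinfun.diff_left)

lemma compose_diff_right: "A o\<^sub>L (B - C) = (A o\<^sub>L B) - (A o\<^sub>L C)"
  by (rule blinfun_eqI) (simp add: blinfun.diff_left blinfun.diff_right)

lemma compose_add_left: "(A + B) o\<^sub>L C = (A o\<^sub>L C) + (B o\<^sub>L C)"
  by (rule blinfun_eqI) (simp add: blinfun.add_left)

lemma compose_add_right: "A o\<^sub>L (B + C) = (A o\<^sub>L B) + (A o\<^sub>L C)"
  by (rule blinfun_eqI) (simp add: blinfun.add_left blinfun.add_right)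

lemma norm_isometry:
  fixes u :: "'h :: complex_hilbert op"
  assumes "u \<in> bounded_ops" "adj u o\<^sub>L u = id_blinfun"
  shows "norm (blinfun_apply u x) = norm x"
proof -
  have "cinner (blinfun_apply u x) (blinfun_apply u x) = cinner x (blinfun_apply (adj u o\<^sub>L u) x)"
    by (simp add: cinner_adj[OF assms(1)])
  then have "(norm (blinfun_apply u x))\<^sup>2 = (norm x)\<^sup>2"
    unfolding assms(2) cinner_self of_real_eq_iff by (simp add: cinner_self del: of_real_power)
  then show ?thesis by (simp add: power2_eq_iff_nonneg)
qed

section \<open>Von Neumann algebras\<close>

subclass (in complex_hilbert) banach ..

lemma commutant_antimono: "S \<subseteq> T \<Longrightarrow> commutant T \<subseteq> commutant S"
  by (auto simp: commutant_def)

lemma commutantD: "T \<in> commutant S \<Longrightarrow> A \<in> S \<Longrightarrow> T o\<^sub>L A = A o\<^sub>L T"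
  by (simp add: commutant_def)

lemma commutant_bounded_ops: "commutant S \<subseteq> bounded_ops"
  by (auto simp: commutant_def)

lemma commutant_commutant_superset: "S \<subseteq> bounded_ops \<Longrightarrow> S \<subseteq> commutant (commutant S)"
  by (auto simp: commutant_def)

lemma commutant_triple: "S \<subseteq> bounded_ops \<Longrightarrow> commutant (commutant (commutant S)) = commutant S"
  using commutant_antimono[OF commutant_commutant_superset]
    commutant_commutant_superset[OF commutant_bounded_ops] by blast

lemma adj_commutant:
  assumes S: "S \<subseteq> bounded_ops" "\<And>A. A \<in> S \<Longrightarrow> adj A \<in> S" and T: "T \<in> commutant S"
  shows "adj T \<in> commutant S"
proof -
  have Tb: "T \<in> bounded_ops" using T commutant_bounded_ops by blast
  have "adj T o\<^sub>L A = A o\<^sub>L adj T" if A: "A \<in> S" for A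
  proof -
    have Ab: "A \<in> bounded_ops" using A S by blast
    have "adj (adj A o\<^sub>L T) = adj (T o\<^sub>L adj A)" using commutantD[OF T S(2)[OF A]] by simp
    then show ?thesis by (simp add: adj_compose Tb Ab adj_bounded_ops adj_adj)
  qed
  then show ?thesis by (simp add: commutant_def adj_bounded_ops Tb)
qed

text \<open>The bicommutant of \<open>S\<close> is a von Neumann algebra because a third commutant is a first one,
  and it is the smallest one because every von Neumann algebra containing \<open>S\<close> is its own
  bicommutant.\<close>

lemma vn_generated_eq_bicommutant:
  assumes S: "S \<subseteq> bounded_ops" "\<And>A. A \<in> S \<Longrightarrow> adj A \<in> S"
  shows "vn_generated S = commutant (commutant S)"
    and "von_neumann_algebra (commutant (commutant S))"
proof -
  have "adj T \<in> commutant (commutant S)" if "T \<in> commutant (commutant S)" for T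
    using adj_commutant[OF commutant_bounded_ops adj_commutant[OF S] that] .
  then show vn: "von_neumann_algebra (commutant (commutant S))"
    unfolding von_neumann_algebra_def
    using commutant_bounded_ops commutant_triple[OF commutant_bounded_ops] by blast
  show "vn_generated S = commutant (commutant S)"
  proof
    show "vn_generated S \<subseteq> commutant (commutant S)"
      unfolding vn_generated_def using vn commutant_commutant_superset[OF S(1)] by blast
    show "commutant (commutant S) \<subseteq> vn_generated S"
      unfolding vn_generated_def
    proof (rule Inter_greatest)
      fix N assume "N \<in> {M. von_neumann_algebra M \<and> S \<subseteq> M}"
      then have "S \<subseteq> N" "commutant (commutant N) = N" by (auto simp: von_neumann_algebra_def)
      then show "commutant (commutant S) \<subseteq> N" using commutant_antimono by metis
    qed
  qed
qed

locale vna =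
  fixes M :: "'h :: complex_hilbert op set"
  assumes vna: "von_neumann_algebra M"
begin

lemma bicommutant: "commutant (commutant M) = M"
  using vna by (simp add: von_neumann_algebra_def)

lemma bounded: "x \<in> M \<Longrightarrow> x \<in> bounded_ops"
  using vna by (auto simp: von_neumann_algebra_def)

lemma adj_mem: "x \<in> M \<Longrightarrow> adj x \<in> M"
  using vna by (auto simp: von_neumann_algebra_def)

lemma adj_adj_mem [simp]: "x \<in> M \<Longrightarrow> adj (adj x) = x"
  by (simp add: adj_adj bounded)

lemma memI:
  assumes "x \<in> bounded_ops" "\<And>T. T \<in> commutant M \<Longrightarrow> x o\<^sub>L T = T o\<^sub>L x"
  shows "x \<in> M"
  using assms bicommutant unfolding commutant_def by blast

lemma commute: "x \<in> M \<Longrightarrow> T \<in> commutant M \<Longrightarrow> x o\<^sub>L T = T o\<^sub>L x"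
  by (simp add: commutant_def)

lemma commute_apply:
  assumes "x \<in> M" "T \<in> commutant M"
  shows "blinfun_apply x (blinfun_apply T \<xi>) = blinfun_apply T (blinfun_apply x \<xi>)"
  using arg_cong[OF commute[OF assms], of "\<lambda>z. blinfun_apply z \<xi>"] by simp

lemma id_mem: "id_blinfun \<in> M"
  by (rule memI) auto

lemma compose_mem: "x \<in> M \<Longrightarrow> y \<in> M \<Longrightarrow> x o\<^sub>L y \<in> M"
  by (rule memI) (auto simp: bounded_ops_compose bounded commute_apply intro!: blinfun_eqI)

lemma add_mem: "x \<in> M \<Longrightarrow> y \<in> M \<Longrightarrow> x + y \<in> M"
  by (rule memI) (auto simp: bounded_ops_add bounded compose_add_left compose_add_right commute)

lemma diff_mem: "x \<in> M \<Longrightarrow> y \<in> M \<Longrightarrow> x - y \<in> M"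
  by (rule memI) (auto simp: bounded_ops_diff bounded compose_diff_left compose_diff_right commute)

lemma cscale_mem:
  assumes x: "x \<in> M"
  shows "cscale c x \<in> M"
proof (rule memI)
  fix T assume T: "T \<in> commutant M"
  then have "T \<in> bounded_ops" using commutant_bounded_ops by blast
  then show "cscale c x o\<^sub>L T = T o\<^sub>L cscale c x"
    by (simp add: cscale_compose_left cscale_compose_right commute[OF x T])
qed (simp add: bounded_ops_cscale bounded x)

lemma zero_mem: "0 \<in> M"
  using diff_mem[OF id_mem id_mem] by simp

lemma closed: "closed M"
  unfolding closed_sequential_limits
proof (intro allI impI)
  fix x l assume "(\<forall>n. x n \<in> M) \<and> x \<longlonglongrightarrow> l"
  then have x: "\<And>n. x n \<in> M" and lim: "x \<longlonglongrightarrow> l" by auto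
  have ap: "(\<lambda>n. blinfun_apply (x n) \<xi>) \<longlonglongrightarrow> blinfun_apply l \<xi>" for \<xi>
    by (intro tendsto_intros lim)
  show "l \<in> M"
  proof (rule memI)
    have "blinfun_apply l (c *\<^sub>C \<xi>) = c *\<^sub>C blinfun_apply l \<xi>" for c \<xi>
    proof (rule LIMSEQ_unique[OF ap])
      show "(\<lambda>n. blinfun_apply (x n) (c *\<^sub>C \<xi>)) \<longlonglongrightarrow> c *\<^sub>C blinfun_apply l \<xi>"
        unfolding bounded_opsD[OF bounded[OF x]]
        by (rule bounded_linear.tendsto[OF bounded_linear_scaleC ap])
    qed
    then show "l \<in> bounded_ops" by (simp add: bounded_ops_def)
    fix T assume T: "T \<in> commutant M"
    have "blinfun_apply l (blinfun_apply T \<xi>) = blinfun_apply T (blinfun_apply l \<xi>)" for \<xi>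
    proof (rule LIMSEQ_unique[OF ap])
      show "(\<lambda>n. blinfun_apply (x n) (blinfun_apply T \<xi>)) \<longlonglongrightarrow> blinfun_apply T (blinfun_apply l \<xi>)"
        unfolding commute_apply[OF x T] by (intro tendsto_intros ap)
    qed
    then show "l o\<^sub>L T = T o\<^sub>L l" by (intro blinfun_eqI) simp
  qed
qed

lemma sum_mem:
  assumes "\<And>i. i \<in> I \<Longrightarrow> x i \<in> M"
  shows "(\<Sum>i\<in>I. x i) \<in> M"
  using assms
  by (induction I rule: infinite_finite_induct) (auto intro: add_mem zero_mem)

lemma unitary_mem: "u \<in> unitaries M \<Longrightarrow> u \<in> M"
  by (auto simp: unitaries_def)

lemma unitary_adj: "u \<in> unitaries M \<Longrightarrow> adj u \<in> unitaries M"
  by (auto simp: unitaries_def adj_mem)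

lemma unitary_norm: "u \<in> unitaries M \<Longrightarrow> norm (blinfun_apply u \<xi>) = norm \<xi>"
  by (rule norm_isometry) (auto simp: unitaries_def bounded)

lemma unitary_cancel:
  assumes "u \<in> unitaries M"
  shows "blinfun_apply u (blinfun_apply (adj u) \<xi>) = \<xi>"
    and "blinfun_apply (adj u) (blinfun_apply u \<xi>) = \<xi>"
  using assms by (auto simp: unitaries_def simp flip: blinfun_apply_blinfun_compose)

lemma Ad_mem: "u \<in> unitaries M \<Longrightarrow> x \<in> M \<Longrightarrow> Ad u x \<in> M"
  by (auto simp: Ad_def unitaries_def intro: compose_mem adj_mem)

text \<open>The geometric series converges in norm, and its partial sums stay in the closed set \<open>M\<close>.\<close>

lemma Neumann_inverse:
  assumes z: "z \<in> M" and nz: "norm z < 1"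
  shows "\<exists>b\<in>M. b o\<^sub>L (id_blinfun - z) = id_blinfun"
proof -
  define P where "P n = ((\<lambda>x. x o\<^sub>L z) ^^ n) id_blinfun" for n
  have P_Suc: "P (Suc n) = P n o\<^sub>L z" for n by (simp add: P_def)
  have P0: "P 0 = id_blinfun" by (simp add: P_def)
  have PM: "P n \<in> M" for n by (induction n) (auto simp: P0 P_Suc id_mem intro: compose_mem z)
  have nP: "norm (P n) \<le> norm z ^ n" for n
  proof (induction n)
    case (Suc n)
    have "norm (P (Suc n)) \<le> norm (P n) * norm z" unfolding P_Suc by (rule norm_blinfun_compose)
    also have "\<dots> \<le> norm z ^ n * norm z" by (rule mult_right_mono[OF Suc]) simp
    finally show ?case by (simp add: mult.commute)
  qed (simp add: P0 norm_blinfun_id_le)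
  define S where "S n = (\<Sum>i<n. P i)" for n
  have S_id: "S n o\<^sub>L (id_blinfun - z) = id_blinfun - P n" for n
  proof (induction n)
    case (Suc n)
    have "S (Suc n) o\<^sub>L (id_blinfun - z) = (S n o\<^sub>L (id_blinfun - z)) + (P n o\<^sub>L (id_blinfun - z))"
      by (simp add: S_def compose_add_left)
    also have "\<dots> = id_blinfun - P (Suc n)"
      unfolding Suc by (simp add: compose_diff_right P_Suc)
    finally show ?case .
  qed (simp add: S_def P0)
  have sm: "summable (\<lambda>n. norm z ^ n)" using nz by (simp add: summable_geometric)
  have "Cauchy S"
  proof (rule CauchyI)
    fix e :: real assume "e > 0"
    with sm obtain N where N: "\<And>m n. m \<ge> N \<Longrightarrow> norm (\<Sum>i\<in>{m..<n}. norm z ^ i) < e"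
      unfolding summable_Cauchy by blast
    have "norm (S m - S n) < e" if mn: "m \<ge> N" "n \<ge> N" "n \<le> m" for m n
    proof -
      have "S m - S n = (\<Sum>i\<in>{n..<m}. P i)"
        unfolding S_def using mn(3) by (simp add: lessThan_atLeast0 sum_diff_nat_ivl)
      also have "norm \<dots> \<le> (\<Sum>i\<in>{n..<m}. norm z ^ i)"
        by (rule order_trans[OF norm_sum sum_mono]) (rule nP)
      also have "\<dots> < e" using N[of n m] mn by (simp add: sum_nonneg)
      finally show ?thesis .
    qed
    then show "\<exists>M. \<forall>m\<ge>M. \<forall>n\<ge>M. norm (S m - S n) < e"
      by (meson nat_le_linear norm_minus_commute[THEN eq_refl] le_less_trans)
  qed
  then obtain b where b: "S \<longlonglongrightarrow> b" using Cauchy_convergent convergent_def by blast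
  have "b \<in> M" using closed_sequentially[OF closed _ b] by (simp add: S_def sum_mem PM)
  moreover have "P \<longlonglongrightarrow> 0"
    by (rule Lim_null_comparison[OF always_eventually[rule_format, OF nP]])
       (rule LIMSEQ_power_zero, use nz in simp)
  then have "(\<lambda>n. S n o\<^sub>L (id_blinfun - z)) \<longlonglongrightarrow> id_blinfun"
    unfolding S_id using tendsto_diff[OF tendsto_const] by fastforce
  moreover have "(\<lambda>n. S n o\<^sub>L (id_blinfun - z)) \<longlonglongrightarrow> (b o\<^sub>L (id_blinfun - z))"
    by (intro bounded_linear.tendsto[OF bounded_bilinear.bounded_linear_left
          [OF bounded_bilinear_blinfun_compose]] b)
  ultimately show ?thesis using LIMSEQ_unique by blast
qed

lemma aut_mem: "\<sigma> \<in> automorphisms M \<Longrightarrow> x \<in> M \<Longrightarrow> \<sigma> x \<in> M"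
  by (auto simp: automorphisms_def bij_betw_def)

lemma aut_inv:
  assumes "\<sigma> \<in> automorphisms M"
  shows "y \<in> M \<Longrightarrow> inv_into M \<sigma> y \<in> M" "y \<in> M \<Longrightarrow> \<sigma> (inv_into M \<sigma> y) = y"
    and "x \<in> M \<Longrightarrow> inv_into M \<sigma> (\<sigma> x) = x"
  using assms by (auto simp: automorphisms_def bij_betw_def inv_into_into f_inv_into_f)

lemma aut_add: "\<sigma> \<in> automorphisms M \<Longrightarrow> x \<in> M \<Longrightarrow> y \<in> M \<Longrightarrow> \<sigma> (x + y) = \<sigma> x + \<sigma> y"
  by (auto simp: automorphisms_def)

lemma aut_compose:
  "\<sigma> \<in> automorphisms M \<Longrightarrow> x \<in> M \<Longrightarrow> y \<in> M \<Longrightarrow> \<sigma> (x o\<^sub>L y) = \<sigma> x o\<^sub>L \<sigma> y"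
  by (auto simp: automorphisms_def)

lemma aut_cscale: "\<sigma> \<in> automorphisms M \<Longrightarrow> x \<in> M \<Longrightarrow> \<sigma> (cscale c x) = cscale c (\<sigma> x)"
  by (auto simp: automorphisms_def)

lemma aut_adj: "\<sigma> \<in> automorphisms M \<Longrightarrow> x \<in> M \<Longrightarrow> \<sigma> (adj x) = adj (\<sigma> x)"
  by (auto simp: automorphisms_def)

lemma aut_diff:
  assumes "\<sigma> \<in> automorphisms M" "x \<in> M" "y \<in> M"
  shows "\<sigma> (x - y) = \<sigma> x - \<sigma> y"
  using aut_add[OF assms(1) diff_mem[OF assms(2,3)] assms(3)] by simp

lemma aut_id:
  assumes \<sigma>: "\<sigma> \<in> automorphisms M"
  shows "\<sigma> id_blinfun = id_blinfun"
proof -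
  have "\<sigma> id_blinfun = \<sigma> id_blinfun o\<^sub>L \<sigma> (inv_into M \<sigma> id_blinfun)"
    by (simp add: aut_inv[OF \<sigma> id_mem])
  also have "\<dots> = \<sigma> (id_blinfun o\<^sub>L inv_into M \<sigma> id_blinfun)"
    using aut_compose[OF \<sigma> id_mem aut_inv(1)[OF \<sigma> id_mem]] by simp
  also have "\<dots> = id_blinfun" by (simp add: aut_inv[OF \<sigma> id_mem])
  finally show ?thesis .
qed

text \<open>A \<open>*\<close>-homomorphism preserves invertibility. If \<open>\<parallel>\<sigma> x\<parallel> > \<parallel>x\<parallel>\<close>, then
  \<open>1 - x\<^sup>* x / \<parallel>\<sigma> x\<parallel>\<^sup>2\<close> is invertible by the Neumann series, but its image
  \<open>1 - \<sigma>(x)\<^sup>* \<sigma>(x) / \<parallel>\<sigma> x\<parallel>\<^sup>2\<close> is not bounded below on vectors that almost attain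
  the norm of \<open>\<sigma> x\<close>. The bound makes \<open>\<phi> \<circ> \<sigma>\<close> bounded on the unit ball for normal \<open>\<phi>\<close>, so that
  a small functional norm of \<open>\<phi> \<circ> \<sigma> - \<phi> \<circ> Ad u\<close> bounds its values.\<close>

lemma automorphism_contractive:
  assumes \<sigma>: "\<sigma> \<in> automorphisms M" and x: "x \<in> M"
  shows "norm (\<sigma> x) \<le> norm x"
proof (rule ccontr)
  assume "\<not> norm (\<sigma> x) \<le> norm x"
  then have less: "norm x < norm (\<sigma> x)" by simp
  define \<kappa> where "\<kappa> = (norm (\<sigma> x))\<^sup>2"
  have xk: "(norm x)\<^sup>2 < \<kappa>" unfolding \<kappa>_def using less by (intro power_strict_mono) auto
  then have k0: "\<kappa> > 0" using le_less_trans[OF zero_le_power2] by blast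
  define z where "z = cscale (of_real (1 / \<kappa>)) (adj x o\<^sub>L x)"
  have xxM: "adj x o\<^sub>L x \<in> M" by (intro compose_mem adj_mem x)
  have zM: "z \<in> M" unfolding z_def by (rule cscale_mem[OF xxM])
  have "norm z \<le> (norm x * norm x) / \<kappa>"
    unfolding z_def norm_cscale using k0 norm_blinfun_compose[of "adj x" x] norm_adj[OF bounded[OF x]]
    by (simp add: divide_right_mono norm_divide)
  also have "\<dots> < 1" using xk k0 by (simp add: power2_eq_square)
  finally obtain b where b: "b \<in> M" "b o\<^sub>L (id_blinfun - z) = id_blinfun"
    using Neumann_inverse[OF zM] by blast
  define y where "y = \<sigma> x"
  have yM: "y \<in> M" unfolding y_def by (rule aut_mem[OF \<sigma> x])
  define k where "k = \<sigma> z"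
  have k: "k = cscale (of_real (1 / \<kappa>)) (adj y o\<^sub>L y)"
    by (simp only: k_def z_def aut_cscale[OF \<sigma> xxM] aut_compose[OF \<sigma> adj_mem[OF x] x]
        aut_adj[OF \<sigma> x] y_def)
  have inv: "\<sigma> b o\<^sub>L (id_blinfun - k) = id_blinfun"
    using arg_cong[OF b(2), of \<sigma>]
    by (simp add: aut_compose[OF \<sigma> b(1) diff_mem[OF id_mem zM]] aut_diff[OF \<sigma> id_mem zM]
        aut_id[OF \<sigma>] k_def)
  \<comment> \<open>Adding 1 avoids a division by zero on the zero space.\<close>
  define D where "D = (norm (\<sigma> b))\<^sup>2 + 1"
  have D: "D \<ge> 1" by (simp add: D_def)
  have main: "(norm (blinfun_apply y \<xi>))\<^sup>2 \<le> \<kappa> * (1 - 1 / (2 * D)) * (norm \<xi>)\<^sup>2" for \<xi>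
  proof -
    define Y where "Y = (norm (blinfun_apply y \<xi>))\<^sup>2"
    have kx: "norm (blinfun_apply k \<xi>) \<le> norm \<xi>"
    proof -
      have "norm (blinfun_apply k \<xi>) \<le> norm k * norm \<xi>" by (rule norm_blinfun)
      also have "norm k \<le> norm y * norm y / \<kappa>"
        unfolding k norm_cscale using k0 norm_blinfun_compose[of "adj y" y] norm_adj[OF bounded[OF yM]]
        by (simp add: divide_right_mono norm_divide)
      also have "\<dots> = 1" using k0 by (auto simp: \<kappa>_def y_def power2_eq_square)
      finally show ?thesis by (simp add: mult_right_mono)
    qed
    have "cinner \<xi> (blinfun_apply k \<xi>) = of_real (Y / \<kappa>)"
      by (simp add: k cinner_scaleC_right cinner_adj[OF bounded[OF yM], symmetric] cinner_self Y_def)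
    then have "(norm (\<xi> - blinfun_apply k \<xi>))\<^sup>2 = (norm \<xi>)\<^sup>2 + (norm (blinfun_apply k \<xi>))\<^sup>2 - 2 * (Y / \<kappa>)"
      by (simp add: norm_sub_square)
    also have "\<dots> \<le> 2 * ((norm \<xi>)\<^sup>2 - Y / \<kappa>)"
      using power_mono[OF kx, of 2] by simp
    finally have d: "(norm (\<xi> - blinfun_apply k \<xi>))\<^sup>2 \<le> 2 * ((norm \<xi>)\<^sup>2 - Y / \<kappa>)" .
    have "\<xi> = blinfun_apply (\<sigma> b) (\<xi> - blinfun_apply k \<xi>)"
      using arg_cong[OF inv, of "\<lambda>T. blinfun_apply T \<xi>"] by (simp add: blinfun.diff_left)
    then have "norm \<xi> \<le> norm (\<sigma> b) * norm (\<xi> - blinfun_apply k \<xi>)"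
      by (metis norm_blinfun)
    then have "(norm \<xi>)\<^sup>2 \<le> (norm (\<sigma> b))\<^sup>2 * (norm (\<xi> - blinfun_apply k \<xi>))\<^sup>2"
      by (metis norm_ge_zero power_mono power_mult_distrib)
    also have "\<dots> \<le> D * (norm (\<xi> - blinfun_apply k \<xi>))\<^sup>2"
      by (rule mult_right_mono) (auto simp: D_def)
    also have "\<dots> \<le> D * (2 * ((norm \<xi>)\<^sup>2 - Y / \<kappa>))"
      by (rule mult_left_mono[OF d]) (use D in simp)
    finally have "(norm \<xi>)\<^sup>2 / (2 * D) \<le> (norm \<xi>)\<^sup>2 - Y / \<kappa>"
      using D by (simp add: field_simps)
    then have "Y / \<kappa> \<le> (1 - 1 / (2 * D)) * (norm \<xi>)\<^sup>2" by (simp add: algebra_simps)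
    then show ?thesis using k0 by (simp add: Y_def field_simps)
  qed
  define r where "r = \<kappa> * (1 - 1 / (2 * D))"
  have "1 / (2 * D) \<le> 1 / 2" "1 / (2 * D) > 0" using D by (simp_all add: field_simps)
  then have r: "r \<ge> 0" "r < \<kappa>" using k0 by (simp_all add: r_def)
  have "norm y \<le> sqrt r"
  proof (rule norm_blinfun_bound)
    fix \<xi>
    show "norm (blinfun_apply y \<xi>) \<le> sqrt r * norm \<xi>"
      by (rule power2_le_imp_le) (use main[of \<xi>] r in \<open>auto simp: r_def[symmetric] power_mult_distrib\<close>)
  qed (use r in simp)
  then have "(norm y)\<^sup>2 \<le> (sqrt r)\<^sup>2" by (intro power_mono) auto
  with r show False by (simp add: \<kappa>_def y_def)
qed

end

section \<open>Automorphisms implemented by unitaries\<close>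

lemma unitary_opD:
  assumes "V \<in> unitaries bounded_ops"
  shows "V \<in> bounded_ops" "adj V o\<^sub>L V = id_blinfun" "V o\<^sub>L adj V = id_blinfun"
    and "adj V \<in> unitaries bounded_ops" "adj (adj V) = V"
    and "blinfun_apply V (blinfun_apply (adj V) \<xi>) = \<xi>"
    and "blinfun_apply (adj V) (blinfun_apply V \<xi>) = \<xi>"
    and "norm (blinfun_apply V \<xi>) = norm \<xi>"
  using assms
  by (auto simp: unitaries_def adj_adj adj_bounded_ops norm_isometry
      simp flip: blinfun_apply_blinfun_compose)

lemma Ad_add: "Ad u (x + y) = Ad u x + Ad u y"
  by (simp add: Ad_def compose_add_left compose_add_right)

lemma Ad_diff: "Ad u (x - y) = Ad u x - Ad u y"
  by (simp add: Ad_def compose_diff_left compose_diff_right)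

lemma Ad_compose:
  assumes "V \<in> unitaries bounded_ops"
  shows "Ad V (x o\<^sub>L y) = Ad V x o\<^sub>L Ad V y"
  by (rule blinfun_eqI) (simp add: Ad_def unitary_opD[OF assms])

lemma Ad_adj_cancel:
  assumes "V \<in> unitaries bounded_ops"
  shows "Ad V (Ad (adj V) x) = x" "Ad (adj V) (Ad V x) = x"
  by (rule blinfun_eqI, simp add: Ad_def unitary_opD[OF assms])+

lemma Ad_cscale: "V \<in> unitaries bounded_ops \<Longrightarrow> Ad V (cscale c x) = cscale c (Ad V x)"
  by (rule blinfun_eqI) (simp add: Ad_def unitary_opD bounded_opsD)

lemma adj_Ad:
  assumes V: "V \<in> unitaries bounded_ops" and x: "x \<in> bounded_ops"
  shows "adj (Ad V x) = Ad V (adj x)"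
  unfolding Ad_def
  by (simp add: adj_compose unitary_opD[OF V] unitary_opD(1)[OF unitary_opD(4)[OF V]] x
      bounded_ops_compose adj_bounded_ops compose_assoc)

lemma Ad_automorphism:
  assumes M: "von_neumann_algebra M" and V: "V \<in> unitaries bounded_ops"
    and inv: "\<And>x. x \<in> M \<Longrightarrow> Ad V x \<in> M" "\<And>x. x \<in> M \<Longrightarrow> Ad (adj V) x \<in> M"
  shows "Ad V \<in> automorphisms M"
proof -
  interpret vna M by (rule vna.intro[OF M])
  have "bij_betw (Ad V) M M"
    by (rule bij_betw_byWitness[where f'="Ad (adj V)"]) (auto simp: Ad_adj_cancel[OF V] inv)
  then show ?thesis
    using V by (auto simp: automorphisms_def Ad_add Ad_compose Ad_cscale adj_Ad bounded)
qed

text \<open>Conjugation by the adjoint of \<open>V\<close> preserves the commutant of \<open>S\<close>, and this in turn makes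
  conjugation by \<open>V\<close> preserve the bicommutant.\<close>

lemma Ad_bicommutant:
  assumes V: "V \<in> unitaries bounded_ops"
    and S: "\<And>A. A \<in> S \<Longrightarrow> Ad V A \<in> S" "\<And>A. A \<in> S \<Longrightarrow> Ad (adj V) A \<in> S"
    and x: "x \<in> commutant (commutant S)"
  shows "Ad V x \<in> commutant (commutant S)"
proof -
  have step: "Ad U T \<in> commutant R"
    if U: "U \<in> unitaries bounded_ops" and R: "\<And>A. A \<in> R \<Longrightarrow> Ad (adj U) A \<in> R"
      and T: "T \<in> commutant R" for U T and R :: "'a op set"
  proof -
    have Tb: "T \<in> bounded_ops" using T commutant_bounded_ops by blast
    have "Ad U T o\<^sub>L A = A o\<^sub>L Ad U T" if A: "A \<in> R" for A
    proof -
      have "Ad U (T o\<^sub>L Ad (adj U) A) = Ad U (Ad (adj U) A o\<^sub>L T)"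
        using commutantD[OF T R[OF A]] by simp
      then show ?thesis by (simp add: Ad_compose[OF U] Ad_adj_cancel[OF U])
    qed
    moreover have "Ad U T \<in> bounded_ops"
      unfolding Ad_def by (intro bounded_ops_compose Tb unitary_opD(1) U unitary_opD(4))
    ultimately show ?thesis by (simp add: commutant_def)
  qed
  note V' = unitary_opD(4)[OF V]
  have "Ad (adj V) T \<in> commutant S" if "T \<in> commutant S" for T
    by (rule step[OF V' _ that]) (simp add: unitary_opD(5)[OF V] S(1))
  then show ?thesis by (rule step[OF V _ x])
qed

section \<open>Symmetries of the torus\<close>

lemma emeasure_circle_measure:
  assumes "A \<in> sets circle_measure"
  shows "emeasure circle_measure A = emeasure lborel (to_circle -` A \<inter> {0..<1})"
proof -
  have "to_circle \<in> restrict_space lborel {0..<1} \<rightarrow>\<^sub>M circle_algebra"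
    by (intro measurable_restrict_space1) (simp add: measurable_to_circle)
  with assms show ?thesis
    by (simp add: circle_measure_def emeasure_distr emeasure_restrict_space space_restrict_space)
qed

lemma circle_preimage_borel: "A \<in> sets circle_measure \<Longrightarrow> to_circle -` A \<in> sets borel"
  by (simp add: sets_circle_measure sets_circle_algebra)

lemma to_circle_of_int_shift: "to_circle (x + 1) = to_circle x"
  by (simp add: to_circle_eq_iff)

lemma ex_to_circle: "\<exists>d. 0 \<le> d \<and> d < 1 \<and> c = to_circle d"
proof -
  obtain d where c: "c = to_circle d"
    using circle.abs_induct[of "\<lambda>c. \<exists>d. c = to_circle d" c] by blast
  have "to_circle d = to_circle (frac d)" by (simp add: to_circle_eq_iff frac_def)
  then show ?thesis using c frac_ge_0[of d] frac_lt_1[of d] by blast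
qed

lemma emeasure_lborel_shift:
  assumes "X \<in> sets borel"
  shows "emeasure lborel ((\<lambda>y::real. y + c) -` X) = emeasure lborel X"
proof -
  have "emeasure lborel X = emeasure (distr lborel borel ((+) c)) X" by (simp add: lborel_distr_plus)
  also have "\<dots> = emeasure lborel ((+) c -` X)" using assms by (subst emeasure_distr) auto
  finally show ?thesis by (simp add: add.commute vimage_def)
qed

text \<open>For \<open>c\<close> represented by \<open>d\<close> in \<open>[0, 1)\<close>, Lebesgue measure on \<open>[0, 1)\<close> is moved to
  \<open>[-d, 1 - d)\<close>; cutting at 0 and moving the negative part by the period 1 restores \<open>[0, 1)\<close>.\<close>

lemma distr_circle_translation: "distr circle_measure circle_measure (\<lambda>r. r - c) = circle_measure"
proof (rule measure_eqI)
  fix A assume "A \<in> sets (distr circle_measure circle_measure (\<lambda>r. r - c))"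
  then have A: "A \<in> sets circle_measure" by simp
  obtain d where d: "0 \<le> d" "d < 1" "c = to_circle d" using ex_to_circle by blast
  define B where "B = to_circle -` A"
  have B [measurable]: "B \<in> sets borel" unfolding B_def by (rule circle_preimage_borel[OF A])
  have per: "y + 1 \<in> B \<longleftrightarrow> y \<in> B" for y by (simp add: B_def to_circle_of_int_shift)
  have m: "(\<lambda>r. r - c) -` A \<in> sets circle_measure"
    using measurable_sets[OF measurable_circle_translation A, of c] by simp
  have "emeasure (distr circle_measure circle_measure (\<lambda>r. r - c)) A
      = emeasure circle_measure ((\<lambda>r. r - c) -` A)"
    using A by (simp add: emeasure_distr measurable_circle_translation)
  also have "\<dots> = emeasure lborel ((\<lambda>y. y + (- d)) -` (B \<inter> {-d..<1-d}))"
    unfolding emeasure_circle_measure[OF m]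
    by (rule arg_cong[where f="emeasure lborel"]) (auto simp: B_def d(3) to_circle_diff)
  also have "\<dots> = emeasure lborel (B \<inter> {-d..<1-d})" by (rule emeasure_lborel_shift) measurable
  also have "B \<inter> {-d..<1-d} = (B \<inter> {-d..<0}) \<union> (B \<inter> {0..<1-d})" using d by auto
  also have "emeasure lborel \<dots> = emeasure lborel (B \<inter> {-d..<0}) + emeasure lborel (B \<inter> {0..<1-d})"
    by (rule plus_emeasure[symmetric]) auto
  also have "B \<inter> {-d..<0} = (\<lambda>y. y + 1) -` (B \<inter> {1-d..<1})" by (auto simp: per)
  also have "emeasure lborel \<dots> = emeasure lborel (B \<inter> {1-d..<1})"
    by (rule emeasure_lborel_shift) measurable
  also have "\<dots> + emeasure lborel (B \<inter> {0..<1-d}) = emeasure lborel ((B \<inter> {1-d..<1}) \<union> (B \<inter> {0..<1-d}))"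
    by (rule plus_emeasure) auto
  also have "(B \<inter> {1-d..<1}) \<union> (B \<inter> {0..<1-d}) = B \<inter> {0..<1}" using d by auto
  finally show "emeasure (distr circle_measure circle_measure (\<lambda>r. r - c)) A = emeasure circle_measure A"
    by (simp add: emeasure_circle_measure[OF A] B_def)
qed simp

lemma to_circle_uminus: "to_circle (- x) = - to_circle x"
  by (simp add: uminus_circle.abs_eq)

lemma measurable_circle_uminus: "uminus \<in> circle_measure \<rightarrow>\<^sub>M circle_measure"
proof (rule measurableI)
  fix A assume A: "A \<in> sets circle_measure"
  have "uminus -` (to_circle -` A) \<inter> space borel \<in> sets borel"
    by (rule measurable_sets[OF _ circle_preimage_borel[OF A]]) measurable
  also have "uminus -` (to_circle -` A) \<inter> space borel = to_circle -` (uminus -` A)"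
    by (auto simp: to_circle_uminus)
  finally show "uminus -` A \<inter> space circle_measure \<in> sets circle_measure"
    by (simp add: sets_circle_measure sets_circle_algebra)
qed simp

text \<open>Reflection moves \<open>[0, 1)\<close> to \<open>(-1, 0]\<close>, which differs from a period interval \<open>[-1, 0)\<close>
  only in two points.\<close>

lemma distr_circle_uminus: "distr circle_measure circle_measure uminus = circle_measure"
proof (rule measure_eqI)
  fix A assume "A \<in> sets (distr circle_measure circle_measure uminus)"
  then have A: "A \<in> sets circle_measure" by simp
  define B where "B = to_circle -` A"
  have B [measurable]: "B \<in> sets borel" unfolding B_def by (rule circle_preimage_borel[OF A])
  have per: "y + 1 \<in> B \<longleftrightarrow> y \<in> B" for y by (simp add: B_def to_circle_of_int_shift)
  have m: "uminus -` A \<in> sets circle_measure"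
    using measurable_sets[OF measurable_circle_uminus A] by simp
  have u: "emeasure lborel (uminus -` X) = emeasure lborel X" if "X \<in> sets borel" for X :: "real set"
    using that by (subst (2) lborel_distr_uminus[symmetric]) (simp add: emeasure_distr)
  have "emeasure (distr circle_measure circle_measure uminus) A = emeasure circle_measure (uminus -` A)"
    using A by (simp add: emeasure_distr measurable_circle_uminus)
  also have "\<dots> = emeasure lborel (uminus -` (B \<inter> {-1<..0}))"
    unfolding emeasure_circle_measure[OF m]
    by (rule arg_cong[where f="emeasure lborel"]) (auto simp: B_def to_circle_uminus)
  also have "\<dots> = emeasure lborel (B \<inter> {-1<..0})" by (rule u) measurable
  also have "\<dots> = emeasure lborel (B \<inter> {-1..<0})"
  proof (rule emeasure_eq_AE)
    show "AE x in lborel. (x \<in> B \<inter> {-1<..0}) = (x \<in> B \<inter> {-1..<0})"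
      using AE_lborel_singleton[of "-1::real"] AE_lborel_singleton[of "0::real"]
      by eventually_elim auto
  qed measurable
  also have "B \<inter> {-1..<0} = (\<lambda>y. y + 1) -` (B \<inter> {0..<1})" by (auto simp: per)
  also have "emeasure lborel \<dots> = emeasure lborel (B \<inter> {0..<1})"
    by (rule emeasure_lborel_shift) measurable
  finally show "emeasure (distr circle_measure circle_measure uminus) A = emeasure circle_measure A"
    by (simp add: emeasure_circle_measure[OF A] B_def)
qed simp

definition preserves :: "'a measure \<Rightarrow> ('a \<Rightarrow> 'a) \<Rightarrow> bool" where
  "preserves N T \<longleftrightarrow> T \<in> N \<rightarrow>\<^sub>M N \<and> distr N N T = N"

lemma preserves_torus_product:
  assumes "preserves circle_measure S" "preserves circle_measure T"
  shows "preserves torus_measure (\<lambda>x. (S (fst x), T (snd x)))"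
proof -
  have m: "S \<in> circle_measure \<rightarrow>\<^sub>M circle_measure" "T \<in> circle_measure \<rightarrow>\<^sub>M circle_measure"
    using assms by (auto simp: preserves_def)
  have "sigma_finite_measure (distr circle_measure circle_measure T)"
    using assms finite_circle_measure by (simp add: preserves_def finite_measure_def)
  from pair_measure_distr[OF m this]
  have "distr torus_measure torus_measure (\<lambda>x. (S (fst x), T (snd x))) = torus_measure"
    using assms by (simp add: torus_measure_def preserves_def case_prod_unfold)
  moreover have "(\<lambda>x. (S (fst x), T (snd x))) \<in> torus_measure \<rightarrow>\<^sub>M torus_measure"
    unfolding torus_measure_def
    by (intro measurable_Pair measurable_compose[OF measurable_fst m(1)]
        measurable_compose[OF measurable_snd m(2)])
  ultimately show ?thesis by (simp add: preserves_def)
qed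

lemma preserves_torus_translation: "preserves torus_measure (\<lambda>x. x - c)"
proof -
  have "preserves circle_measure (\<lambda>r. r - d)" for d
    by (simp add: preserves_def measurable_circle_translation distr_circle_translation)
  from preserves_torus_product[OF this[of "fst c"] this[of "snd c"]]
  show ?thesis by (simp add: minus_prod_def)
qed

lemma preserves_torus_uminus: "preserves torus_measure uminus"
proof -
  have "preserves circle_measure uminus"
    by (simp add: preserves_def measurable_circle_uminus distr_circle_uminus)
  from preserves_torus_product[OF this this]
  moreover have "(uminus :: torus \<Rightarrow> torus) = (\<lambda>x. (- fst x, - snd x))"
    by (simp add: fun_eq_iff uminus_prod_def)
  ultimately show ?thesis by simp
qed

text \<open>The regular representations, the translations and the reflection all come from such maps.
  The fibre of the preimage of \<open>A\<close> over \<open>g\<close> is the preimage under \<open>S g\<close> of the fibre of \<open>A\<close> over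
  \<open>\<kappa> g\<close>, and the bijection \<open>\<kappa>\<close> only permutes the fibres.\<close>

lemma preserves_skew:
  assumes \<kappa>: "bij \<kappa>" and S: "\<And>g. preserves torus_measure (S g)"
  shows "preserves f2_torus_measure (\<lambda>z. (\<kappa> (fst z), S (fst z) (snd z)))"
proof -
  define T where "T z = (\<kappa> (fst z), S (fst z) (snd z))" for z
  interpret t: finite_measure torus_measure by (rule finite_torus_measure)
  have Sm: "S g \<in> torus_measure \<rightarrow>\<^sub>M torus_measure" for g using S by (simp add: preserves_def)
  have T: "T \<in> f2_torus_measure \<rightarrow>\<^sub>M f2_torus_measure"
    unfolding f2_torus_measure_def
    by (rule measurable_pair_measure_countable1[OF countable_f2])
       (simp add: T_def measurable_Pair Sm)
  have "distr f2_torus_measure f2_torus_measure T = f2_torus_measure"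
  proof (rule measure_eqI)
    fix A assume "A \<in> sets (distr f2_torus_measure f2_torus_measure T)"
    then have A: "A \<in> sets f2_torus_measure" by simp
    then have A': "A \<in> sets (count_space UNIV \<Otimes>\<^sub>M torus_measure)" by (simp add: f2_torus_measure_def)
    have TA: "T -` A \<in> sets (count_space UNIV \<Otimes>\<^sub>M torus_measure)"
      using measurable_sets[OF T A] by (simp add: f2_torus_measure_def space_pair_measure)
    have fib: "emeasure torus_measure (Pair g -` (T -` A)) = emeasure torus_measure (Pair (\<kappa> g) -` A)" for g
    proof -
      have Ag: "Pair (\<kappa> g) -` A \<in> sets torus_measure" by (rule sets_Pair1[OF A'])
      have "Pair g -` (T -` A) = S g -` (Pair (\<kappa> g) -` A) \<inter> space torus_measure" by (auto simp: T_def)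
      then have "emeasure torus_measure (Pair g -` (T -` A))
          = emeasure (distr torus_measure torus_measure (S g)) (Pair (\<kappa> g) -` A)"
        using Ag by (simp add: emeasure_distr Sm)
      then show ?thesis using S[of g] by (simp add: preserves_def)
    qed
    have "emeasure (distr f2_torus_measure f2_torus_measure T) A = emeasure f2_torus_measure (T -` A)"
      using A T by (simp add: emeasure_distr f2_torus_measure_def space_pair_measure)
    also have "\<dots> = (\<integral>\<^sup>+g. emeasure torus_measure (Pair (\<kappa> g) -` A) \<partial>count_space UNIV)"
      unfolding f2_torus_measure_def by (subst t.emeasure_pair_measure_alt[OF TA]) (simp add: fib)
    also have "\<dots> = (\<integral>\<^sup>+g. emeasure torus_measure (Pair g -` A) \<partial>count_space UNIV)"
      using \<kappa> by (rule nn_integral_bij_count_space)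
    also have "\<dots> = emeasure f2_torus_measure A"
      unfolding f2_torus_measure_def by (rule t.emeasure_pair_measure_alt[OF A', symmetric])
    finally show "emeasure (distr f2_torus_measure f2_torus_measure T) A = emeasure f2_torus_measure A" .
  qed simp
  with T show ?thesis by (simp add: preserves_def T_def[abs_def])
qed

section \<open>Integrals over rectangles determine a function\<close>

definition init_arc :: "real \<Rightarrow> circle set" where
  "init_arc a = to_circle ` {0..<a}"

lemma init_arc_mem_iff:
  assumes "0 \<le> y" "y < 1" "a \<le> 1"
  shows "to_circle y \<in> init_arc a \<longleftrightarrow> y < a"
proof
  assume "to_circle y \<in> init_arc a"
  then obtain x where x: "0 \<le> x" "x < a" "y - x \<in> \<int>" by (auto simp: init_arc_def to_circle_eq_iff)
  then obtain z where "y - x = of_int z" by (auto elim!: Ints_cases)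
  moreover from this have "z < 1" "- 1 < z" using x assms by linarith+
  ultimately have "y = x" by simp
  with x show "y < a" by simp
qed (use assms in \<open>auto simp: init_arc_def\<close>)

text \<open>The section \<open>\<rho>\<close> of the quotient map with values in \<open>[0, 1)\<close> is measurable for the
  sigma-algebra generated by the arcs, because the sets \<open>\<rho> < y\<close> are arcs; and every set of the
  circle is the preimage under \<open>\<rho>\<close> of its preimage in the line.\<close>

lemma sets_circle_measure_init_arcs: "sets circle_measure = sigma_sets UNIV (init_arc ` {0..1})"
proof
  have init_arc: "init_arc a \<in> sets circle_measure" if a: "a \<in> {0..1}" for a
  proof -
    have "to_circle y \<in> init_arc a \<longleftrightarrow> frac y < a" for y
    proof -
      have "to_circle y = to_circle (frac y)" by (simp add: to_circle_eq_iff frac_def)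
      then show ?thesis using init_arc_mem_iff[of "frac y" a] a by (simp add: frac_lt_1)
    qed
    then have "to_circle -` init_arc a = {y \<in> space borel. frac y < a}" by auto
    also have "\<dots> \<in> sets borel" by (simp add: frac_def) measurable
    finally show ?thesis by (simp add: sets_circle_measure sets_circle_algebra)
  qed
  then have "init_arc ` {0..1} \<subseteq> sets circle_measure" by blast
  from sets.sigma_sets_subset[OF this]
  show "sigma_sets UNIV (init_arc ` {0..1}) \<subseteq> sets circle_measure" by simp
  define G where "G = sigma UNIV (init_arc ` {0..1})"
  have sG: "sets G = sigma_sets UNIV (init_arc ` {0..1})" "space G = UNIV" by (simp_all add: G_def)
  define \<rho> where "\<rho> c = (SOME d. 0 \<le> d \<and> d < 1 \<and> c = to_circle d)" for c
  have \<rho>: "0 \<le> \<rho> c" "\<rho> c < 1" "to_circle (\<rho> c) = c" for c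
  proof -
    have "0 \<le> \<rho> c \<and> \<rho> c < 1 \<and> c = to_circle (\<rho> c)"
      unfolding \<rho>_def by (rule someI_ex[OF ex_to_circle])
    then show "0 \<le> \<rho> c" "\<rho> c < 1" "to_circle (\<rho> c) = c" by (blast, blast, metis)
  qed
  have "\<rho> \<in> borel_measurable G"
  proof (rule borel_measurableI_less)
    fix y :: real
    have "{c. \<rho> c < y} = init_arc (max 0 (min y 1))"
    proof (rule set_eqI)
      fix c
      have "to_circle (\<rho> c) \<in> init_arc (max 0 (min y 1)) \<longleftrightarrow> \<rho> c < max 0 (min y 1)"
        by (rule init_arc_mem_iff) (auto simp: \<rho>)
      then show "c \<in> {c. \<rho> c < y} \<longleftrightarrow> c \<in> init_arc (max 0 (min y 1))"
        using \<rho>(1,2)[of c] by (simp add: \<rho>(3) less_max_iff_disj)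
    qed
    then show "{c \<in> space G. \<rho> c < y} \<in> sets G" by (auto simp: sG intro!: sigma_sets.Basic)
  qed
  then have "\<rho> -` (to_circle -` A) \<inter> space G \<in> sets G" if "A \<in> sets circle_measure" for A
    using measurable_sets circle_preimage_borel[OF that] by blast
  moreover have "\<rho> -` (to_circle -` A) = A" for A by (auto simp: \<rho>(3))
  ultimately show "sets circle_measure \<subseteq> sigma_sets UNIV (init_arc ` {0..1})" by (auto simp: sG)
qed

lemma init_arc_1: "init_arc 1 = UNIV"
proof -
  have "c \<in> init_arc 1" for c
    using ex_to_circle[of c] by (auto simp: init_arc_def)
  then show ?thesis by blast
qed

lemma init_arc_Int: "a \<in> {0..1} \<Longrightarrow> b \<in> {0..1} \<Longrightarrow> init_arc a \<inter> init_arc b = init_arc (min a b)"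
proof -
  assume ab: "a \<in> {0..1}" "b \<in> {0..1}"
  have "c \<in> init_arc a \<inter> init_arc b \<longleftrightarrow> c \<in> init_arc (min a b)" for c
  proof -
    obtain d where "0 \<le> d" "d < 1" "c = to_circle d" using ex_to_circle by blast
    with ab show ?thesis by (simp add: init_arc_mem_iff min_le_iff_disj)
  qed
  then show ?thesis by blast
qed

definition rectangles :: "torus set set" where
  "rectangles = {init_arc a \<times> init_arc b | a b. a \<in> {0..1} \<and> b \<in> {0..1}}"

lemma sets_torus_measure_rectangles: "sets torus_measure = sigma_sets UNIV rectangles"
proof -
  have "sets torus_measure
      = sets (sigma (space circle_measure \<times> space circle_measure)
          {a \<times> b | a b. a \<in> init_arc ` {0..1} \<and> b \<in> init_arc ` {0..1}})"
    unfolding torus_measure_def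
    by (rule sets_pair_eq[where Ca="{UNIV}" and Cb="{UNIV}"])
       (auto simp: sets_circle_measure_init_arcs intro!: image_eqI[where x=1] init_arc_1[symmetric])
  also have "{a \<times> b | a b. a \<in> init_arc ` {0..1} \<and> b \<in> init_arc ` {0..1}} = rectangles"
    unfolding rectangles_def by blast
  finally show ?thesis by simp
qed

text \<open>The sets over which \<open>u\<close> has integral 0 form a Dynkin system, and the rectangles are stable
  under intersection.\<close>

lemma integrable_eq_0_if_rectangles:
  fixes u :: "torus \<Rightarrow> complex"
  assumes u: "integrable torus_measure u"
    and R: "\<And>A. A \<in> rectangles \<Longrightarrow> set_lebesgue_integral torus_measure A u = 0"
  shows "AE x in torus_measure. u x = 0"
proof -
  interpret t: finite_measure torus_measure by (rule finite_torus_measure)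
  have "Int_stable rectangles"
  proof (rule Int_stableI)
    fix A B assume "A \<in> rectangles" "B \<in> rectangles"
    then obtain a b c d where ab: "A = init_arc a \<times> init_arc b" "a \<in> {0..1}" "b \<in> {0..1}"
      and cd: "B = init_arc c \<times> init_arc d" "c \<in> {0..1}" "d \<in> {0..1}" by (auto simp: rectangles_def)
    have "A \<inter> B = init_arc (min a c) \<times> init_arc (min b d)"
      using ab cd by (simp add: Times_Int_Times init_arc_Int)
    then show "A \<inter> B \<in> rectangles" using ab cd by (auto simp: rectangles_def min_def)
  qed
  moreover have "rectangles \<subseteq> Pow UNIV" by simp
  ultimately have z: "set_lebesgue_integral torus_measure A u = 0" if "A \<in> sigma_sets UNIV rectangles" for A
    using that
  proof (induction rule: sigma_sets_induct_disjoint)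
    case (compl A)
    then have A: "A \<in> sets torus_measure" by (simp add: sets_torus_measure_rectangles)
    have "UNIV \<in> rectangles"
      by (auto simp: rectangles_def init_arc_1 intro!: exI[of _ 1])
    then have U: "(\<integral>x. u x \<partial>torus_measure) = 0" using R[of UNIV] by (simp add: set_lebesgue_integral_def)
    have iA: "integrable torus_measure (\<lambda>x. indicator A x *\<^sub>R u x)"
      by (rule integrable_mult_indicator[OF A u])
    have "set_lebesgue_integral torus_measure (UNIV - A) u = (\<integral>x. u x - indicator A x *\<^sub>R u x \<partial>torus_measure)"
      unfolding set_lebesgue_integral_def
      by (rule Bochner_Integration.integral_cong) (auto simp: indicator_def)
    also have "\<dots> = 0"
      using compl.IH U Bochner_Integration.integral_diff[OF u iA] by (simp add: set_lebesgue_integral_def)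
    finally show ?case .
  next
    case empty
    show ?case by (simp add: set_lebesgue_integral_def)
  next
    case (union A)
    then have A: "A i \<in> sets torus_measure" for i by (auto simp: sets_torus_measure_rectangles)
    have "set_lebesgue_integral torus_measure (\<Union>i. A i) u = (\<Sum>i. set_lebesgue_integral torus_measure (A i) u)"
    proof (rule lebesgue_integral_countable_add[OF A])
      show "i \<noteq> j \<Longrightarrow> A i \<inter> A j = {}" for i j
        using union.hyps by (auto simp: disjoint_family_on_def)
      show "set_integrable torus_measure (\<Union> (range A)) u"
        unfolding set_integrable_def using A by (intro integrable_mult_indicator u) auto
    qed
    then show ?case using union.IH by simp
  qed (auto simp: R)
  show ?thesis
    by (rule t.density_zero[OF u]) (simp add: z sets_torus_measure_rectangles)
qed

section \<open>Multiplication and composition operators\<close>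

abbreviation square_integrable :: "(f2 \<times> torus \<Rightarrow> complex) \<Rightarrow> bool" where
  "square_integrable \<equiv> sq_int f2_torus_measure"

lemma ltwo_cases: obtains \<xi> where "x = to_ltwo \<xi>" "square_integrable \<xi>"
  by (metis to_ltwo_rep sq_int_rep_ltwo)

lemma cinner_to_ltwo:
  assumes "square_integrable \<xi>" "square_integrable \<eta>"
  shows "cinner (to_ltwo \<xi>) (to_ltwo \<eta>) = (\<integral>z. \<xi> z * cnj (\<eta> z) \<partial>f2_torus_measure)"
  using assms by (intro cinner_ltwo.abs_eq ltwo_rel_self)

lemma scaleC_to_ltwo: "square_integrable \<xi> \<Longrightarrow> c *\<^sub>C to_ltwo \<xi> = to_ltwo (\<lambda>z. c * \<xi> z)"
  by (intro scaleC_ltwo.abs_eq ltwo_rel_self)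

lemma plus_to_ltwo:
  "square_integrable \<xi> \<Longrightarrow> square_integrable \<eta> \<Longrightarrow> to_ltwo \<xi> + to_ltwo \<eta> = to_ltwo (\<lambda>z. \<xi> z + \<eta> z)"
  by (intro plus_ltwo.abs_eq ltwo_rel_self)

lemma measurable_cnj [measurable]: "cnj \<in> borel_measurable borel"
  by (intro borel_measurable_continuous_onI continuous_intros)

subsection \<open>Multiplication\<close>

definition symbols :: "(f2 \<times> torus \<Rightarrow> complex) set" where
  "symbols = {F \<in> borel_measurable f2_torus_measure. bounded (range F)}"

definition mult_op :: "(f2 \<times> torus \<Rightarrow> complex) \<Rightarrow> ltwo op" where
  "mult_op F = Blinfun (\<lambda>\<xi>. to_ltwo (\<lambda>z. F z * rep_ltwo \<xi> z))"

lemma mult_op_apply: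
  assumes F: "F \<in> symbols" and \<xi>: "square_integrable \<xi>"
  shows "blinfun_apply (mult_op F) (to_ltwo \<xi>) = to_ltwo (\<lambda>z. F z * \<xi> z)"
    and "square_integrable (\<lambda>z. F z * \<xi> z)"
proof -
  obtain C where C: "\<And>z. cmod (F z) \<le> C" using F by (auto simp: symbols_def bounded_iff)
  have m: "F \<in> borel_measurable f2_torus_measure" using F by (simp add: symbols_def)
  show "blinfun_apply (mult_op F) (to_ltwo \<xi>) = to_ltwo (\<lambda>z. F z * \<xi> z)"
    unfolding mult_op_def bounded_linear_Blinfun_apply[OF bounded_linear_mult_ltwo(1)[OF m C]]
    by (rule bounded_linear_mult_ltwo(3)[OF m C \<xi>])
  show "square_integrable (\<lambda>z. F z * \<xi> z)" by (rule bounded_linear_mult_ltwo(2)[OF m C \<xi>])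
qed

lemma symbols_mult:
  assumes "F \<in> symbols" "G \<in> symbols"
  shows "(\<lambda>z. F z * G z) \<in> symbols"
proof -
  have [measurable]: "F \<in> borel_measurable f2_torus_measure" "G \<in> borel_measurable f2_torus_measure"
    using assms by (auto simp: symbols_def)
  obtain B C where B: "\<And>z. cmod (F z) \<le> B" and C: "\<And>z. cmod (G z) \<le> C"
    using assms by (auto simp: symbols_def bounded_iff)
  have "cmod (F z * G z) \<le> B * C" for z
    unfolding norm_mult by (intro mult_mono B C order_trans[OF norm_ge_zero B]) simp
  then have "bounded (range (\<lambda>z. F z * G z))" by (auto simp: bounded_iff)
  then show ?thesis by (simp add: symbols_def)
qed

lemma symbols_cnj:
  assumes "F \<in> symbols"
  shows "(\<lambda>z. cnj (F z)) \<in> symbols"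
proof -
  have [measurable]: "F \<in> borel_measurable f2_torus_measure" using assms by (simp add: symbols_def)
  show ?thesis using assms by (simp add: symbols_def bounded_iff)
qed

lemma symbols_const: "(\<lambda>z. c) \<in> symbols"
  by (simp add: symbols_def)

lemma mult_op_bounded_ops: "F \<in> symbols \<Longrightarrow> mult_op F \<in> bounded_ops"
proof -
  assume F: "F \<in> symbols"
  have "blinfun_apply (mult_op F) (c *\<^sub>C x) = c *\<^sub>C blinfun_apply (mult_op F) x" for c x
    by (cases x rule: ltwo_cases)
       (simp add: scaleC_to_ltwo mult_op_apply[OF F] sq_int_scale mult.left_commute)
  then show ?thesis by (simp add: bounded_ops_def)
qed

lemma mult_op_compose:
  assumes "F \<in> symbols" "G \<in> symbols"
  shows "mult_op F o\<^sub>L mult_op G = mult_op (\<lambda>z. F z * G z)"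
proof (rule blinfun_eqI)
  fix x
  show "blinfun_apply (mult_op F o\<^sub>L mult_op G) x = blinfun_apply (mult_op (\<lambda>z. F z * G z)) x"
    by (cases x rule: ltwo_cases)
       (simp add: mult_op_apply assms symbols_mult mult.assoc)
qed

lemma adj_mult_op:
  assumes F: "F \<in> symbols"
  shows "adj (mult_op F) = mult_op (\<lambda>z. cnj (F z))"
proof (rule adj_eqI)
  fix x y
  obtain \<xi> \<eta> where x: "x = to_ltwo \<xi>" "square_integrable \<xi>"
    and y: "y = to_ltwo \<eta>" "square_integrable \<eta>" by (metis ltwo_cases)
  show "cinner (blinfun_apply (mult_op F) x) y = cinner x (blinfun_apply (mult_op (\<lambda>z. cnj (F z))) y)"
    using mult_op_apply[OF F x(2)] mult_op_apply[OF symbols_cnj[OF F] y(2)]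
    by (simp add: x y cinner_to_ltwo) (simp add: mult_ac)
qed

lemma mult_op_one: "mult_op (\<lambda>z. 1) = id_blinfun"
proof (rule blinfun_eqI)
  fix x show "blinfun_apply (mult_op (\<lambda>z. 1)) x = blinfun_apply id_blinfun x"
    by (cases x rule: ltwo_cases) (simp add: mult_op_apply symbols_const)
qed

lemma mult_op_unitary:
  assumes F: "F \<in> symbols" "\<And>z. cmod (F z) = 1"
  shows "mult_op F \<in> unitaries bounded_ops"
proof -
  have "cnj (F z) * F z = 1" "F z * cnj (F z) = 1" for z
    using complex_norm_square[of "F z"] F(2)[of z] by (simp_all add: mult.commute)
  then show ?thesis
    by (simp add: unitaries_def mult_op_bounded_ops F adj_mult_op mult_op_compose symbols_cnj mult_op_one)
qed

lemma cscale_mult_op: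
  assumes F: "F \<in> symbols"
  shows "cscale c (mult_op F) = mult_op (\<lambda>z. c * F z)"
proof (rule blinfun_eqI)
  fix x
  show "blinfun_apply (cscale c (mult_op F)) x = blinfun_apply (mult_op (\<lambda>z. c * F z)) x"
    by (cases x rule: ltwo_cases)
       (simp add: mult_op_apply F symbols_mult[OF symbols_const F] scaleC_to_ltwo mult.assoc)
qed

lemma norm_mult_op_square:
  assumes F: "F \<in> symbols" and \<xi>: "square_integrable \<xi>"
  shows "(norm (blinfun_apply (mult_op F) (to_ltwo \<xi>)))\<^sup>2 = (\<integral>z. (cmod (F z * \<xi> z))\<^sup>2 \<partial>f2_torus_measure)"
  by (simp add: mult_op_apply[OF F \<xi>] norm_to_ltwo)

subsection \<open>Composition with measure preserving maps\<close>

definition comp_op :: "(f2 \<times> torus \<Rightarrow> f2 \<times> torus) \<Rightarrow> ltwo op" where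
  "comp_op T = Blinfun (\<lambda>\<xi>. to_ltwo (\<lambda>z. rep_ltwo \<xi> (T z)))"

abbreviation mpt :: "(f2 \<times> torus \<Rightarrow> f2 \<times> torus) \<Rightarrow> bool" where
  "mpt \<equiv> preserves f2_torus_measure"

lemma mpt_integral:
  fixes f :: "f2 \<times> torus \<Rightarrow> 'b :: {banach, second_countable_topology}"
  assumes T: "mpt T" and f: "f \<in> borel_measurable f2_torus_measure"
  shows "(\<integral>z. f (T z) \<partial>f2_torus_measure) = (\<integral>z. f z \<partial>f2_torus_measure)"
    and "integrable f2_torus_measure f \<Longrightarrow> integrable f2_torus_measure (\<lambda>z. f (T z))"
proof -
  have m: "T \<in> f2_torus_measure \<rightarrow>\<^sub>M f2_torus_measure"
    and d: "distr f2_torus_measure f2_torus_measure T = f2_torus_measure"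
    using T by (auto simp: preserves_def)
  show "(\<integral>z. f (T z) \<partial>f2_torus_measure) = (\<integral>z. f z \<partial>f2_torus_measure)"
    using integral_distr[OF m f] by (simp add: d)
  show "integrable f2_torus_measure f \<Longrightarrow> integrable f2_torus_measure (\<lambda>z. f (T z))"
    using integrable_distr_eq[OF m f] by (simp add: d)
qed

lemma mpt_compose:
  assumes "mpt T" "mpt U"
  shows "mpt (\<lambda>z. T (U z))"
proof -
  have "distr (distr f2_torus_measure f2_torus_measure U) f2_torus_measure T
      = distr f2_torus_measure f2_torus_measure (T \<circ> U)"
    using assms by (intro distr_distr) (auto simp: preserves_def)
  then show ?thesis
    using assms by (auto simp: preserves_def comp_def intro: measurable_compose)
qed

lemma square_integrable_mpt:
  assumes T: "mpt T" and \<xi>: "square_integrable \<xi>"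
  shows "square_integrable (\<lambda>z. \<xi> (T z))"
proof -
  have [measurable]: "\<xi> \<in> borel_measurable f2_torus_measure" "T \<in> f2_torus_measure \<rightarrow>\<^sub>M f2_torus_measure"
    using T \<xi> by (auto simp: sq_int_def preserves_def)
  have "integrable f2_torus_measure (\<lambda>z. (cmod (\<xi> (T z)))\<^sup>2)"
    by (rule mpt_integral(2)[OF T]) (use \<xi> in \<open>auto simp: sq_int_def\<close>)
  then show ?thesis by (simp add: sq_int_def)
qed

lemma symbols_mpt:
  assumes T: "mpt T" and F: "F \<in> symbols"
  shows "(\<lambda>z. F (T z)) \<in> symbols"
proof -
  have [measurable]: "F \<in> borel_measurable f2_torus_measure" "T \<in> f2_torus_measure \<rightarrow>\<^sub>M f2_torus_measure"
    using T F by (auto simp: symbols_def preserves_def)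
  have "bounded (range (\<lambda>z. F (T z)))" using F by (auto simp: symbols_def elim!: bounded_subset)
  then show ?thesis by (simp add: symbols_def)
qed

lemma ltwo_rel_mpt:
  assumes T: "mpt T" and r: "ltwo_rel \<xi> \<eta>"
  shows "ltwo_rel (\<lambda>z. \<xi> (T z)) (\<lambda>z. \<eta> (T z))"
proof -
  have [measurable]: "\<xi> \<in> borel_measurable f2_torus_measure" "\<eta> \<in> borel_measurable f2_torus_measure"
    "T \<in> f2_torus_measure \<rightarrow>\<^sub>M f2_torus_measure"
    using r T by (auto simp: sq_int_def ltwo_rel_def preserves_def)
  have "AE z in distr f2_torus_measure f2_torus_measure T. \<xi> z = \<eta> z"
  proof -
    have "distr f2_torus_measure f2_torus_measure T = f2_torus_measure"
      using T by (simp add: preserves_def)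
    then show ?thesis using r by (simp only: ltwo_rel_def)
  qed
  then have "AE z in f2_torus_measure. \<xi> (T z) = \<eta> (T z)"
    by (subst (asm) AE_distr_iff) measurable
  then show ?thesis using r by (simp add: ltwo_rel_def square_integrable_mpt[OF T])
qed

lemma comp_op_apply:
  assumes T: "mpt T" and \<xi>: "square_integrable \<xi>"
  shows "blinfun_apply (comp_op T) (to_ltwo \<xi>) = to_ltwo (\<lambda>z. \<xi> (T z))"
proof -
  have ap: "to_ltwo (\<lambda>z. rep_ltwo (to_ltwo \<xi>) (T z)) = to_ltwo (\<lambda>z. \<xi> (T z))"
    if "square_integrable \<xi>" for \<xi>
    by (intro to_ltwo_eqI ltwo_rel_mpt[OF T] rep_to_ltwo that)
  have "bounded_linear (\<lambda>\<xi>. to_ltwo (\<lambda>z. rep_ltwo \<xi> (T z)))"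
  proof (rule bounded_linear_intro[where K=1])
    fix x y :: ltwo and r :: real
    obtain \<xi> \<eta> where x: "x = to_ltwo \<xi>" "square_integrable \<xi>"
      and y: "y = to_ltwo \<eta>" "square_integrable \<eta>" by (metis ltwo_cases)
    show "to_ltwo (\<lambda>z. rep_ltwo (x + y) (T z))
        = to_ltwo (\<lambda>z. rep_ltwo x (T z)) + to_ltwo (\<lambda>z. rep_ltwo y (T z))"
      using x(2) y(2) by (simp add: x(1) y(1) ap square_integrable_mpt[OF T] plus_to_ltwo sq_int_add)
    show "to_ltwo (\<lambda>z. rep_ltwo (r *\<^sub>R x) (T z)) = r *\<^sub>R to_ltwo (\<lambda>z. rep_ltwo x (T z))"
      using x(2) by (simp add: x(1) ap square_integrable_mpt[OF T] scaleR_scaleC scaleC_to_ltwo sq_int_scale)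
    have "(norm (to_ltwo (\<lambda>z. \<xi> (T z))))\<^sup>2 = (norm x)\<^sup>2"
    proof -
      have [measurable]: "\<xi> \<in> borel_measurable f2_torus_measure" using x by (simp add: sq_int_def)
      show ?thesis
        using x(2) mpt_integral(1)[OF T, of "\<lambda>z. (cmod (\<xi> z))\<^sup>2"]
        by (simp add: x(1) norm_to_ltwo square_integrable_mpt[OF T])
    qed
    then show "norm (to_ltwo (\<lambda>z. rep_ltwo x (T z))) \<le> norm x * 1"
      using x(2) by (simp add: x(1) ap power2_eq_iff_nonneg)
  qed
  from bounded_linear_Blinfun_apply[OF this] show ?thesis
    using ap[OF \<xi>] by (simp add: comp_op_def)
qed

lemma comp_op_bounded_ops:
  assumes T: "mpt T"
  shows "comp_op T \<in> bounded_ops"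
proof -
  have "blinfun_apply (comp_op T) (c *\<^sub>C x) = c *\<^sub>C blinfun_apply (comp_op T) x" for c x
    by (cases x rule: ltwo_cases)
       (simp add: scaleC_to_ltwo comp_op_apply[OF T] sq_int_scale square_integrable_mpt[OF T])
  then show ?thesis by (simp add: bounded_ops_def)
qed

lemma comp_op_compose:
  assumes T: "mpt T" and U: "mpt U"
  shows "comp_op T o\<^sub>L comp_op U = comp_op (\<lambda>z. U (T z))"
proof (rule blinfun_eqI)
  fix x
  show "blinfun_apply (comp_op T o\<^sub>L comp_op U) x = blinfun_apply (comp_op (\<lambda>z. U (T z))) x"
    by (cases x rule: ltwo_cases)
       (simp add: comp_op_apply[OF T] comp_op_apply[OF U] comp_op_apply[OF mpt_compose[OF U T]]
          square_integrable_mpt[OF U])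
qed

lemma comp_op_id: "comp_op (\<lambda>z. z) = id_blinfun"
proof (rule blinfun_eqI)
  have "mpt (\<lambda>z. z)" by (simp add: preserves_def distr_id2)
  then show "blinfun_apply (comp_op (\<lambda>z. z)) x = blinfun_apply id_blinfun x" for x
    by (cases x rule: ltwo_cases) (simp add: comp_op_apply)
qed

lemma comp_op_mult_op:
  assumes T: "mpt T" and F: "F \<in> symbols"
  shows "comp_op T o\<^sub>L mult_op F = mult_op (\<lambda>z. F (T z)) o\<^sub>L comp_op T"
proof (rule blinfun_eqI)
  fix x
  show "blinfun_apply (comp_op T o\<^sub>L mult_op F) x = blinfun_apply (mult_op (\<lambda>z. F (T z)) o\<^sub>L comp_op T) x"
    by (cases x rule: ltwo_cases)
       (simp add: comp_op_apply[OF T] mult_op_apply[OF F] mult_op_apply[OF symbols_mpt[OF T F]]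
          square_integrable_mpt[OF T])
qed

lemma cinner_comp_op:
  assumes T: "mpt T"
  shows "cinner (blinfun_apply (comp_op T) x) (blinfun_apply (comp_op T) y) = cinner x y"
proof -
  obtain \<xi> \<eta> where x: "x = to_ltwo \<xi>" "square_integrable \<xi>"
    and y: "y = to_ltwo \<eta>" "square_integrable \<eta>" by (metis ltwo_cases)
  have [measurable]: "\<xi> \<in> borel_measurable f2_torus_measure" "\<eta> \<in> borel_measurable f2_torus_measure"
    using x y by (auto simp: sq_int_def)
  show ?thesis
    using x(2) y(2) mpt_integral(1)[OF T, of "\<lambda>z. \<xi> z * cnj (\<eta> z)"]
    by (simp add: x(1) y(1) comp_op_apply[OF T] cinner_to_ltwo square_integrable_mpt[OF T])
qed

lemma adj_comp_op:
  assumes T: "mpt T" and U: "mpt U" and inv: "\<And>z. U (T z) = z" "\<And>z. T (U z) = z"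
  shows "adj (comp_op T) = comp_op U"
proof (rule adj_eqI)
  fix x y
  have "blinfun_apply (comp_op T) (blinfun_apply (comp_op U) y) = y"
    using comp_op_compose[OF T U] by (simp add: inv comp_op_id flip: blinfun_apply_blinfun_compose)
  then show "cinner (blinfun_apply (comp_op T) x) y = cinner x (blinfun_apply (comp_op U) y)"
    using cinner_comp_op[OF T, of x "blinfun_apply (comp_op U) y"] by simp
qed

lemma comp_op_unitary:
  assumes T: "mpt T" and U: "mpt U" and inv: "\<And>z. U (T z) = z" "\<And>z. T (U z) = z"
  shows "comp_op T \<in> unitaries bounded_ops"
  by (simp add: unitaries_def comp_op_bounded_ops[OF T] adj_comp_op[OF assms]
      comp_op_compose[OF T U] comp_op_compose[OF U T] inv comp_op_id)

lemma Ad_comp_op_mult_op: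
  assumes T: "mpt T" and U: "mpt U" and inv: "\<And>z. U (T z) = z" "\<And>z. T (U z) = z"
    and F: "F \<in> symbols"
  shows "Ad (comp_op T) (mult_op F) = mult_op (\<lambda>z. F (T z))"
  by (simp add: Ad_def comp_op_mult_op[OF T F] compose_assoc adj_comp_op[OF T U inv]
      comp_op_compose[OF T U] inv comp_op_id)

lemma Ad_comp_op_comp_op:
  assumes T: "mpt T" and U: "mpt U" and inv: "\<And>z. U (T z) = z" "\<And>z. T (U z) = z"
    and S: "mpt S"
  shows "Ad (comp_op T) (comp_op S) = comp_op (\<lambda>z. U (S (T z)))"
  by (simp add: Ad_def adj_comp_op[OF T U inv] comp_op_compose[OF T S] comp_op_compose[OF mpt_compose[OF S T] U])

section \<open>Total families of vectors\<close>

text \<open>The elementary tensor of the point mass at \<open>h\<close> and \<open>f\<close>.\<close>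

definition slice :: "f2 \<Rightarrow> (torus \<Rightarrow> complex) \<Rightarrow> f2 \<times> torus \<Rightarrow> complex" where
  "slice h f z = (if fst z = h then f (snd z) else 0)"

interpretation torus: finite_measure torus_measure
  by (rule finite_torus_measure)

interpretation f2_torus: pair_sigma_finite "count_space (UNIV :: f2 set)" torus_measure
  by (intro pair_sigma_finite.intro sigma_finite_measure_count_space_countable countable_f2
      torus.sigma_finite_measure_axioms)

lemma slice_measurable:
  assumes [measurable]: "f \<in> borel_measurable torus_measure"
  shows "slice h f \<in> borel_measurable f2_torus_measure"
  unfolding f2_torus_measure_def
proof (rule measurable_pair_measure_countable1[OF countable_f2])
  show "(\<lambda>y. slice h f (x, y)) \<in> borel_measurable torus_measure" for x
    by (cases "x = h") (simp_all add: slice_def)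
qed

lemma nn_integral_slice:
  assumes [measurable]: "f \<in> borel_measurable torus_measure"
  shows "(\<integral>\<^sup>+z. ennreal ((cmod (slice h f z))\<^sup>2) \<partial>f2_torus_measure) = (\<integral>\<^sup>+x. ennreal ((cmod (f x))\<^sup>2) \<partial>torus_measure)"
proof -
  have [measurable]: "slice h f \<in> borel_measurable (count_space UNIV \<Otimes>\<^sub>M torus_measure)"
    using slice_measurable[of f h] by (simp add: f2_torus_measure_def)
  have "(\<integral>\<^sup>+z. ennreal ((cmod (slice h f z))\<^sup>2) \<partial>f2_torus_measure)
      = (\<integral>\<^sup>+g. (\<integral>\<^sup>+x. ennreal ((cmod (slice h f (g, x)))\<^sup>2) \<partial>torus_measure) \<partial>count_space UNIV)"
    unfolding f2_torus_measure_def by (rule torus.nn_integral_fst[symmetric]) measurable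
  also have "\<dots> = (\<integral>\<^sup>+g. (\<integral>\<^sup>+x. ennreal ((cmod (f x))\<^sup>2) \<partial>torus_measure) * indicator {h} g \<partial>count_space UNIV)"
    by (rule nn_integral_cong) (auto simp: slice_def indicator_def)
  also have "\<dots> = (\<integral>\<^sup>+x. ennreal ((cmod (f x))\<^sup>2) \<partial>torus_measure)"
    by (simp add: nn_integral_cmult_indicator)
  finally show ?thesis .
qed

lemma slice_square_integrable:
  assumes "f \<in> linf"
  shows "square_integrable (slice h f)"
proof -
  have m [measurable]: "f \<in> borel_measurable torus_measure" using assms by (simp add: linf_def)
  obtain C where C: "\<And>x. cmod (f x) \<le> C" using assms by (auto simp: linf_def bounded_iff)
  have "(\<integral>\<^sup>+x. ennreal ((cmod (f x))\<^sup>2) \<partial>torus_measure) \<le> (\<integral>\<^sup>+x. ennreal (C\<^sup>2) \<partial>torus_measure)"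
    by (intro nn_integral_mono ennreal_leI power_mono C) simp
  also have "\<dots> < \<infinity>" using torus.emeasure_finite[of UNIV] by (simp add: ennreal_mult_less_top less_top[symmetric] ennreal_mult_eq_top_iff)
  finally have "integrable f2_torus_measure (\<lambda>z. (cmod (slice h f z))\<^sup>2)"
    using slice_measurable[OF m, of h] by (intro integrableI_bounded) (simp_all add: nn_integral_slice[OF m])
  with slice_measurable[OF m] show ?thesis by (simp add: sq_int_def)
qed

lemma fibre_sq_int:
  assumes \<xi>: "square_integrable \<xi>"
  shows "sq_int torus_measure (\<lambda>x. \<xi> (g, x))"
proof -
  have m: "\<xi> \<in> borel_measurable (count_space UNIV \<Otimes>\<^sub>M torus_measure)"
    and i: "integrable (count_space UNIV \<Otimes>\<^sub>M torus_measure) (\<lambda>z. (cmod (\<xi> z))\<^sup>2)"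
    using \<xi> by (auto simp: sq_int_def f2_torus_measure_def)
  have "(\<lambda>x. \<xi> (g, x)) \<in> borel_measurable torus_measure"
    by (rule measurable_compose[OF measurable_Pair1' m]) simp
  moreover have "integrable torus_measure (\<lambda>x. (cmod (\<xi> (g, x)))\<^sup>2)"
    using f2_torus.AE_integrable_fst'[OF i] by (simp add: AE_count_space)
  ultimately show ?thesis by (simp add: sq_int_def)
qed

lemma cinner_slice:
  assumes \<xi>: "square_integrable \<xi>" and f: "f \<in> linf"
  shows "cinner (to_ltwo \<xi>) (to_ltwo (slice h f)) = (\<integral>x. \<xi> (h, x) * cnj (f x) \<partial>torus_measure)"
proof -
  define F where "F z = \<xi> z * cnj (slice h f z)" for z
  have "integrable f2_torus_measure F"
    unfolding F_def by (rule integrable_mult_sq_int[OF \<xi> slice_square_integrable[OF f]])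
  then have i: "integrable (count_space UNIV \<Otimes>\<^sub>M torus_measure) F" by (simp add: f2_torus_measure_def)
  have F0: "(\<integral>x. F (g, x) \<partial>torus_measure) = (if g = h then (\<integral>x. \<xi> (h, x) * cnj (f x) \<partial>torus_measure) else 0)" for g
    by (simp add: F_def slice_def)
  have fin: "finite {g. (\<integral>x. F (g, x) \<partial>torus_measure) \<noteq> 0}"
    by (rule finite_subset[of _ "{h}"]) (auto simp: F0)
  have "cinner (to_ltwo \<xi>) (to_ltwo (slice h f)) = (\<integral>g. (\<integral>x. F (g, x) \<partial>torus_measure) \<partial>count_space UNIV)"
    unfolding f2_torus.integral_fst'[OF i] cinner_to_ltwo[OF \<xi> slice_square_integrable[OF f]]
    by (simp add: F_def[abs_def] f2_torus_measure_def)
  also have "\<dots> = (\<Sum>g | g \<in> UNIV \<and> (\<integral>x. F (g, x) \<partial>torus_measure) \<noteq> 0. \<integral>x. F (g, x) \<partial>torus_measure)"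
    using fin by (intro lebesgue_integral_count_space_finite_support) simp
  also have "\<dots> = (\<Sum>g\<in>{h}. \<integral>x. F (g, x) \<partial>torus_measure)"
    by (rule sum.mono_neutral_left) (auto simp: F0 split: if_splits)
  finally show ?thesis by (simp add: F0)
qed

lemma rectangles_sets: "A \<in> rectangles \<Longrightarrow> A \<in> sets torus_measure"
  by (simp add: sets_torus_measure_rectangles)

lemma indicator_linf: "A \<in> sets torus_measure \<Longrightarrow> (indicator A :: torus \<Rightarrow> complex) \<in> linf"
  by (auto simp: linf_def bounded_iff indicator_def intro!: exI[of _ 1] split: if_splits)

text \<open>The functions on the copy of the torus at \<open>h\<close> can be tested separately for each \<open>h\<close>, where
  indicators of rectangles suffice.\<close>

lemma slices_total:
  assumes "\<And>h A. A \<in> rectangles \<Longrightarrow> cinner \<zeta> (to_ltwo (slice h (indicator A))) = 0"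
  shows "\<zeta> = 0"
proof -
  obtain \<xi> where z: "\<zeta> = to_ltwo \<xi>" and \<xi>: "square_integrable \<xi>" by (rule ltwo_cases)
  have m [measurable]: "\<xi> \<in> borel_measurable (count_space UNIV \<Otimes>\<^sub>M torus_measure)"
    using \<xi> by (auto simp: sq_int_def f2_torus_measure_def)
  have "AE x in torus_measure. \<xi> (g, x) = 0" for g
  proof (rule integrable_eq_0_if_rectangles)
    have "sq_int torus_measure (\<lambda>x. 1)" by (simp add: sq_int_def)
    from integrable_mult_sq_int[OF fibre_sq_int[OF \<xi>] this]
    show "integrable torus_measure (\<lambda>x. \<xi> (g, x))" by simp
    fix A assume A: "A \<in> rectangles"
    have "set_lebesgue_integral torus_measure A (\<lambda>x. \<xi> (g, x))
        = (\<integral>x. \<xi> (g, x) * cnj (indicator A x) \<partial>torus_measure)"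
      unfolding set_lebesgue_integral_def
      by (rule Bochner_Integration.integral_cong) (auto simp: indicator_def)
    also have "\<dots> = 0"
      using assms[OF A, of g] cinner_slice[OF \<xi> indicator_linf[OF rectangles_sets[OF A]], of g]
      by (simp add: z)
    finally show "set_lebesgue_integral torus_measure A (\<lambda>x. \<xi> (g, x)) = 0" .
  qed
  then have "AE z in f2_torus_measure. \<xi> z = 0"
    unfolding f2_torus_measure_def by (intro f2_torus.AE_pair_measure) (auto simp: AE_count_space, measurable)
  then have "ltwo_rel \<xi> (\<lambda>z. 0)" using \<xi> by (simp add: ltwo_rel_def)
  then show ?thesis unfolding z by (simp add: to_ltwo_eqI zero_ltwo_def)
qed

lemma closed_subspace_of_slices:
  fixes K :: "ltwo set"
  assumes "closed K" "subspace K" "\<And>c x. x \<in> K \<Longrightarrow> c *\<^sub>C x \<in> K"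
    and R: "\<And>h A. A \<in> rectangles \<Longrightarrow> to_ltwo (slice h (indicator A)) \<in> K"
  shows "x \<in> K"
proof (rule closed_subspace_eq_UNIV[OF assms(1,2)])
  fix z assume z: "\<And>k. k \<in> K \<Longrightarrow> inner k z = 0"
  have "cinner k z = 0" if k: "k \<in> K" for k
  proof (rule complex_eqI)
    show "Re (cinner k z) = Re 0" using z[OF k] by (simp add: inner_cinner)
    show "Im (cinner k z) = Im 0"
      using z[OF assms(3)[OF k, of "- \<i>"]] by (simp add: inner_cinner cinner_scaleC_left)
  qed
  then have "cinner z k = 0" if "k \<in> K" for k
    using that cinner_commute[of z k] by simp
  then show "z = 0" by (intro slices_total) (simp add: R)
qed

section \<open>The crossed product and its commutant\<close>

definition rotation :: torus where
  "rotation = (to_circle (1 / sqrt 2), to_circle (1 / sqrt 3))"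

definition letter_shift :: "letter \<Rightarrow> torus" where
  "letter_shift l = (if snd l then rotation else - rotation)"

text \<open>The group acts on functions through its exponent sum: \<open>g\<close> translates by the exponent sum
  of \<open>g\<close> times the rotation vector (\<open>free_action_shift\<close>).\<close>

definition shift :: "f2 \<Rightarrow> torus" where
  "shift g = sum_list (map letter_shift (word g))"

lemma letter_shift_inv: "letter_shift (letter_inv l) = - letter_shift l"
  by (simp add: letter_shift_def letter_inv_def)

lemma sum_letter_shift_lmult:
  "sum_list (map letter_shift (lmult l w)) = letter_shift l + sum_list (map letter_shift w)"
  by (cases w) (auto simp: lmult_def letter_shift_inv)

lemma shift_mult: "shift (g * h) = shift g + shift h"
proof -
  have "sum_list (map letter_shift (foldr lmult v w))
      = sum_list (map letter_shift v) + sum_list (map letter_shift w)" for v w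
    by (induction v) (simp_all add: sum_letter_shift_lmult add.assoc)
  then show ?thesis by (simp add: shift_def times_f2.rep_eq)
qed

lemma shift_one [simp]: "shift 1 = 0"
  by (simp add: shift_def one_f2.rep_eq)

lemma shift_inv: "shift (f2_inv g) = - shift g"
proof -
  have "shift (f2_inv g) + shift g = 0" by (simp flip: shift_mult)
  then show ?thesis by (simp add: eq_neg_iff_add_eq_0)
qed

lemma free_action_shift: "free_action alpha alpha g f = (\<lambda>x. f (x - shift g))"
proof -
  have a: "alpha = (\<lambda>f x. f (x - rotation))" by (simp add: alpha_translation fun_eq_iff rotation_def)
  have l: "letter_action alpha alpha l = (\<lambda>f x. f (x - letter_shift l))" for l
    by (cases l; cases "fst l"; cases "snd l")
       (auto simp: letter_action_def letter_shift_def a[symmetric] inv_alpha[folded rotation_def])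
  have "foldr (\<lambda>l. (\<circ>) (letter_action alpha alpha l)) w id f
      = (\<lambda>x. f (x - sum_list (map letter_shift w)))" for w
    by (induction w) (simp_all add: l algebra_simps)
  then show ?thesis by (simp add: free_action_def shift_def)
qed

definition pi_symbol :: "(torus \<Rightarrow> complex) \<Rightarrow> f2 \<times> torus \<Rightarrow> complex" where
  "pi_symbol f z = f (snd z + shift (fst z))"

lemma cp_pi_eq: "cp_pi f = mult_op (pi_symbol f)"
proof -
  have "(\<lambda>(g, x). free_action alpha alpha (f2_inv g) f x * \<xi> (g, x)) = (\<lambda>z. pi_symbol f z * \<xi> z)"
    for \<xi> by (simp add: fun_eq_iff pi_symbol_def free_action_shift shift_inv)
  then show ?thesis by (simp add: cp_pi_def mult_op_def)
qed

lemma symbols_base: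
  assumes "f \<in> linf"
  shows "(\<lambda>z. f (snd z)) \<in> symbols"
proof -
  have [measurable]: "f \<in> borel_measurable torus_measure" using assms by (simp add: linf_def)
  have "(\<lambda>z. f (snd z)) \<in> borel_measurable f2_torus_measure"
    unfolding f2_torus_measure_def by measurable
  then show ?thesis using assms by (auto simp: symbols_def linf_def elim!: bounded_subset)
qed

lemma symbols_group: "bounded (range F) \<Longrightarrow> (\<lambda>z. F (fst z)) \<in> symbols"
proof -
  assume "bounded (range F)"
  moreover have "(\<lambda>z. F (fst z)) \<in> borel_measurable f2_torus_measure"
    unfolding f2_torus_measure_def
    by (rule measurable_pair_measure_countable1[OF countable_f2]) simp
  ultimately show ?thesis by (auto simp: symbols_def elim!: bounded_subset)
qed

lemma mpt_skew:
  "bij \<kappa> \<Longrightarrow> mpt (\<lambda>z. (\<kappa> (fst z), snd z - c (fst z)))"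
  by (rule preserves_skew[of _ "\<lambda>g x. x - c g"]) (auto intro: preserves_torus_translation)

lemma bij_f2:
  shows "bij (\<lambda>g. h * g :: f2)" "bij (\<lambda>g. g * h :: f2)" "bij f2_inv" "bij (\<lambda>g. f2_inv h * g * h)"
proof -
  have canc: "f2_inv h * (h * g) = g" "h * (f2_inv h * g) = g" "g * h * f2_inv h = g" "g * f2_inv h * h = g"
    for g h :: f2
    by (simp_all only: mult.assoc f2_right_inverse f2_left_inverse mult_1_right)
      (simp_all only: mult.assoc[symmetric] f2_right_inverse f2_left_inverse mult_1_left)
  show l: "bij (\<lambda>g. h * g :: f2)" for h
    by (rule o_bij[where g="\<lambda>g. f2_inv h * g"]) (simp_all add: fun_eq_iff canc)
  show r: "bij (\<lambda>g. g * h :: f2)"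
    by (rule o_bij[where g="\<lambda>g. g * f2_inv h"]) (simp_all add: fun_eq_iff canc)
  show "bij f2_inv" by (rule o_bij[where g=f2_inv]) (simp_all add: fun_eq_iff)
  show "bij (\<lambda>g. f2_inv h * g * h)" using bij_comp[OF l[of "f2_inv h"] r] by (simp add: comp_def)
qed

lemma f2_cancel [simp]:
  fixes g h :: f2
  shows "f2_inv h * (h * g) = g" "h * (f2_inv h * g) = g"
  by (simp_all only: mult.assoc[symmetric] f2_right_inverse f2_left_inverse mult_1_left)

lemma pi_symbol_symbols:
  assumes "f \<in> linf"
  shows "pi_symbol f \<in> symbols"
proof -
  have "mpt (\<lambda>z. (id (fst z), snd z - (- shift (fst z))))" by (rule mpt_skew[OF bij_id])
  from symbols_mpt[OF this symbols_base[OF assms]]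
  show ?thesis by (simp add: pi_symbol_def[abs_def])
qed

lemma linf_cnj: "f \<in> linf \<Longrightarrow> (\<lambda>x. cnj (f x)) \<in> linf"
proof -
  assume f: "f \<in> linf"
  then have [measurable]: "f \<in> borel_measurable torus_measure" by (simp add: linf_def)
  show ?thesis using f by (simp add: linf_def bounded_iff)
qed

lemma linf_translate: "f \<in> linf \<Longrightarrow> (\<lambda>x. f (x - c)) \<in> linf"
proof -
  assume f: "f \<in> linf"
  then have [measurable]: "f \<in> borel_measurable torus_measure" by (simp add: linf_def)
  show ?thesis using f by (auto simp: linf_def elim!: bounded_subset)
qed

lemma linf_uminus: "f \<in> linf \<Longrightarrow> (\<lambda>x. f (- x)) \<in> linf"
proof -
  assume f: "f \<in> linf"
  have "uminus \<in> torus_measure \<rightarrow>\<^sub>M torus_measure" using preserves_torus_uminus by (simp add: preserves_def)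
  moreover have "f \<in> borel_measurable torus_measure" using f by (simp add: linf_def)
  ultimately have "(\<lambda>x. f (- x)) \<in> borel_measurable torus_measure" by (rule measurable_compose)
  then show ?thesis using f by (auto simp: linf_def elim!: bounded_subset)
qed

lemma mpt_left: "mpt (\<lambda>z. (h * fst z, snd z))"
  using mpt_skew[of "\<lambda>g. h * g" "\<lambda>g. 0"] bij_f2(1)[of h] by simp

lemma mpt_right: "mpt (\<lambda>z. (fst z * h, snd z - shift h))"
  using mpt_skew[of "\<lambda>g. g * h" "\<lambda>g. shift h"] bij_f2(2)[of h] by simp

lemma cp_lambda_eq: "cp_lambda h = comp_op (\<lambda>z. (f2_inv h * fst z, snd z))"
  by (simp add: cp_lambda_def comp_op_def case_prod_unfold)

text \<open>Right translation has to be accompanied by a translation of the torus in order to commute with the functions, which are twisted by the group coordinate.\<close>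

definition rho :: "f2 \<Rightarrow> ltwo op" where
  "rho h = comp_op (\<lambda>z. (fst z * h, snd z - shift h))"

text \<open>The untwisted multiplication. It commutes with \<open>\<pi>(f)\<close> as a multiplication operator and
  with left translations because it ignores the group coordinate.\<close>

definition right_mult :: "(torus \<Rightarrow> complex) \<Rightarrow> ltwo op" where
  "right_mult f = mult_op (\<lambda>z. f (snd z))"

definition generators :: "ltwo op set" where
  "generators = cp_pi ` linf \<union> range cp_lambda"

lemma adj_cp_pi: "f \<in> linf \<Longrightarrow> adj (cp_pi f) = cp_pi (\<lambda>x. cnj (f x))"
  unfolding cp_pi_eq by (simp only: adj_mult_op[OF pi_symbol_symbols]) (simp add: pi_symbol_def[abs_def])

lemma adj_cp_lambda: "adj (cp_lambda h) = cp_lambda (f2_inv h)"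
  unfolding cp_lambda_eq by (rule adj_comp_op[OF mpt_left mpt_left]) simp_all

lemma cp_lambda_unitary_op: "cp_lambda h \<in> unitaries bounded_ops"
  unfolding cp_lambda_eq by (rule comp_op_unitary[OF mpt_left mpt_left[of h]]) simp_all

lemma adj_rho: "adj (rho h) = rho (f2_inv h)"
  unfolding rho_def by (rule adj_comp_op[OF mpt_right mpt_right]) (simp_all add: shift_inv mult.assoc)

lemma adj_right_mult: "f \<in> linf \<Longrightarrow> adj (right_mult f) = right_mult (\<lambda>x. cnj (f x))"
  by (simp add: right_mult_def adj_mult_op symbols_base)

lemma generators_bounded: "generators \<subseteq> bounded_ops"
  by (auto simp: generators_def cp_pi_eq cp_lambda_eq mult_op_bounded_ops pi_symbol_symbols
      comp_op_bounded_ops mpt_left)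

lemma generators_adj: "A \<in> generators \<Longrightarrow> adj A \<in> generators"
  by (auto simp: generators_def adj_cp_pi adj_cp_lambda intro: linf_cnj)

lemma crossed_product_eq: "crossed_product = commutant (commutant generators)"
  unfolding crossed_product_def generators_def[symmetric]
  by (rule vn_generated_eq_bicommutant[OF generators_bounded generators_adj])

lemma crossed_product_vna: "von_neumann_algebra crossed_product"
  unfolding crossed_product_eq
  by (rule vn_generated_eq_bicommutant[OF generators_bounded generators_adj])

interpretation M: vna crossed_product
  by (rule vna.intro[OF crossed_product_vna])

lemma commutant_crossed_product: "commutant crossed_product = commutant generators"
  unfolding crossed_product_eq by (rule commutant_triple[OF generators_bounded])

lemma generators_crossed_product: "generators \<subseteq> crossed_product"
  unfolding crossed_product_eq by (rule commutant_commutant_superset[OF generators_bounded])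

lemma cp_pi_mem: "f \<in> linf \<Longrightarrow> cp_pi f \<in> crossed_product"
  using generators_crossed_product by (auto simp: generators_def)

lemma cp_lambda_mem: "cp_lambda h \<in> crossed_product"
  using generators_crossed_product by (auto simp: generators_def)

lemma cp_lambda_unitary: "cp_lambda h \<in> unitaries crossed_product"
  using cp_lambda_unitary_op[of h] cp_lambda_mem[of h] by (simp add: unitaries_def)

lemma right_mult_commutant:
  assumes f: "f \<in> linf"
  shows "right_mult f \<in> commutant crossed_product"
proof -
  have "right_mult f o\<^sub>L A = A o\<^sub>L right_mult f" if "A \<in> generators" for A
    using that unfolding generators_def
  proof
    assume "A \<in> cp_pi ` linf"
    then show ?thesis
      by (auto simp: right_mult_def cp_pi_eq mult_op_compose symbols_base f pi_symbol_symbols mult.commute)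
  next
    assume "A \<in> range cp_lambda"
    then obtain h where A: "A = comp_op (\<lambda>z. (f2_inv h * fst z, snd z))" by (auto simp: cp_lambda_eq)
    show ?thesis
      using comp_op_mult_op[OF mpt_left symbols_base[OF f], of "f2_inv h"] by (simp add: A right_mult_def)
  qed
  moreover have "right_mult f \<in> bounded_ops"
    by (simp add: right_mult_def mult_op_bounded_ops symbols_base f)
  ultimately show ?thesis unfolding commutant_crossed_product by (simp add: commutant_def)
qed

lemma rho_commutant: "rho h \<in> commutant crossed_product"
proof -
  have "rho h o\<^sub>L A = A o\<^sub>L rho h" if "A \<in> generators" for A
    using that unfolding generators_def
  proof
    assume "A \<in> cp_pi ` linf"
    then obtain f where f: "f \<in> linf" "A = mult_op (pi_symbol f)" by (auto simp: cp_pi_eq)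
    have "(\<lambda>z. pi_symbol f (fst z * h, snd z - shift h)) = pi_symbol f"
      by (simp add: pi_symbol_def fun_eq_iff shift_mult algebra_simps)
    then show ?thesis
      using comp_op_mult_op[OF mpt_right pi_symbol_symbols[OF f(1)], of h] by (simp add: f(2) rho_def)
  next
    assume "A \<in> range cp_lambda"
    then obtain k where A: "A = comp_op (\<lambda>z. (f2_inv k * fst z, snd z))" by (auto simp: cp_lambda_eq)
    show ?thesis
      by (simp add: A rho_def comp_op_compose mpt_left mpt_right mult.assoc)
  qed
  moreover have "rho h \<in> bounded_ops"
    by (simp add: rho_def comp_op_bounded_ops mpt_right)
  ultimately show ?thesis unfolding commutant_crossed_product by (simp add: commutant_def)
qed

section \<open>The trace vector\<close>

text \<open>The vector \<open>\<Omega>\<close> whose vector state is the trace.\<close>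

definition vacuum :: ltwo where
  "vacuum = to_ltwo (slice 1 (\<lambda>x. 1))"

lemma linf_const [simp]: "(\<lambda>x. c) \<in> linf"
  by (simp add: linf_def)

lemma norm_slice:
  assumes f: "f \<in> linf"
  shows "(norm (to_ltwo (slice h f)))\<^sup>2 = (\<integral>x. (cmod (f x))\<^sup>2 \<partial>torus_measure)"
proof -
  have "complex_of_real ((norm (to_ltwo (slice h f)))\<^sup>2) = (\<integral>x. f x * cnj (f x) \<partial>torus_measure)"
    using cinner_slice[OF slice_square_integrable[OF f] f, of h h]
    by (simp add: cinner_self slice_def)
  then have "(norm (to_ltwo (slice h f)))\<^sup>2 = Re (\<integral>x. f x * cnj (f x) \<partial>torus_measure)"
    by (metis Re_complex_of_real)
  then show ?thesis by (simp add: Re_integral_self)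
qed

lemma torus_measure_UNIV: "measure torus_measure UNIV = 1"
proof -
  interpret c: finite_measure circle_measure by (rule finite_circle_measure)
  have "emeasure torus_measure (UNIV \<times> UNIV) = 1"
    unfolding torus_measure_def
    using c.emeasure_pair_measure_Times[of UNIV circle_measure UNIV] sets.top[of circle_measure]
    by (simp add: prob_space_circle_measure)
  then show ?thesis by (simp add: measure_def)
qed

lemma norm_vacuum: "norm vacuum = 1"
proof -
  have "(norm vacuum)\<^sup>2 = 1"
    by (simp add: vacuum_def norm_slice torus_measure_UNIV)
  then show ?thesis using power2_eq_iff_nonneg[of "norm vacuum" 1] by simp
qed

lemma right_mult_slice:
  "f \<in> linf \<Longrightarrow> k \<in> linf \<Longrightarrow>
    blinfun_apply (right_mult f) (to_ltwo (slice h k)) = to_ltwo (slice h (\<lambda>x. f x * k x))"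
  unfolding right_mult_def
  by (simp add: mult_op_apply symbols_base slice_square_integrable)
     (rule arg_cong[where f=to_ltwo], simp add: slice_def fun_eq_iff)

lemma f2_mult_eq_iff: "g * h = k \<longleftrightarrow> g = k * f2_inv (h :: f2)"
proof
  assume "g * h = k"
  then have "k * f2_inv h = g * (h * f2_inv h)" by (metis mult.assoc)
  then show "g = k * f2_inv h" by simp
next
  assume "g = k * f2_inv h"
  then have "g * h = k * (f2_inv h * h)" by (metis mult.assoc)
  then show "g * h = k" by simp
qed

lemma rho_slice:
  assumes "f \<in> linf"
  shows "blinfun_apply (rho h) (to_ltwo (slice k f)) = to_ltwo (slice (k * f2_inv h) (\<lambda>x. f (x - shift h)))"
  unfolding rho_def
  by (simp add: comp_op_apply mpt_right slice_square_integrable assms)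
     (rule arg_cong[where f=to_ltwo], simp add: slice_def fun_eq_iff f2_mult_eq_iff)

lemma lambda_slice:
  assumes "f \<in> linf"
  shows "blinfun_apply (cp_lambda h) (to_ltwo (slice k f)) = to_ltwo (slice (h * k) f)"
proof -
  have "f2_inv h * g = k \<longleftrightarrow> g = h * k" for g by auto
  then show ?thesis
    unfolding cp_lambda_eq
    by (simp add: comp_op_apply mpt_left slice_square_integrable assms)
       (rule arg_cong[where f=to_ltwo], simp add: slice_def fun_eq_iff)
qed

lemma pi_vacuum: "f \<in> linf \<Longrightarrow> blinfun_apply (cp_pi f) vacuum = blinfun_apply (right_mult f) vacuum"
  unfolding right_mult_def cp_pi_eq vacuum_def
  by (simp add: mult_op_apply symbols_base slice_square_integrable pi_symbol_symbols)
     (rule arg_cong[where f=to_ltwo], simp add: slice_def pi_symbol_def fun_eq_iff)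

lemma lambda_vacuum: "blinfun_apply (cp_lambda h) vacuum = blinfun_apply (rho (f2_inv h)) vacuum"
  by (simp add: vacuum_def lambda_slice rho_slice)

lemma mpt_inverse: "mpt (\<lambda>z. (f2_inv (fst z), snd z + shift (fst z)))"
  using mpt_skew[of f2_inv "\<lambda>g. - shift g"] bij_f2(3) by simp

text \<open>Both sides have the same inner product with \<open>T \<Omega>\<close> for \<open>T = f \<rho>\<^bsub>h\<^sup>-\<^sup>1\<^esub>\<close> in the commutant, because
  \<open>\<langle>x\<^sup>* \<Omega>, T \<Omega>\<rangle> = \<langle>T\<^sup>* \<Omega>, x \<Omega>\<rangle>\<close>; these vectors are total.\<close>

lemma adj_vacuum:
  assumes x: "x \<in> crossed_product" and \<xi>: "square_integrable \<xi>"
    and x\<xi>: "blinfun_apply x vacuum = to_ltwo \<xi>"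
  shows "blinfun_apply (adj x) vacuum = to_ltwo (\<lambda>z. cnj (\<xi> (f2_inv (fst z), snd z + shift (fst z))))"
    and "square_integrable (\<lambda>z. cnj (\<xi> (f2_inv (fst z), snd z + shift (fst z))))"
proof -
  define \<eta> where "\<eta> z = cnj (\<xi> (f2_inv (fst z), snd z + shift (fst z)))" for z
  have sq: "square_integrable (\<lambda>z. \<xi> (f2_inv (fst z), snd z + shift (fst z)))"
    by (rule square_integrable_mpt[OF mpt_inverse \<xi>])
  then have m [measurable]: "(\<lambda>z. \<xi> (f2_inv (fst z), snd z + shift (fst z))) \<in> borel_measurable f2_torus_measure"
    by (simp add: sq_int_def)
  have \<eta>: "square_integrable \<eta>"
    using sq unfolding \<eta>_def[abs_def] sq_int_def by simp
  have "blinfun_apply (adj x) vacuum - to_ltwo \<eta> = 0"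
  proof (rule slices_total)
    fix h :: f2 and A assume "A \<in> rectangles"
    define f :: "torus \<Rightarrow> complex" where "f = indicator A"
    have f: "f \<in> linf" unfolding f_def by (rule indicator_linf[OF rectangles_sets]) fact
    have cf: "cnj (f y) = f y" for y by (simp add: f_def indicator_def)
    \<comment> \<open>An element of the commutant that maps \<open>\<Omega>\<close> to the slice.\<close>
    define T where "T = right_mult f o\<^sub>L rho (f2_inv h)"
    have T\<Omega>: "blinfun_apply T vacuum = to_ltwo (slice h f)"
      by (simp add: T_def vacuum_def rho_slice right_mult_slice f)
    have Rb: "right_mult f \<in> bounded_ops" "rho (f2_inv h) \<in> bounded_ops"
      using right_mult_commutant[OF f] rho_commutant[of "f2_inv h"] commutant_bounded_ops by blast+
    have T\<Omega>': "blinfun_apply (adj T) vacuum = to_ltwo (slice (f2_inv h) (\<lambda>y. f (y - shift h)))"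
      by (simp add: T_def adj_compose Rb adj_rho adj_right_mult f cf vacuum_def right_mult_slice rho_slice)
    have xT: "blinfun_apply x (blinfun_apply T vacuum) = blinfun_apply T (blinfun_apply x vacuum)"
      by (simp add: T_def M.commute_apply[OF x] right_mult_commutant rho_commutant f)
    have Tb: "T \<in> bounded_ops" unfolding T_def by (rule bounded_ops_compose[OF Rb])
    have "cinner (blinfun_apply (adj x) vacuum) (to_ltwo (slice h f))
        = cinner vacuum (blinfun_apply T (blinfun_apply x vacuum))"
      by (simp add: T\<Omega>[symmetric] cinner_adj'[OF M.bounded[OF x]] xT)
    also have "\<dots> = cinner (blinfun_apply (adj T) vacuum) (to_ltwo \<xi>)"
      by (simp add: cinner_adj'[OF Tb] x\<xi>)
    also have "\<dots> = cnj (\<integral>y. \<xi> (f2_inv h, y) * cnj (f (y - shift h)) \<partial>torus_measure)"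
      unfolding T\<Omega>' by (subst cinner_commute) (simp add: cinner_slice[OF \<xi> linf_translate[OF f]])
    also have "(\<integral>y. \<xi> (f2_inv h, y) * cnj (f (y - shift h)) \<partial>torus_measure)
        = (\<integral>y. \<xi> (f2_inv h, y + shift h) * cnj (f y) \<partial>torus_measure)"
    proof -
      define k where "k y = \<xi> (f2_inv h, y) * cnj (f (y - shift h))" for y
      have [measurable]: "(\<lambda>y. \<xi> (f2_inv h, y)) \<in> borel_measurable torus_measure"
        using fibre_sq_int[OF \<xi>] by (simp add: sq_int_def)
      have [measurable]: "f \<in> borel_measurable torus_measure" using f by (simp add: linf_def)
      have k: "k \<in> borel_measurable torus_measure" unfolding k_def by measurable
      have P: "preserves torus_measure (\<lambda>y. y - (- shift h))" by (rule preserves_torus_translation)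
      have "(\<integral>y. k y \<partial>distr torus_measure torus_measure (\<lambda>y. y - (- shift h)))
          = (\<integral>y. k (y - (- shift h)) \<partial>torus_measure)"
        using P k by (intro integral_distr) (auto simp: preserves_def)
      then show ?thesis using P by (simp add: preserves_def k_def)
    qed
    also have "cnj \<dots> = cinner (to_ltwo \<eta>) (to_ltwo (slice h f))"
      by (simp add: cinner_slice[OF \<eta> f] \<eta>_def cf flip: Bochner_Integration.integral_cnj)
    finally show "cinner (blinfun_apply (adj x) vacuum - to_ltwo \<eta>) (to_ltwo (slice h (indicator A))) = 0"
      by (simp add: cinner_diff_left f_def)
  qed
  then show "blinfun_apply (adj x) vacuum = to_ltwo (\<lambda>z. cnj (\<xi> (f2_inv (fst z), snd z + shift (fst z))))"
    by (simp add: \<eta>_def[abs_def])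
  show "square_integrable (\<lambda>z. cnj (\<xi> (f2_inv (fst z), snd z + shift (fst z))))"
    using \<eta> by (simp add: \<eta>_def[abs_def])
qed

text \<open>The right side of \<open>adj_vacuum\<close> is an antiunitary image of \<open>x \<Omega>\<close>. This is the trace
  property.\<close>

lemma norm_adj_vacuum:
  assumes x: "x \<in> crossed_product"
  shows "norm (blinfun_apply (adj x) vacuum) = norm (blinfun_apply x vacuum)"
proof -
  obtain \<xi> where \<xi>: "blinfun_apply x vacuum = to_ltwo \<xi>" "square_integrable \<xi>" by (rule ltwo_cases)
  have [measurable]: "\<xi> \<in> borel_measurable f2_torus_measure" using \<xi> by (simp add: sq_int_def)
  note a = adj_vacuum[OF x \<xi>(2,1)]
  have "(norm (blinfun_apply (adj x) vacuum))\<^sup>2 = (norm (blinfun_apply x vacuum))\<^sup>2"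
    unfolding a(1) \<xi>(1) norm_to_ltwo[OF a(2)] norm_to_ltwo[OF \<xi>(2)]
    using mpt_integral(1)[OF mpt_inverse, of "\<lambda>z. (cmod (\<xi> z))\<^sup>2"] by simp
  then show ?thesis by (simp add: power2_eq_iff_nonneg)
qed

text \<open>Taking adjoints turns the unitary on the right into one on the left, where it is isometric.\<close>

lemma norm_unitary_vacuum:
  assumes y: "y \<in> crossed_product" and u: "u \<in> unitaries crossed_product"
  shows "norm (blinfun_apply y (blinfun_apply u vacuum)) = norm (blinfun_apply y vacuum)"
proof -
  have uM: "u \<in> crossed_product" using u by (rule M.unitary_mem)
  have "norm (blinfun_apply (y o\<^sub>L u) vacuum) = norm (blinfun_apply (adj (y o\<^sub>L u)) vacuum)"
    by (rule norm_adj_vacuum[symmetric]) (rule M.compose_mem[OF y uM])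
  also have "\<dots> = norm (blinfun_apply (adj y) vacuum)"
    by (simp add: adj_compose M.bounded y uM M.unitary_norm[OF M.unitary_adj[OF u]])
  also have "\<dots> = norm (blinfun_apply y vacuum)" by (rule norm_adj_vacuum[OF y])
  finally show ?thesis by simp
qed

section \<open>The spectral gap of the free group\<close>

definition starts_with :: "gen \<Rightarrow> f2 set" where
  "starts_with x = {g. word g \<noteq> [] \<and> fst (hd (word g)) = x}"

lemma foldr_lmult_letter:
  assumes "is_reduced w"
  shows "foldr lmult w [x] = (if w \<noteq> [] \<and> last w = letter_inv x then butlast w else w @ [x])"
  using assms
proof (induction w)
  case (Cons l w)
  then have w: "is_reduced w" and hd: "w \<noteq> [] \<Longrightarrow> hd w \<noteq> letter_inv l" by (auto simp: reduced_Cons)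
  have IH: "foldr lmult w [x] = (if w \<noteq> [] \<and> last w = letter_inv x then butlast w else w @ [x])"
    by (rule Cons.IH[OF w])
  have step: "foldr lmult (l # w) [x] = lmult l (if w \<noteq> [] \<and> last w = letter_inv x then butlast w else w @ [x])"
    by (simp only: foldr.simps comp_apply IH)
  show ?case
  proof (cases w)
    case Nil
    then show ?thesis by (auto simp: lmult_def letter_inv_def prod_eq_iff)
  next
    case (Cons k v)
    with hd have k: "k \<noteq> letter_inv l" by simp
    show ?thesis unfolding step using k Cons by (cases "v = []") (auto simp: lmult_def)
  qed
qed simp

text \<open>The letter added on the right cancels at most the last letter of a word of length at least
  two, so the letter added on the left stays in front.\<close>

lemma conj_letter_head:
  assumes x: "word x = [l]" and g: "word g \<noteq> []" "fst (hd (word g)) \<noteq> fst l"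
  shows "word (x * g * f2_inv x) \<noteq> []" "hd (word (x * g * f2_inv x)) = l"
proof -
  obtain k v where kv: "word g = k # v" using g(1) by (cases "word g") auto
  with g(2) have kl: "k \<noteq> letter_inv l" by (auto simp: letter_inv_def)
  have xg: "word (x * g) = l # k # v" using kl by (simp add: times_f2.rep_eq x kv lmult_def)
  have "word (x * g * f2_inv x) = foldr lmult (l # k # v) [letter_inv l]"
    unfolding times_f2.rep_eq[of "x * g"] xg by (simp add: f2_inv.rep_eq x)
  also have "\<dots> = (if last (l # k # v) = letter_inv (letter_inv l) then butlast (l # k # v)
      else (l # k # v) @ [letter_inv l])"
    using foldr_lmult_letter[of "l # k # v" "letter_inv l"] xg is_reduced_word[of "x * g"] by simp
  finally have *: "word (x * g * f2_inv x) = (if last (l # k # v) = letter_inv (letter_inv l) then butlast (l # k # v)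
      else (l # k # v) @ [letter_inv l])" .
  show "word (x * g * f2_inv x) \<noteq> []" "hd (word (x * g * f2_inv x)) = l"
    unfolding * by auto
qed

lemma word_gens:
  "word f2_a = [(gen_a, True)]" "word f2_b = [(gen_b, True)]"
  "word (f2_inv f2_b) = [(gen_b, False)]"
  by (simp_all add: f2_a.rep_eq f2_b.rep_eq f2_inv.rep_eq letter_inv_def)

lemma starts_with_cover: "g = 1 \<or> g \<in> starts_with gen_a \<or> g \<in> starts_with gen_b"
proof (cases "word g = []")
  case True
  then show ?thesis by (simp add: one_f2.rep_eq flip: word_inject)
next
  case False
  then show ?thesis by (cases "fst (hd (word g))") (auto simp: starts_with_def)
qed

definition restrict_op :: "f2 set \<Rightarrow> ltwo op" where
  "restrict_op S = mult_op (\<lambda>z. indicator S (fst z))"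

definition mass :: "f2 set \<Rightarrow> ltwo \<Rightarrow> real" where
  "mass S \<zeta> = norm (blinfun_apply (restrict_op S) \<zeta>)"

text \<open>On \<open>x \<Omega>\<close> this is conjugation: \<open>conj_op h (x \<Omega>) = \<lambda>\<^sub>h x \<lambda>\<^sub>h\<^sup>* \<Omega>\<close> for \<open>x\<close> in the crossed
  product, because \<open>\<rho>\<^sub>h\<close> commutes with \<open>x\<close> and \<open>\<rho>\<^sub>h \<Omega> = \<lambda>\<^sub>h\<^sup>* \<Omega>\<close>.\<close>

definition conj_op :: "f2 \<Rightarrow> ltwo op" where
  "conj_op h = cp_lambda h o\<^sub>L rho h"

lemma restrict_symbols: "(\<lambda>z. indicator S (fst z)) \<in> symbols"
  by (rule symbols_group) (auto simp: bounded_iff indicator_def intro!: exI[of _ 1])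

lemma mass_square:
  assumes "square_integrable \<xi>"
  shows "(mass S (to_ltwo \<xi>))\<^sup>2 = (\<integral>z. indicator S (fst z) * (cmod (\<xi> z))\<^sup>2 \<partial>f2_torus_measure)"
    and "integrable f2_torus_measure (\<lambda>z. indicator S (fst z) * (cmod (\<xi> z))\<^sup>2 :: real)"
proof -
  have eq: "(cmod (indicator S (fst z) * \<xi> z))\<^sup>2 = indicator S (fst z) * (cmod (\<xi> z))\<^sup>2" for z
    by (simp add: indicator_def)
  note a = mult_op_apply[OF restrict_symbols assms, of S]
  show "(mass S (to_ltwo \<xi>))\<^sup>2 = (\<integral>z. indicator S (fst z) * (cmod (\<xi> z))\<^sup>2 \<partial>f2_torus_measure)"
    unfolding mass_def restrict_op_def a(1) norm_to_ltwo[OF a(2)] eq ..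
  show "integrable f2_torus_measure (\<lambda>z. indicator S (fst z) * (cmod (\<xi> z))\<^sup>2 :: real)"
    using a(2) unfolding sq_int_def eq by blast
qed

lemma mass_nonneg: "mass S \<zeta> \<ge> 0"
  by (simp add: mass_def)

lemma mass_mono: "S \<subseteq> T \<Longrightarrow> mass S \<zeta> \<le> mass T \<zeta>"
proof (cases \<zeta> rule: ltwo_cases)
  case (1 \<xi>)
  assume ST: "S \<subseteq> T"
  have "(mass S \<zeta>)\<^sup>2 \<le> (mass T \<zeta>)\<^sup>2"
    unfolding 1(1) mass_square(1)[OF 1(2)]
    by (rule integral_mono) (use mass_square(2)[OF 1(2)] ST in \<open>auto simp: indicator_def\<close>)
  then show ?thesis by (rule power2_le_imp_le) (rule mass_nonneg)
qed

lemma mass_disjoint: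
  assumes "S \<inter> T = {}"
  shows "(mass (S \<union> T) \<zeta>)\<^sup>2 = (mass S \<zeta>)\<^sup>2 + (mass T \<zeta>)\<^sup>2"
proof (cases \<zeta> rule: ltwo_cases)
  case (1 \<xi>)
  have "indicator (S \<union> T) g = (indicator S g + indicator T g :: real)" for g
    using assms by (auto simp: indicator_def)
  then show ?thesis
    unfolding 1(1) mass_square(1)[OF 1(2)]
    by (simp add: distrib_right mass_square(2)[OF 1(2)])
qed

lemma mass_UNIV: "mass UNIV \<zeta> = norm \<zeta>"
  by (simp add: mass_def restrict_op_def mult_op_one)

lemma mass_le_norm: "mass S \<zeta> \<le> norm \<zeta>"
  using mass_mono[of S UNIV \<zeta>] by (simp add: mass_UNIV)

lemma mass_diff: "mass S \<zeta> \<le> mass S \<eta> + norm (\<zeta> - \<eta>)"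
proof -
  have "mass S \<zeta> \<le> mass S \<eta> + mass S (\<zeta> - \<eta>)"
    unfolding mass_def blinfun.diff_right by (rule norm_triangle_sub)
  then show ?thesis using mass_le_norm[of S "\<zeta> - \<eta>"] by linarith
qed

lemma conj_op_eq: "conj_op h = comp_op (\<lambda>z. (f2_inv h * fst z * h, snd z - shift h))"
  by (simp add: conj_op_def cp_lambda_eq rho_def comp_op_compose mpt_left mpt_right)

lemma mpt_conj: "mpt (\<lambda>z. (f2_inv h * fst z * h, snd z - shift h))"
  by (rule mpt_skew[of "\<lambda>g. f2_inv h * g * h" "\<lambda>g. shift h"]) (rule bij_f2)

lemma conj_op_mass: "mass {g. f2_inv h * g * h \<in> S} (blinfun_apply (conj_op h) \<zeta>) = mass S \<zeta>"
proof -
  have "blinfun_apply (restrict_op {g. f2_inv h * g * h \<in> S}) (blinfun_apply (conj_op h) \<zeta>)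
      = blinfun_apply (conj_op h) (blinfun_apply (restrict_op S) \<zeta>)"
    using comp_op_mult_op[OF mpt_conj[of h] restrict_symbols[of S]]
    by (simp add: conj_op_eq restrict_op_def indicator_def of_bool_def flip: blinfun_apply_blinfun_compose)
  moreover have "norm (blinfun_apply (conj_op h) \<eta>) = norm \<eta>" for \<eta>
    using cinner_comp_op[OF mpt_conj[of h], of \<eta> \<eta>]
    by (simp add: conj_op_eq norm_eq_sqrt_inner inner_cinner)
  ultimately show ?thesis by (simp add: mass_def)
qed

text \<open>Write \<open>S\<close>, \<open>T\<close> for the words starting with a power of \<open>a\<close>, \<open>b\<close>. Since
  \<open>a T a\<^sup>-\<^sup>1 \<subseteq> S\<close>, while \<open>b S b\<^sup>-\<^sup>1\<close> and \<open>b\<^sup>-\<^sup>1 S b\<close> are disjoint subsets of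
  \<open>T\<close>, an almost invariant vector has masses with \<open>T \<lesssim> S\<close> and \<open>2 S\<^sup>2 \<lesssim> T\<^sup>2\<close>,
  so both are small. This is the 14-epsilon argument of Murray and von Neumann.\<close>

lemma spectral_gap:
  assumes a: "norm (blinfun_apply (conj_op f2_a) \<zeta> - \<zeta>) \<le> \<epsilon>"
    and b: "norm (blinfun_apply (conj_op f2_b) \<zeta> - \<zeta>) \<le> \<epsilon>"
  shows "mass (- {1}) \<zeta> \<le> 14 * \<epsilon>"
proof -
  define S where "S = starts_with gen_a"
  define T where "T = starts_with gen_b"
  define s where "s = mass S \<zeta>"
  define t where "t = mass T \<zeta>"
  have e0: "\<epsilon> \<ge> 0" using a norm_ge_zero order_trans by blast
  have s0: "s \<ge> 0" "t \<ge> 0" by (simp_all add: s_def t_def mass_nonneg)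
  have sub_a: "T \<subseteq> {g. f2_a * g * f2_inv f2_a \<in> S}"
    using conj_letter_head[OF word_gens(1)] by (auto simp: S_def T_def starts_with_def)
  have undo: "h * (f2_inv h * g * h) * f2_inv h = g" for g h :: f2
    by (simp add: mult.assoc)
  have "t \<le> mass {g. f2_a * g * f2_inv f2_a \<in> S} \<zeta>" unfolding t_def by (rule mass_mono[OF sub_a])
  also have "\<dots> = mass S (blinfun_apply (conj_op f2_a) \<zeta>)"
    using conj_op_mass[of f2_a "{g. f2_a * g * f2_inv f2_a \<in> S}" \<zeta>] by (simp add: undo)
  also have "\<dots> \<le> s + \<epsilon>" using mass_diff[of S "blinfun_apply (conj_op f2_a) \<zeta>" \<zeta>] a by (simp add: s_def)
  finally have ts: "t \<le> s + \<epsilon>" .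
  define S1 where "S1 = {g. f2_inv f2_b * g * f2_b \<in> S}"
  define S2 where "S2 = {g. f2_b * g * f2_inv f2_b \<in> S}"
  have 1: "word g \<noteq> [] \<and> hd (word g) = (gen_b, True)" if "g \<in> S1" for g
    using conj_letter_head[OF word_gens(2), of "f2_inv f2_b * g * f2_b"] that
    by (auto simp: S1_def S_def starts_with_def undo)
  have 2: "word g \<noteq> [] \<and> hd (word g) = (gen_b, False)" if "g \<in> S2" for g
    using conj_letter_head[OF word_gens(3), of "f2_b * g * f2_inv f2_b"] that undo[of "f2_inv f2_b" g]
    by (auto simp: S2_def S_def starts_with_def)
  have dis: "S1 \<inter> S2 = {}" using 1 2 by fastforce
  have sub_b: "S1 \<union> S2 \<subseteq> T" using 1 2 by (fastforce simp: T_def starts_with_def)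
  have m1: "s \<le> mass S1 \<zeta> + \<epsilon>"
    using conj_op_mass[of f2_b S \<zeta>] mass_diff[of S1 "blinfun_apply (conj_op f2_b) \<zeta>" \<zeta>] b
    by (simp add: s_def S1_def)
  have m2: "s \<le> mass S2 \<zeta> + \<epsilon>"
    using conj_op_mass[of f2_b S2 \<zeta>] mass_diff[of S \<zeta> "blinfun_apply (conj_op f2_b) \<zeta>"] b
    by (simp add: s_def S2_def undo norm_minus_commute)
  \<comment> \<open>Otherwise \<open>2 (s - \<epsilon>)\<^sup>2 \<le> (s + \<epsilon>)\<^sup>2\<close>, that is \<open>s \<le> (1 + \<surd>2)\<^sup>2 \<epsilon>\<close>.\<close>
  have "s \<le> 6 * \<epsilon>"
  proof (cases "s \<le> \<epsilon>")
    case False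
    have "(s - \<epsilon>)\<^sup>2 \<le> (mass S1 \<zeta>)\<^sup>2" "(s - \<epsilon>)\<^sup>2 \<le> (mass S2 \<zeta>)\<^sup>2"
      using m1 m2 False by (auto intro!: power_mono)
    then have "2 * (s - \<epsilon>)\<^sup>2 \<le> (mass (S1 \<union> S2) \<zeta>)\<^sup>2" by (simp add: mass_disjoint[OF dis])
    also have "\<dots> \<le> t\<^sup>2" unfolding t_def by (intro power_mono mass_mono sub_b mass_nonneg)
    also have "\<dots> \<le> (s + \<epsilon>)\<^sup>2" using ts s0 by (intro power_mono) auto
    finally have "s * (s - 6 * \<epsilon>) + \<epsilon> * \<epsilon> \<le> 0"
      by (simp add: power2_eq_square algebra_simps)
    then have "s * (s - 6 * \<epsilon>) \<le> 0" using zero_le_square[of \<epsilon>] by linarith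
    then show ?thesis using False e0 by (auto simp: mult_le_0_iff)
  qed (use e0 in linarith)
  moreover have "mass (- {1}) \<zeta> \<le> s + t"
  proof -
    have "S \<inter> T = {}" by (auto simp: S_def T_def starts_with_def)
    then have "(mass (S \<union> T) \<zeta>)\<^sup>2 = s\<^sup>2 + t\<^sup>2" by (simp add: mass_disjoint s_def t_def)
    also have "\<dots> \<le> (s + t)\<^sup>2" using s0 by (simp add: power2_sum)
    finally have "mass (S \<union> T) \<zeta> \<le> s + t" by (rule power2_le_imp_le) (use s0 in simp)
    moreover have "mass (- {1}) \<zeta> \<le> mass (S \<union> T) \<zeta>"
      using starts_with_cover by (intro mass_mono) (auto simp: S_def T_def)
    ultimately show ?thesis by linarith
  qed
  ultimately show ?thesis using ts e0 by linarith
qed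

section \<open>The flows\<close>

lemma crossed_product_Ad:
  assumes V: "V \<in> unitaries bounded_ops"
    and S: "\<And>A. A \<in> generators \<Longrightarrow> Ad V A \<in> generators"
      "\<And>A. A \<in> generators \<Longrightarrow> Ad (adj V) A \<in> generators"
  shows "Ad V \<in> automorphisms crossed_product"
proof (rule Ad_automorphism[OF crossed_product_vna V])
  show "x \<in> crossed_product \<Longrightarrow> Ad V x \<in> crossed_product" for x
    unfolding crossed_product_eq by (rule Ad_bicommutant[OF V S])
  show "x \<in> crossed_product \<Longrightarrow> Ad (adj V) x \<in> crossed_product" for x
    unfolding crossed_product_eq
    by (rule Ad_bicommutant[OF unitary_opD(4)[OF V]]) (auto simp: S unitary_opD(5)[OF V])
qed

definition translation :: "torus \<Rightarrow> ltwo op" where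
  "translation c = comp_op (\<lambda>z. (fst z, snd z - c))"

lemma mpt_translation: "mpt (\<lambda>z. (fst z, snd z - c))"
  using mpt_skew[OF bij_id, of "\<lambda>g. c"] by simp

lemma translation_compose: "translation c o\<^sub>L translation d = translation (c + d)"
  by (simp add: translation_def comp_op_compose mpt_translation algebra_simps)

lemma adj_translation: "adj (translation c) = translation (- c)"
  unfolding translation_def by (rule adj_comp_op[OF mpt_translation mpt_translation]) simp_all

lemma translation_unitary: "translation c \<in> unitaries bounded_ops"
  unfolding translation_def
  by (rule comp_op_unitary[OF mpt_translation mpt_translation[of "- c"]]) simp_all

lemma norm_translation: "norm (blinfun_apply (translation c) x) = norm x"
  by (rule unitary_opD(8)[OF translation_unitary])

lemma translation_slice:
  assumes "f \<in> linf"
  shows "blinfun_apply (translation c) (to_ltwo (slice h f)) = to_ltwo (slice h (\<lambda>x. f (x - c)))"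
  unfolding translation_def
  by (simp add: comp_op_apply mpt_translation slice_square_integrable assms)
     (rule arg_cong[where f=to_ltwo], simp add: slice_def fun_eq_iff)

lemma translation_vacuum: "blinfun_apply (translation c) vacuum = vacuum"
  by (simp add: vacuum_def translation_slice)

lemma Ad_translation_pi:
  assumes f: "f \<in> linf"
  shows "Ad (translation c) (cp_pi f) = cp_pi (\<lambda>x. f (x - c))"
proof -
  have "Ad (translation c) (cp_pi f) = mult_op (\<lambda>z. pi_symbol f (fst z, snd z - c))"
    unfolding translation_def cp_pi_eq
    by (rule Ad_comp_op_mult_op[OF mpt_translation mpt_translation[of "- c"] _ _ pi_symbol_symbols[OF f]]) simp_all
  then show ?thesis by (simp add: cp_pi_eq pi_symbol_def[abs_def] algebra_simps)
qed

lemma Ad_translation_lambda: "Ad (translation c) (cp_lambda h) = cp_lambda h"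
  unfolding translation_def cp_lambda_eq
  by (subst Ad_comp_op_comp_op[OF mpt_translation mpt_translation[of "- c"] _ _ mpt_left]) simp_all

lemma translation_automorphism: "Ad (translation c) \<in> automorphisms crossed_product"
  by (rule crossed_product_Ad[OF translation_unitary])
     (auto simp: generators_def adj_translation Ad_translation_pi Ad_translation_lambda linf_translate
        intro: linf_translate[of _ "- c", simplified])

subsection \<open>Strong continuity\<close>

lemma singleton_null_circle: "{c} \<in> null_sets circle_measure"
proof -
  obtain d where c: "c = to_circle d" using ex_to_circle by blast
  have "to_circle -` {c} = (\<lambda>k. d + of_int k) ` UNIV"
    by (auto simp: c to_circle_eq_iff image_iff elim!: Ints_cases) (metis add.commute diff_add_cancel)
  then have cnt: "countable (to_circle -` {c})" by simp
  have "to_circle -` {c} \<in> sets borel"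
    by (rule sets.countable[OF _ cnt]) simp
  then have s: "{c} \<in> sets circle_measure"
    by (simp add: sets_circle_measure sets_circle_algebra)
  have "emeasure circle_measure {c} = 0"
    unfolding emeasure_circle_measure[OF s]
    by (rule emeasure_lborel_countable) (rule countable_subset[OF _ cnt], auto)
  with s show ?thesis by (simp add: null_sets_def)
qed

lemma AE_torus_coordinates: "AE x in torus_measure. fst x \<noteq> c \<and> snd x \<noteq> d"
proof -
  interpret c: finite_measure circle_measure by (rule finite_circle_measure)
  have "{c} \<times> UNIV \<in> null_sets torus_measure" "UNIV \<times> {d} \<in> null_sets torus_measure"
    using singleton_null_circle[of c] singleton_null_circle[of d] sets.top[of circle_measure]
    by (auto simp: null_sets_def torus_measure_def c.emeasure_pair_measure_Times)
  then have "AE x in torus_measure. x \<notin> {c} \<times> UNIV" "AE x in torus_measure. x \<notin> UNIV \<times> {d}"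
    by (auto intro: AE_not_in)
  then show ?thesis by eventually_elim (auto simp: mem_Times_iff)
qed

lemma eventually_init_arc_translate:
  assumes a: "a \<in> {0..1}" and X: "X \<longlonglongrightarrow> 0"
    and r: "r \<noteq> to_circle 0" "r \<noteq> to_circle a"
  shows "\<forall>\<^sub>F n in sequentially. r - to_circle (X n) \<in> init_arc a \<longleftrightarrow> r \<in> init_arc a"
proof -
  obtain y where y: "0 \<le> y" "y < 1" "r = to_circle y" using ex_to_circle by blast
  with r have "0 < y" "y \<noteq> a" by (auto simp: less_le)
  have lim: "(\<lambda>n. y - X n) \<longlonglongrightarrow> y" using tendsto_diff[OF tendsto_const X, of y] by simp
  have "\<forall>\<^sub>F n in sequentially. y - X n > 0" "\<forall>\<^sub>F n in sequentially. y - X n < 1"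
    by (rule order_tendstoD(1)[OF lim \<open>0 < y\<close>], rule order_tendstoD(2)[OF lim y(2)])
  moreover have "\<forall>\<^sub>F n in sequentially. y - X n < a \<longleftrightarrow> y < a"
  proof (cases "y < a")
    case True
    then show ?thesis using order_tendstoD(2)[OF lim True] by simp
  next
    case False
    with \<open>y \<noteq> a\<close> have "a < y" by simp
    from order_tendstoD(1)[OF lim this] show ?thesis by eventually_elim (use False in auto)
  qed
  ultimately show ?thesis
  proof eventually_elim
    case (elim n)
    then show ?case
      using init_arc_mem_iff[of "y - X n" a] init_arc_mem_iff[of y a] a y by (simp add: to_circle_diff)
  qed
qed

definition direction :: "real \<Rightarrow> real \<Rightarrow> real \<Rightarrow> torus" where
  "direction p q t = (to_circle (p * t), to_circle (q * t))"

lemma direction_add: "direction p q (s + t) = direction p q s + direction p q t"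
  by (simp add: direction_def distrib_left to_circle_add)

lemma direction_minus: "direction (- p) (- q) t = - direction p q t" "direction p q (- t) = - direction p q t"
  by (simp_all add: direction_def to_circle_uminus uminus_prod_def)

text \<open>The indicator of a rectangle is continuous off the four lines through its sides, a null
  set; dominated convergence gives the \<open>L\<^sup>2\<close> limit.\<close>

lemma translation_slice_tendsto:
  assumes A: "A \<in> rectangles" and X: "X \<longlonglongrightarrow> 0"
  shows "(\<lambda>n. blinfun_apply (translation (direction p q (X n))) (to_ltwo (slice h (indicator A))))
    \<longlonglongrightarrow> to_ltwo (slice h (indicator A))"
proof -
  define f :: "torus \<Rightarrow> complex" where "f = indicator A"
  have f: "f \<in> linf" unfolding f_def by (rule indicator_linf[OF rectangles_sets[OF A]])
  obtain a b where ab: "A = init_arc a \<times> init_arc b" "a \<in> {0..1}" "b \<in> {0..1}"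
    using A by (auto simp: rectangles_def)
  define d where "d n = direction p q (X n)" for n
  have df: "(\<lambda>x. f (x - d n) - f x) \<in> linf" for n
  proof -
    have m: "(\<lambda>x. f (x - d n)) \<in> linf" by (rule linf_translate[OF f])
    then have [measurable]: "(\<lambda>x. f (x - d n)) \<in> borel_measurable torus_measure" "f \<in> borel_measurable torus_measure"
      using f by (auto simp: linf_def)
    have "cmod (f (x - d n) - f x) \<le> 1" for x by (simp add: f_def indicator_def)
    then show ?thesis by (auto simp: linf_def bounded_iff)
  qed
  have meas: "(\<lambda>x. (cmod (f (x - d n) - f x))\<^sup>2) \<in> borel_measurable torus_measure" for n
    using df[of n] by (auto simp: linf_def)
  have "(\<lambda>n. \<integral>x. (cmod (f (x - d n) - f x))\<^sup>2 \<partial>torus_measure) \<longlonglongrightarrow> (\<integral>x. 0 \<partial>torus_measure)"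
  proof (rule integral_dominated_convergence[where w="\<lambda>x. 1"])
    show "AE x in torus_measure. (\<lambda>n. (cmod (f (x - d n) - f x))\<^sup>2) \<longlonglongrightarrow> 0"
      using AE_torus_coordinates[of "to_circle 0" "to_circle 0"]
        AE_torus_coordinates[of "to_circle a" "to_circle b"]
    proof eventually_elim
      case (elim x)
      have "(\<lambda>n. p * X n) \<longlonglongrightarrow> 0" "(\<lambda>n. q * X n) \<longlonglongrightarrow> 0"
        using tendsto_mult[OF tendsto_const X] by fastforce+
      with elim have "\<forall>\<^sub>F n in sequentially. fst x - to_circle (p * X n) \<in> init_arc a \<longleftrightarrow> fst x \<in> init_arc a"
        "\<forall>\<^sub>F n in sequentially. snd x - to_circle (q * X n) \<in> init_arc b \<longleftrightarrow> snd x \<in> init_arc b"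
        by (auto intro!: eventually_init_arc_translate ab)
      then have "\<forall>\<^sub>F n in sequentially. (cmod (f (x - d n) - f x))\<^sup>2 = 0"
        by eventually_elim
          (auto simp: f_def indicator_def ab d_def direction_def mem_Times_iff minus_prod_def)
      then show ?case by (rule tendsto_eventually)
    qed
    show "AE x in torus_measure. norm ((cmod (f (x - d n) - f x))\<^sup>2) \<le> 1" for n
      by (auto simp: f_def indicator_def)
  qed (use meas in auto)
  moreover have "(norm (blinfun_apply (translation (d n)) (to_ltwo (slice h f)) - to_ltwo (slice h f)))\<^sup>2
      = (\<integral>x. (cmod (f (x - d n) - f x))\<^sup>2 \<partial>torus_measure)" for n
  proof -
    have "blinfun_apply (translation (d n)) (to_ltwo (slice h f)) - to_ltwo (slice h f)
        = to_ltwo (slice h (\<lambda>x. f (x - d n) - f x))"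
      unfolding translation_slice[OF f]
      by (subst minus_to_ltwo) (auto simp: slice_square_integrable linf_translate f
          intro!: arg_cong[where f=to_ltwo], auto simp: slice_def)
    then show ?thesis by (simp add: norm_slice[OF df])
  qed
  ultimately have "(\<lambda>n. (norm (blinfun_apply (translation (d n)) (to_ltwo (slice h f)) - to_ltwo (slice h f)))\<^sup>2) \<longlonglongrightarrow> 0"
    by simp
  from tendsto_real_sqrt[OF this] have "(\<lambda>n. norm (blinfun_apply (translation (d n)) (to_ltwo (slice h f)) - to_ltwo (slice h f))) \<longlonglongrightarrow> 0"
    by simp
  then show ?thesis unfolding d_def f_def by (simp add: tendsto_norm_zero_iff LIM_zero_iff)
qed

text \<open>The vectors with this property form a closed subspace, as the translations are isometric, and it contains the total family of slices.\<close>

lemma translation_tendsto_id: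
  assumes X: "X \<longlonglongrightarrow> (0 :: real)"
  shows "(\<lambda>n. blinfun_apply (translation (direction p q (X n))) x) \<longlonglongrightarrow> x"
proof -
  define V where "V n = blinfun_apply (translation (direction p q (X n)))" for n
  define K where "K = {x. (\<lambda>n. V n x) \<longlonglongrightarrow> x}"
  have lin: "V n (x + y) = V n x + V n y" "V n (r *\<^sub>R x) = r *\<^sub>R V n x" "V n (c *\<^sub>C x) = c *\<^sub>C V n x"
    "V n (x - y) = V n x - V n y" "norm (V n x) = norm x" "V n 0 = 0" for n x y r c
    using bounded_opsD[OF unitary_opD(1)[OF translation_unitary]]
    by (simp_all add: V_def blinfun.add_right blinfun.scaleR_right blinfun.diff_right norm_translation)
  have "x \<in> K"
  proof (rule closed_subspace_of_slices)
    show "closed K"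
      unfolding closed_sequential_limits
    proof (intro allI impI)
      fix y l assume y: "(\<forall>k. y k \<in> K) \<and> y \<longlonglongrightarrow> l"
      have "(\<lambda>n. V n l) \<longlonglongrightarrow> l"
      proof (rule LIMSEQ_I)
        fix r :: real assume r: "r > 0"
        then obtain k where k: "norm (y k - l) < r / 3"
          using LIMSEQ_D[of y l "r / 3"] y by auto
        from y have "(\<lambda>n. V n (y k)) \<longlonglongrightarrow> y k" by (simp add: K_def)
        from LIMSEQ_D[OF this, of "r / 3"] r
        obtain N where N: "\<And>n. n \<ge> N \<Longrightarrow> norm (V n (y k) - y k) < r / 3" by auto
        have "norm (V n l - l) < r" if "n \<ge> N" for n
        proof -
          have "V n l - l = (V n (y k) - y k) + ((y k - l) - V n (y k - l))"
            by (simp add: lin)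
          also have "norm \<dots> \<le> norm (V n (y k) - y k) + (norm (y k - l) + norm (V n (y k - l)))"
            by (intro norm_triangle_le add_mono order_refl norm_triangle_ineq4)
          finally show ?thesis using N[OF that] k lin(5)[of n "y k - l"] by linarith
        qed
        then show "\<exists>no. \<forall>n\<ge>no. norm (V n l - l) < r" by blast
      qed
      then show "l \<in> K" by (simp add: K_def)
    qed
    show "subspace K"
      by (auto simp: subspace_def K_def lin intro!: tendsto_intros)
    show "x \<in> K \<Longrightarrow> c *\<^sub>C x \<in> K" for c x
      by (simp add: K_def lin bounded_linear.tendsto[OF bounded_linear_scaleC])
    show "A \<in> rectangles \<Longrightarrow> to_ltwo (slice h (indicator A)) \<in> K" for h A
      unfolding K_def V_def by (simp add: translation_slice_tendsto X)
  qed
  then show ?thesis by (simp add: K_def V_def)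
qed

lemma translation_tendsto:
  assumes "X \<longlonglongrightarrow> (s :: real)"
  shows "(\<lambda>n. blinfun_apply (translation (direction p q (X n))) x) \<longlonglongrightarrow> blinfun_apply (translation (direction p q s)) x"
proof -
  have X: "(\<lambda>n. X n - s) \<longlonglongrightarrow> 0" using assms by (simp add: LIM_zero_iff)
  have "blinfun_apply (translation (direction p q (X n))) x
      = blinfun_apply (translation (direction p q s)) (blinfun_apply (translation (direction p q (X n - s))) x)" for n
    by (simp add: translation_compose direction_add[symmetric] flip: blinfun_apply_blinfun_compose)
  then show ?thesis
    by (simp add: blinfun.bounded_linear_right[THEN bounded_linear.tendsto, OF translation_tendsto_id[OF X]])
qed

definition theta :: "real \<Rightarrow> real \<Rightarrow> real \<Rightarrow> ltwo op \<Rightarrow> ltwo op" where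
  "theta p q t = Ad (translation (direction p q t))"

lemma theta_automorphism: "theta p q t \<in> automorphisms crossed_product"
  unfolding theta_def by (rule translation_automorphism)

text \<open>Both the unitary and the vector it acts on depend on \<open>t\<close>; the isometry of the unitary
  controls the change of the vector.\<close>

lemma theta_continuous: "continuous_on UNIV (\<lambda>t. blinfun_apply (theta p q t x) \<xi>)"
  unfolding continuous_on_eq_continuous_at[OF open_UNIV] continuous_at_sequentially
proof (intro ballI allI impI)
  fix s X assume X: "X \<longlonglongrightarrow> (s :: real)"
  define V where "V t = blinfun_apply (translation (direction p q t))" for t
  have V: "(\<lambda>n. V (Y n) y) \<longlonglongrightarrow> V u y" if "Y \<longlonglongrightarrow> u" for Y u y
    unfolding V_def by (rule translation_tendsto[OF that])
  have V_diff: "V t (y - z) = V t y - V t z" "norm (V t y) = norm y" for t y z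
    by (simp_all add: V_def blinfun.diff_right norm_translation)
  define \<eta> where "\<eta> t = blinfun_apply x (V (- t) \<xi>)" for t
  have th: "blinfun_apply (theta p q t x) \<xi> = V t (\<eta> t)" for t
    by (simp add: theta_def Ad_def V_def \<eta>_def adj_translation direction_minus)
  have \<eta>: "(\<lambda>n. \<eta> (X n)) \<longlonglongrightarrow> \<eta> s"
    unfolding \<eta>_def by (intro tendsto_intros V X)
  have "(\<lambda>n. V (X n) (\<eta> (X n) - \<eta> s)) \<longlonglongrightarrow> 0"
  proof (rule Lim_null_comparison)
    show "(\<lambda>n. norm (\<eta> (X n) - \<eta> s)) \<longlonglongrightarrow> 0"
      using \<eta> by (simp add: LIM_zero_iff tendsto_norm_zero)
  qed (simp only: V_diff(2) order_refl eventually_True)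
  from tendsto_add[OF this V[OF X, of "\<eta> s"]]
  show "((\<lambda>t. blinfun_apply (theta p q t x) \<xi>) \<circ> X) \<longlonglongrightarrow> blinfun_apply (theta p q s x) \<xi>"
    by (simp add: comp_def th V_diff)
qed

lemma theta_flow_theta: "theta_flow 0 0 p q (theta p q)"
proof -
  have "theta p q (s + t) x = theta p q s (theta p q t x)" for s t x
  proof -
    have "Ad (translation (c + d)) x = Ad (translation c) (Ad (translation d) x)" for c d
    proof -
      have ap: "blinfun_apply (translation (c + d)) y
          = blinfun_apply (translation c) (blinfun_apply (translation d) y)" for c d y
        by (simp add: translation_compose flip: blinfun_apply_blinfun_compose)
      have "- (c + d) = - d + - c" by simp
      then show ?thesis
        by (intro blinfun_eqI)
          (simp only: Ad_def adj_translation blinfun_apply_blinfun_compose ap)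
    qed
    then show ?thesis by (simp add: theta_def direction_add)
  qed
  then have "flow crossed_product (theta p q)"
    by (simp add: flow_def theta_automorphism theta_continuous)
  then show ?thesis
    by (auto simp: theta_flow_def theta_def Ad_translation_pi Ad_translation_lambda direction_def
        minus_prod_def case_prod_unfold)
qed

subsection \<open>Reversing a flow\<close>

lift_definition f2_flip :: "f2 \<Rightarrow> f2" is "map letter_inv"
proof -
  fix w assume "is_reduced w"
  then show "is_reduced (map letter_inv w)"
    unfolding is_reduced_def successively_map
    by (rule successively_mono) (metis letter_inv_inv)
qed

lemma f2_flip_flip [simp]: "f2_flip (f2_flip g) = g"
  by transfer (simp add: comp_def)

lemma f2_flip_mult: "f2_flip (g * h) = f2_flip g * f2_flip h"
proof transfer
  have l: "map letter_inv (lmult l w) = lmult (letter_inv l) (map letter_inv w)" for l w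
  proof -
    have "letter_inv k = l \<longleftrightarrow> k = letter_inv l" for k by (metis letter_inv_inv)
    then show ?thesis by (cases w) (auto simp: lmult_def)
  qed
  have "map letter_inv (foldr lmult v w) = foldr lmult (map letter_inv v) (map letter_inv w)" for v w
    by (induction v) (simp_all add: l)
  then show "map letter_inv (foldr lmult g h) = foldr lmult (map letter_inv g) (map letter_inv h)" for g h .
qed

lemma f2_flip_inv: "f2_inv (f2_flip g) = f2_flip (f2_inv g)"
  by transfer (simp add: rev_map)

lemma shift_flip: "shift (f2_flip g) = - shift g"
proof -
  have "sum_list (map (letter_shift \<circ> letter_inv) w) = - sum_list (map letter_shift w)" for w
    by (induction w) (simp_all add: letter_shift_inv)
  then show ?thesis by (simp add: shift_def f2_flip.rep_eq)
qed

definition reflection :: "ltwo op" where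
  "reflection = comp_op (\<lambda>z. (f2_flip (fst z), - snd z))"

lemma mpt_reflection: "mpt (\<lambda>z. (f2_flip (fst z), - snd z))"
proof (rule preserves_skew)
  show "bij f2_flip" by (rule o_bij[where g=f2_flip]) (simp_all add: fun_eq_iff)
qed (use preserves_torus_uminus in simp)

lemma reflection_unitary: "reflection \<in> unitaries bounded_ops"
  unfolding reflection_def by (rule comp_op_unitary[OF mpt_reflection mpt_reflection]) simp_all

lemma adj_reflection: "adj reflection = reflection"
  unfolding reflection_def by (rule adj_comp_op[OF mpt_reflection mpt_reflection]) simp_all

lemma Ad_reflection_pi:
  assumes f: "f \<in> linf"
  shows "Ad reflection (cp_pi f) = cp_pi (\<lambda>x. f (- x))"
proof -
  have "Ad reflection (cp_pi f) = mult_op (\<lambda>z. pi_symbol f (f2_flip (fst z), - snd z))"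
    unfolding reflection_def cp_pi_eq
    by (rule Ad_comp_op_mult_op[OF mpt_reflection mpt_reflection _ _ pi_symbol_symbols[OF f]]) simp_all
  then show ?thesis by (simp add: cp_pi_eq pi_symbol_def[abs_def] shift_flip)
qed

lemma Ad_reflection_lambda: "Ad reflection (cp_lambda h) = cp_lambda (f2_flip h)"
  unfolding reflection_def cp_lambda_eq
  by (subst Ad_comp_op_comp_op[OF mpt_reflection mpt_reflection _ _ mpt_left])
     (simp_all add: f2_flip_mult f2_flip_inv)

lemma reflection_automorphism: "Ad reflection \<in> automorphisms crossed_product"
  by (rule crossed_product_Ad[OF reflection_unitary])
     (auto simp: generators_def adj_reflection Ad_reflection_pi Ad_reflection_lambda linf_uminus)

lemma Ad_reflection_translation:
  "Ad reflection (Ad (translation c) x) = Ad (translation (- c)) (Ad reflection x)"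
proof -
  have 1: "reflection o\<^sub>L translation c = translation (- c) o\<^sub>L reflection" for c
    unfolding reflection_def translation_def comp_op_compose[OF mpt_reflection mpt_translation]
      comp_op_compose[OF mpt_translation mpt_reflection] by simp
  have "blinfun_apply reflection (blinfun_apply (translation c) y)
      = blinfun_apply (translation (- c)) (blinfun_apply reflection y)" for c y
    using 1[of c] by (simp flip: blinfun_apply_blinfun_compose)
  then show ?thesis
    by (intro blinfun_eqI) (simp add: Ad_def adj_reflection adj_translation)
qed

lemma cocycle_conjugate_reverse: "cocycle_conjugate crossed_product (theta p q) (theta (- p) (- q))"
proof -
  let ?u = "\<lambda>t :: real. id_blinfun :: ltwo op"
  have "id_blinfun \<in> unitaries crossed_product" by (simp add: unitaries_def M.id_mem)
  then have "cocycle crossed_product (theta (- p) (- q)) ?u"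
    by (simp add: cocycle_def M.aut_id[OF theta_automorphism])
  moreover have "Ad (?u t) (theta (- p) (- q) t x)
      = Ad reflection (theta p q t (inv_into crossed_product (Ad reflection) x))"
    if "x \<in> crossed_product" for t x
    using M.aut_inv(2)[OF reflection_automorphism that]
    by (simp add: theta_def Ad_reflection_translation direction_minus) (simp add: Ad_def)
  ultimately have "conjugates crossed_product (theta p q) (theta (- p) (- q)) ?u (Ad reflection)"
    by (simp add: conjugates_def reflection_automorphism)
  then show ?thesis unfolding cocycle_conjugate_def by blast
qed

section \<open>Characters\<close>

lift_definition circle_char :: "int \<Rightarrow> circle \<Rightarrow> complex" is "\<lambda>k y. cis (2 * pi * (of_int k * y))"
proof -
  fix k x y assume "circle_rel x y"
  then obtain z where "x = y + of_int z"
    by (auto simp: circle_rel_def elim!: Ints_cases) (metis add.commute diff_add_cancel)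
  then have "2 * pi * (of_int k * x) = 2 * pi * (of_int k * y) + 2 * pi * of_int (k * z)"
    by (simp add: algebra_simps)
  moreover have "cis (2 * pi * of_int (k * z)) = 1" by (rule cis_multiple_2pi) simp
  ultimately show "cis (2 * pi * (of_int k * x)) = cis (2 * pi * (of_int k * y))"
    by (simp add: cis_mult[symmetric])
qed

lemma circle_char_add: "circle_char k (x + y) = circle_char k x * circle_char k y"
  by transfer (simp add: cis_mult distrib_left)

lemma circle_char_minus: "circle_char (- k) x = cnj (circle_char k x)"
  by transfer (simp add: cis_cnj)

lemma cmod_circle_char: "cmod (circle_char k x) = 1"
  by transfer simp

lemma circle_char_to_circle: "circle_char k (to_circle y) = cis (2 * pi * (of_int k * y))"
  by (rule circle_char.abs_eq)

lemma measurable_circle_char [measurable]: "circle_char k \<in> borel_measurable circle_measure"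
proof (rule measurableI)
  fix B :: "complex set" assume B: "B \<in> sets borel"
  have "(\<lambda>y. cis (2 * pi * (of_int k * y))) \<in> borel_measurable borel"
    by (intro borel_measurable_continuous_onI continuous_intros)
  from measurable_sets[OF this B]
  have "(\<lambda>y. cis (2 * pi * (of_int k * y))) -` B \<in> sets borel" by simp
  moreover have "to_circle -` (circle_char k -` B) = (\<lambda>y. cis (2 * pi * (of_int k * y))) -` B"
    by (auto simp: circle_char_to_circle)
  ultimately show "circle_char k -` B \<inter> space circle_measure \<in> sets circle_measure"
    by (simp add: sets_circle_measure sets_circle_algebra)
qed simp

definition torus_char :: "int \<times> int \<Rightarrow> torus \<Rightarrow> complex" where
  "torus_char a x = circle_char (fst a) (fst x) * circle_char (snd a) (snd x)"

lemma torus_char_add: "torus_char a (x + y) = torus_char a x * torus_char a y"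
  by (simp add: torus_char_def circle_char_add mult_ac)

lemma torus_char_neg: "torus_char (- a) x = cnj (torus_char a x)"
  by (simp add: torus_char_def circle_char_minus)

lemma cmod_torus_char [simp]: "cmod (torus_char a x) = 1"
  by (simp add: torus_char_def norm_mult cmod_circle_char)

lemma torus_char_cnj: "torus_char a x * cnj (torus_char a x) = 1" "cnj (torus_char a x) * torus_char a x = 1"
  using complex_norm_square[of "torus_char a x"] by (simp_all add: mult.commute)

lemma torus_char_zero [simp]: "torus_char a 0 = 1"
proof -
  have "torus_char a 0 * torus_char a 0 = torus_char a 0 * 1"
    using torus_char_add[of a 0 0] by simp
  moreover have "torus_char a 0 \<noteq> 0" by (metis cmod_torus_char norm_zero zero_neq_one)
  ultimately show ?thesis by (simp only: mult_cancel_left) simp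
qed

lemma torus_char_uminus: "torus_char a (- x) = cnj (torus_char a x)"
proof -
  have "torus_char a (- x) = torus_char a (- x) * (torus_char a x * cnj (torus_char a x))"
    by (simp add: torus_char_cnj)
  also have "\<dots> = torus_char a (- x + x) * cnj (torus_char a x)"
    by (simp only: torus_char_add mult.assoc)
  finally show ?thesis by simp
qed

lemma torus_char_linf: "torus_char a \<in> linf"
proof -
  have "torus_char a \<in> borel_measurable torus_measure"
    unfolding torus_char_def[abs_def] torus_measure_def by measurable
  then show ?thesis by (auto simp: linf_def bounded_iff intro!: exI[of _ 1])
qed

lemma torus_char_real:
  "torus_char a (to_circle x, to_circle y) = cis (2 * pi * (of_int (fst a) * x + of_int (snd a) * y))"
  by (simp add: torus_char_def circle_char_to_circle cis_mult distrib_left)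

section \<open>Almost invariant characters\<close>

text \<open>Compare the parity of the multiplicity of \<open>p\<close> on both sides.\<close>

lemma nonsquare_int:
  fixes x y d :: int
  assumes eq: "x\<^sup>2 = d * y\<^sup>2" and p: "prime p" "odd (multiplicity p d)"
  shows "y = 0"
proof (rule ccontr)
  assume y: "y \<noteq> 0"
  have d: "d \<noteq> 0" using p by (auto simp: multiplicity_zero)
  with y eq have x: "x \<noteq> 0" by auto
  have pe: "prime_elem p" by (rule prime_imp_prime_elem[OF p(1)])
  have "multiplicity p (x\<^sup>2) = 2 * multiplicity p x"
    by (rule prime_elem_multiplicity_power_distrib[OF pe x])
  moreover have "multiplicity p (d * y\<^sup>2) = multiplicity p d + 2 * multiplicity p y"
    using prime_elem_multiplicity_mult_distrib[OF pe d, of "y\<^sup>2"] prime_elem_multiplicity_power_distrib[OF pe y, of 2] y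
    by simp
  ultimately have "2 * multiplicity p x = multiplicity p d + 2 * multiplicity p y" by (simp add: eq)
  then have "even (multiplicity p d)" by presburger
  with p show False by simp
qed

lemma nonsquares:
  fixes x y :: int
  shows "x\<^sup>2 = 2 * y\<^sup>2 \<Longrightarrow> y = 0" "x\<^sup>2 = 3 * y\<^sup>2 \<Longrightarrow> y = 0" "x\<^sup>2 = 6 * y\<^sup>2 \<Longrightarrow> y = 0"
proof -
  have m2: "multiplicity 2 (2::int) = 1" by (rule multiplicity_self) auto
  have m3: "multiplicity 3 (3::int) = 1" by (rule multiplicity_self) auto
  have m6: "multiplicity 2 (6::int) = 1"
    by (rule multiplicity_eqI) (auto simp: power2_eq_square)
  show "x\<^sup>2 = 2 * y\<^sup>2 \<Longrightarrow> y = 0" by (erule nonsquare_int[where p=2]) (simp_all add: m2)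
  show "x\<^sup>2 = 3 * y\<^sup>2 \<Longrightarrow> y = 0" by (erule nonsquare_int[where p=3]) (simp_all add: m3)
  show "x\<^sup>2 = 6 * y\<^sup>2 \<Longrightarrow> y = 0" by (erule nonsquare_int[where p=2]) (simp_all add: m6)
qed

text \<open>Isolating the term with \<open>\<surd>2\<close> and squaring gives an integer equation whose only irrational
  term is \<open>4 a c \<surd>3\<close>; as \<open>\<surd>3\<close> is irrational, \<open>a c = 0\<close>, and both cases reduce to the irrationality
  of \<open>\<surd>2\<close> or \<open>\<surd>6\<close>.\<close>

lemma sqrt_independent:
  fixes a b c :: int
  assumes "of_int a * sqrt 3 + of_int b * (1 / sqrt 2) + of_int c = 0"
  shows "a = 0 \<and> b = 0 \<and> c = 0"
proof -
  have b: "of_int b * (1 / sqrt 2) = - (of_int a * sqrt 3 + of_int c)" using assms by simp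
  have "(of_int b * (1 / sqrt 2))\<^sup>2 = (of_int a * sqrt 3 + of_int c)\<^sup>2"
    by (simp only: b power2_minus)
  then have sq: "(of_int b)\<^sup>2 = 6 * (of_int a)\<^sup>2 + 2 * (of_int c)\<^sup>2 + 4 * of_int a * of_int c * sqrt 3"
    by (simp add: power2_sum power_mult_distrib power_divide field_simps)
  then have "(of_int (b\<^sup>2 - 6 * a\<^sup>2 - 2 * c\<^sup>2) :: real)\<^sup>2 = (of_int (4 * a * c) * sqrt 3)\<^sup>2"
    by simp
  also have "\<dots> = of_int (3 * (4 * a * c)\<^sup>2)" by (simp add: power_mult_distrib)
  finally have "(b\<^sup>2 - 6 * a\<^sup>2 - 2 * c\<^sup>2)\<^sup>2 = 3 * (4 * a * c)\<^sup>2"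
    by (simp only: of_int_power[symmetric] of_int_eq_iff)
  from nonsquares(2)[OF this] have "a = 0 \<or> c = 0" by simp
  then show ?thesis
  proof
    assume a: "a = 0"
    with sq have "(of_int (b\<^sup>2) :: real) = of_int (2 * c\<^sup>2)" by simp
    then have "b\<^sup>2 = 2 * c\<^sup>2" by (simp only: of_int_eq_iff)
    with nonsquares(1)[OF this] a show ?thesis by simp
  next
    assume c: "c = 0"
    with sq have "(of_int (b\<^sup>2) :: real) = of_int (6 * a\<^sup>2)" by simp
    then have "b\<^sup>2 = 6 * a\<^sup>2" by (simp only: of_int_eq_iff)
    with nonsquares(3)[OF this] c show ?thesis by simp
  qed
qed

lemma Kronecker_sqrt:
  fixes \<alpha> \<beta> \<epsilon> :: real
  assumes "\<epsilon> > 0"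
  shows "\<exists>k i j :: int. \<bar>of_int k * sqrt 3 - of_int i - \<alpha>\<bar> < \<epsilon> \<and> \<bar>of_int k * (1 / sqrt 2) - of_int j - \<beta>\<bar> < \<epsilon>"
proof -
  interpret module "\<lambda>r x. real_of_int r * x"
    by (simp add: module.intro distrib_left mult.commute)
  define \<theta> :: "nat \<Rightarrow> real" where "\<theta> n = (if n = 0 then sqrt 3 else if n = 1 then 1 / sqrt 2 else 1)" for n
  define \<gamma> :: "nat \<Rightarrow> real" where "\<gamma> n = (if n = 0 then \<alpha> else \<beta>)" for n
  have dist: "sqrt 3 \<noteq> 1 / sqrt 2" "sqrt 3 \<noteq> 1" "1 / sqrt 2 \<noteq> (1::real)"
    using sqrt_independent[of 1 "-1" 0] by (auto simp: divide_eq_eq)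
  have set: "\<theta> ` {..2} = {sqrt 3, 1 / sqrt 2, 1}"
    by (auto simp: \<theta>_def image_iff intro: bexI[of _ 0] bexI[of _ 1] bexI[of _ 2])
  have inj: "inj_on \<theta> {..2}"
    using dist by (auto simp: inj_on_def \<theta>_def)
  have "independent (\<theta> ` {..2})"
    unfolding independent_explicit_module set
  proof (intro allI impI)
    fix t and u :: "real \<Rightarrow> int" and v
    assume t: "finite t" "t \<subseteq> {sqrt 3, 1 / sqrt 2, 1}" "(\<Sum>v\<in>t. of_int (u v) * v) = 0" "v \<in> t"
    define w where "w x = (if x \<in> t then u x else 0)" for x
    have "(\<Sum>v\<in>t. of_int (u v) * v) = (\<Sum>v\<in>{sqrt 3, 1 / sqrt 2, 1}. of_int (w v) * v)"
      using t by (intro sum.mono_neutral_cong_left) (auto simp: w_def)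
    also have "\<dots> = of_int (w (sqrt 3)) * sqrt 3 + of_int (w (1 / sqrt 2)) * (1 / sqrt 2) + of_int (w 1)"
      using dist by simp
    finally have "w (sqrt 3) = 0 \<and> w (1 / sqrt 2) = 0 \<and> w 1 = 0"
      using t(3) by (intro sqrt_independent) simp
    then show "u v = 0" using t(2,4) by (auto simp: w_def split: if_splits)
  qed
  then obtain k h where "\<And>i. i < 2 \<Longrightarrow> \<bar>of_int k * \<theta> i - of_int (h i) - \<gamma> i\<bar> < \<epsilon>"
    using Kronecker_thm_2[of \<theta> 2 \<epsilon> \<gamma>] inj assms by (auto simp: \<theta>_def)
  from this[of 0] this[of 1] show ?thesis
    by (intro exI[of _ k] exI[of _ "h 0"] exI[of _ "h 1"]) (simp add: \<theta>_def \<gamma>_def)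
qed

definition frequency :: "real \<Rightarrow> real \<Rightarrow> int \<times> int \<Rightarrow> real" where
  "frequency p q a = 2 * pi * (of_int (fst a) * p + of_int (snd a) * q)"

lemma torus_char_direction: "torus_char a (direction p q t) = cis (frequency p q a * t)"
  by (simp add: direction_def torus_char_real frequency_def algebra_simps)

definition almost_invariant :: "(nat \<Rightarrow> int \<times> int) \<Rightarrow> bool" where
  "almost_invariant c \<longleftrightarrow> (\<lambda>k. torus_char (c k) rotation) \<longlonglongrightarrow> 1"

lemma almost_invariant_uminus: "almost_invariant c \<Longrightarrow> almost_invariant (\<lambda>k. - c k)"
  unfolding almost_invariant_def using tendsto_cnj[of "\<lambda>k. torus_char (c k) rotation" 1 sequentially]
  by (simp add: torus_char_neg)

text \<open>With \<open>s = r / 2\<pi>\<close>, integers \<open>m\<close> and \<open>n\<close> are wanted with \<open>m \<surd>3 + n\<close> close to \<open>s\<close> and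
  \<open>m / \<surd>2 + n / \<surd>3\<close> close to an integer. Substituting \<open>n = s - m \<surd>3\<close> in the second condition turns
  it into \<open>m / \<surd>2\<close> being close to \<open>- s / \<surd>3\<close> modulo 1, since \<open>m \<surd>3 / \<surd>3 = m\<close> is an integer. This
  is where the choice of \<open>(p, q)\<close> pays off: both conditions are then covered by Kronecker's
  theorem for \<open>\<surd>3\<close>, \<open>1 / \<surd>2\<close>, 1.\<close>

lemma ex_almost_invariant:
  "\<exists>c. almost_invariant c \<and> (\<lambda>k. frequency (sqrt 3) 1 (c k)) \<longlonglongrightarrow> r"
proof -
  define s where "s = r / (2 * pi)"
  define E where "E n = 1 / real (Suc n)" for n
  have E: "E \<longlonglongrightarrow> 0" unfolding E_def by (rule LIMSEQ_Suc[OF lim_1_over_n])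
  have "\<exists>a. \<exists>j :: int. \<bar>of_int (fst a) * sqrt 3 + of_int (snd a) - s\<bar> \<le> E n
      \<and> \<bar>of_int (fst a) * (1 / sqrt 2) + of_int (snd a) * (1 / sqrt 3) - of_int j\<bar> \<le> 2 * E n"
    for n
  proof -
    have "E n > 0" by (simp add: E_def)
    from Kronecker_sqrt[OF this, of s "- s / sqrt 3"] obtain k i j :: int
      where i: "\<bar>of_int k * sqrt 3 - of_int i - s\<bar> < E n"
        and j: "\<bar>of_int k * (1 / sqrt 2) - of_int j - (- s / sqrt 3)\<bar> < E n" by blast
    define \<delta> where "\<delta> = of_int k * sqrt 3 - of_int i - s"
    have "\<bar>\<delta> / sqrt 3\<bar> \<le> \<bar>\<delta>\<bar>" by (simp add: divide_le_eq mult_le_cancel_left1)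
    then have d: "\<bar>\<delta> / sqrt 3\<bar> < E n" using i by (simp add: \<delta>_def)
    have "\<delta> / sqrt 3 = of_int k - of_int i * (1 / sqrt 3) - s / sqrt 3"
      by (simp add: \<delta>_def diff_divide_distrib)
    then have "of_int k * (1 / sqrt 2) + of_int (- i) * (1 / sqrt 3) - of_int (j - k)
        = (of_int k * (1 / sqrt 2) - of_int j - (- s / sqrt 3)) + \<delta> / sqrt 3" by simp
    then have "\<bar>of_int k * (1 / sqrt 2) + of_int (- i) * (1 / sqrt 3) - of_int (j - k)\<bar> \<le> 2 * E n"
      using j d by linarith
    then show ?thesis using i by (intro exI[of _ "(k, - i)"] exI[of _ "j - k"]) simp
  qed
  then obtain c j where c: "\<And>n. \<bar>of_int (fst (c n)) * sqrt 3 + of_int (snd (c n)) - s\<bar> \<le> E n"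
    and j: "\<And>n. \<bar>of_int (fst (c n)) * (1 / sqrt 2) + of_int (snd (c n)) * (1 / sqrt 3) - of_int (j n :: int)\<bar> \<le> 2 * E n"
    by metis
  have "(\<lambda>n. of_int (fst (c n)) * sqrt 3 + of_int (snd (c n)) - s) \<longlonglongrightarrow> 0"
    by (rule Lim_null_comparison[OF _ E]) (simp add: c)
  from tendsto_mult[OF tendsto_const this, of "2 * pi"]
  have "(\<lambda>n. frequency (sqrt 3) 1 (c n) - r) \<longlonglongrightarrow> 0"
    by (simp add: frequency_def s_def algebra_simps)
  then have 1: "(\<lambda>n. frequency (sqrt 3) 1 (c n)) \<longlonglongrightarrow> r" by (simp add: LIM_zero_iff)
  define y where "y n = of_int (fst (c n)) * (1 / sqrt 2) + of_int (snd (c n)) * (1 / sqrt 3) - of_int (j n)" for n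
  have "(\<lambda>n. 2 * E n) \<longlonglongrightarrow> 0" using tendsto_mult[OF tendsto_const E, of 2] by simp
  then have "y \<longlonglongrightarrow> 0" 
    by (rule Lim_null_comparison[rotated])
      (intro always_eventually allI, simp only: real_norm_def y_def j)
  then have "(\<lambda>n. cis (2 * pi * y n)) \<longlonglongrightarrow> cis (2 * pi * 0)" by (intro tendsto_intros)
  moreover have "cis (2 * pi * y n) = torus_char (c n) rotation" for n
  proof -
    have "2 * pi * (of_int (fst (c n)) * (1 / sqrt 2) + of_int (snd (c n)) * (1 / sqrt 3))
        = 2 * pi * y n + 2 * pi * of_int (j n)" by (simp add: y_def algebra_simps)
    moreover have "cis (2 * pi * of_int (j n)) = 1" by (rule cis_multiple_2pi) simp
    ultimately show ?thesis
      unfolding rotation_def torus_char_real by (simp add: cis_mult[symmetric])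
  qed
  ultimately have "almost_invariant c" by (simp add: almost_invariant_def)
  with 1 show ?thesis by blast
qed

lemma almost_invariant_shift:
  assumes "almost_invariant c"
  shows "(\<lambda>k. torus_char (c k) (shift g)) \<longlonglongrightarrow> 1"
proof -
  have l: "(\<lambda>k. torus_char (c k) (letter_shift l)) \<longlonglongrightarrow> 1" for l
  proof (cases "snd l")
    case True
    then show ?thesis using assms by (simp add: letter_shift_def almost_invariant_def)
  next
    case False
    then show ?thesis
      using almost_invariant_uminus[OF assms]
      by (simp add: letter_shift_def almost_invariant_def torus_char_neg torus_char_uminus)
  qed
  have "(\<lambda>k. torus_char (c k) (sum_list (map letter_shift w))) \<longlonglongrightarrow> 1" for w
  proof (induction w)
    case (Cons x w)
    from tendsto_mult[OF l[of x] this] show ?case by (simp add: torus_char_add)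
  qed simp
  then show ?thesis by (simp add: shift_def)
qed

section \<open>The Rohlin property\<close>

definition char_op :: "int \<times> int \<Rightarrow> ltwo op" where
  "char_op a = cp_pi (torus_char a)"

definition base_op :: "int \<times> int \<Rightarrow> ltwo op" where
  "base_op a = right_mult (torus_char a)"

definition phase_op :: "int \<times> int \<Rightarrow> ltwo op" where
  "phase_op a = mult_op (\<lambda>z. torus_char a (shift (fst z)))"

lemma char_op_mem: "char_op a \<in> crossed_product"
  unfolding char_op_def by (rule cp_pi_mem[OF torus_char_linf])

lemma adj_char_op: "adj (char_op a) = char_op (- a)"
  by (simp add: char_op_def adj_cp_pi torus_char_linf torus_char_neg[abs_def])

lemma char_op_unitary_op: "char_op a \<in> unitaries bounded_ops"
  unfolding char_op_def cp_pi_eq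
  by (rule mult_op_unitary[OF pi_symbol_symbols[OF torus_char_linf]]) (simp add: pi_symbol_def)

lemma char_op_unitary: "char_op a \<in> unitaries crossed_product"
  using char_op_unitary_op[of a] char_op_mem[of a] by (simp add: unitaries_def)

lemma char_op_inverse: "char_op (- a) o\<^sub>L char_op a = id_blinfun"
  using unitary_opD(2)[OF char_op_unitary_op[of a]] by (simp add: adj_char_op)

lemma base_op_commutant: "base_op a \<in> commutant crossed_product"
  unfolding base_op_def by (rule right_mult_commutant[OF torus_char_linf])

lemma norm_base_op: "norm (blinfun_apply (base_op a) \<xi>) = norm \<xi>"
proof -
  have "base_op a \<in> unitaries bounded_ops"
    unfolding base_op_def right_mult_def
    by (rule mult_op_unitary[OF symbols_base[OF torus_char_linf]]) simp
  then show ?thesis by (rule unitary_opD(8))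
qed

lemma phase_symbols: "(\<lambda>z. torus_char a (shift (fst z))) \<in> symbols"
  by (rule symbols_group) (auto simp: bounded_iff intro!: exI[of _ 1])

lemma phase_op_unitary: "phase_op a \<in> unitaries bounded_ops"
  unfolding phase_op_def by (rule mult_op_unitary[OF phase_symbols]) simp

lemma adj_phase_op: "adj (phase_op a) = phase_op (- a)"
  by (simp add: phase_op_def adj_mult_op phase_symbols torus_char_neg)

text \<open>A character is multiplicative, so \<open>\<chi>(x + shift g)\<close> splits into a factor that ignores \<open>g\<close>
  and one that ignores \<open>x\<close>.\<close>

lemma char_op_factor:
  "char_op a = base_op a o\<^sub>L phase_op a" "char_op a = phase_op a o\<^sub>L base_op a"
  unfolding char_op_def base_op_def phase_op_def right_mult_def cp_pi_eq
    mult_op_compose[OF symbols_base[OF torus_char_linf] phase_symbols]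
    mult_op_compose[OF phase_symbols symbols_base[OF torus_char_linf]]
  by (simp_all add: pi_symbol_def[abs_def] torus_char_add mult.commute)

text \<open>The phases tend to 1 for each group element, by almost invariance; dominated convergence.\<close>

lemma phase_op_tendsto:
  assumes c: "almost_invariant c"
  shows "(\<lambda>k. blinfun_apply (phase_op (c k)) x) \<longlonglongrightarrow> x"
proof -
  obtain \<xi> where x: "x = to_ltwo \<xi>" and \<xi>: "square_integrable \<xi>" by (rule ltwo_cases)
  define F where "F k z = torus_char (c k) (shift (fst z)) - 1" for k and z :: "f2 \<times> torus"
  have F: "F k \<in> symbols" for k
  proof -
    have "bounded (range (\<lambda>g. torus_char (c k) (shift g) - 1))"
    proof -
      have "cmod (torus_char (c k) y - 1) \<le> 2" for y
        using norm_triangle_ineq4[of "torus_char (c k) y" 1] by simp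
      then show ?thesis unfolding bounded_iff by blast
    qed
    then show ?thesis unfolding F_def[abs_def] by (rule symbols_group)
  qed
  have F2: "cmod (F k z) \<le> 2" for k z
    using norm_triangle_ineq4[of "torus_char (c k) (shift (fst z))" 1] by (simp add: F_def)
  have ap: "blinfun_apply (phase_op (c k)) x - x = blinfun_apply (mult_op (F k)) x" for k
    using mult_op_apply[OF phase_symbols[of "c k"] \<xi>] mult_op_apply(1)[OF F \<xi>, of k] \<xi>
    by (simp add: x phase_op_def minus_to_ltwo F_def left_diff_distrib)
  have sqF: "sq_int f2_torus_measure (\<lambda>z. F k z * \<xi> z)" for k by (rule mult_op_apply(2)[OF F \<xi>])
  have lim: "(\<lambda>k. \<integral>z. (cmod (F k z * \<xi> z))\<^sup>2 \<partial>f2_torus_measure) \<longlonglongrightarrow> (\<integral>z. 0 \<partial>f2_torus_measure)"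
  proof (rule integral_dominated_convergence[where w="\<lambda>z. 4 * (cmod (\<xi> z))\<^sup>2"])
    show "integrable f2_torus_measure (\<lambda>z. 4 * (cmod (\<xi> z))\<^sup>2)" using \<xi> by (simp add: sq_int_def)
    show "(\<lambda>z. (cmod (F k z * \<xi> z))\<^sup>2) \<in> borel_measurable f2_torus_measure" for k
      using sqF[of k] by (auto simp: sq_int_def)
    have "(\<lambda>k. (cmod (F k z * \<xi> z))\<^sup>2) \<longlonglongrightarrow> (cmod ((1 - 1) * \<xi> z))\<^sup>2" for z
      unfolding F_def by (intro tendsto_intros almost_invariant_shift[OF c])
    then show "AE z in f2_torus_measure. (\<lambda>k. (cmod (F k z * \<xi> z))\<^sup>2) \<longlonglongrightarrow> 0" by simp
    have "(cmod (F k z * \<xi> z))\<^sup>2 \<le> 4 * (cmod (\<xi> z))\<^sup>2" for k z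
      using mult_right_mono[OF power_mono[OF F2[of k z], of 2], of "(cmod (\<xi> z))\<^sup>2"]
      by (simp add: norm_mult power_mult_distrib)
    then show "AE z in f2_torus_measure. norm ((cmod (F k z * \<xi> z))\<^sup>2) \<le> 4 * (cmod (\<xi> z))\<^sup>2" for k
      by simp
  qed simp
  have "(\<lambda>k. (norm (blinfun_apply (phase_op (c k)) x - x))\<^sup>2) \<longlonglongrightarrow> 0"
  proof -
    have "(norm (blinfun_apply (phase_op (c k)) x - x))\<^sup>2 = (\<integral>z. (cmod (F k z * \<xi> z))\<^sup>2 \<partial>f2_torus_measure)" for k
      unfolding ap unfolding x by (rule norm_mult_op_square[OF F \<xi>])
    then show ?thesis using lim by simp
  qed
  from tendsto_real_sqrt[OF this] show ?thesis
    by (simp add: tendsto_norm_zero_iff LIM_zero_iff)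
qed

text \<open>The functional norm is a supremum of real numbers, which bounds the values only when they
  are known to be bounded; \<open>B\<close> supplies this.\<close>

lemma functional_norm_bounds:
  assumes "\<And>x. x \<in> crossed_product \<Longrightarrow> norm x \<le> 1 \<Longrightarrow> cmod (\<psi> x) \<le> B"
  shows "functional_norm crossed_product \<psi> \<le> B" "0 \<le> functional_norm crossed_product \<psi>"
    and "x \<in> crossed_product \<Longrightarrow> norm x \<le> 1 \<Longrightarrow> cmod (\<psi> x) \<le> functional_norm crossed_product \<psi>"
proof -
  have z: "0 \<in> {x \<in> crossed_product. norm x \<le> 1}" by (simp add: M.zero_mem)
  have bdd: "bdd_above ((\<lambda>x. cmod (\<psi> x)) ` {x \<in> crossed_product. norm x \<le> 1})"
    using assms by (intro bdd_aboveI2) auto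
  show "functional_norm crossed_product \<psi> \<le> B"
    unfolding functional_norm_def by (rule cSUP_least) (use z assms in auto)
  show le: "cmod (\<psi> x) \<le> functional_norm crossed_product \<psi>"
    if "x \<in> crossed_product" "norm x \<le> 1" for x
    unfolding functional_norm_def by (rule cSUP_upper[OF _ bdd]) (use that in auto)
  show "0 \<le> functional_norm crossed_product \<psi>"
    using le[of 0] z order_trans[OF norm_ge_zero] by auto
qed

lemma predual_cases:
  assumes "\<phi> \<in> predual crossed_product"
  obtains \<xi> \<eta> :: "nat \<Rightarrow> ltwo" where
    "summable (\<lambda>j. norm (\<xi> j) * norm (\<eta> j))"
    "\<And>x. x \<in> crossed_product \<Longrightarrow> \<phi> x = (\<Sum>j. cinner (blinfun_apply x (\<xi> j)) (\<eta> j))"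
    "\<And>x. summable (\<lambda>j. cinner (blinfun_apply x (\<xi> j)) (\<eta> j))"
proof -
  obtain \<xi> \<eta> :: "nat \<Rightarrow> ltwo" where s: "summable (\<lambda>k. (norm (\<xi> k))\<^sup>2)" "summable (\<lambda>k. (norm (\<eta> k))\<^sup>2)"
    and \<phi>: "\<And>x. x \<in> crossed_product \<Longrightarrow> \<phi> x = (\<Sum>k. cinner (blinfun_apply x (\<xi> k)) (\<eta> k))"
    using assms unfolding predual_def by blast
  have sm: "summable (\<lambda>j. norm (\<xi> j) * norm (\<eta> j))"
  proof (rule summable_comparison_test')
    show "summable (\<lambda>k. (norm (\<xi> k))\<^sup>2 + (norm (\<eta> k))\<^sup>2)" by (rule summable_add[OF s])
    show "norm (norm (\<xi> k) * norm (\<eta> k)) \<le> (norm (\<xi> k))\<^sup>2 + (norm (\<eta> k))\<^sup>2" for k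
      using sum_squares_bound[of "norm (\<xi> k)" "norm (\<eta> k)"]
        mult_nonneg_nonneg[OF norm_ge_zero[of "\<xi> k"] norm_ge_zero[of "\<eta> k"]]
      unfolding real_norm_def by linarith
  qed
  have "summable (\<lambda>j. cinner (blinfun_apply x (\<xi> j)) (\<eta> j))" for x
  proof (rule summable_comparison_test'[OF summable_mult[OF sm, of "norm x"]])
    show "cmod (cinner (blinfun_apply x (\<xi> j)) (\<eta> j)) \<le> norm x * (norm (\<xi> j) * norm (\<eta> j))" for j
      using cmod_cinner_le[of "blinfun_apply x (\<xi> j)" "\<eta> j"]
        mult_right_mono[OF norm_blinfun[of x "\<xi> j"] norm_ge_zero[of "\<eta> j"]]
      by (simp add: mult.assoc)
  qed
  with sm \<phi> show ?thesis by (rule that)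
qed

text \<open>With \<open>x\<^sub>k = R\<^sub>k P\<^sub>k\<close>, where \<open>R\<^sub>k\<close> commutes with the algebra and the phases \<open>P\<^sub>k\<close> tend to
  \<open>1\<close> strongly, the commutator of \<open>x\<^sub>k\<close> with a vector functional only sees \<open>P\<^sub>k - 1\<close> on the two
  vectors.\<close>

lemma char_op_central:
  assumes c: "almost_invariant c" and \<phi>: "\<phi> \<in> predual crossed_product"
  shows "(\<lambda>k. functional_norm crossed_product
    (\<lambda>y. \<phi> (char_op (c k) o\<^sub>L y) - \<phi> (y o\<^sub>L char_op (c k)))) \<longlonglongrightarrow> 0"
proof -
  obtain \<xi> \<eta> :: "nat \<Rightarrow> ltwo" where s: "summable (\<lambda>j. norm (\<xi> j) * norm (\<eta> j))"
    and \<phi>: "\<And>x. x \<in> crossed_product \<Longrightarrow> \<phi> x = (\<Sum>j. cinner (blinfun_apply x (\<xi> j)) (\<eta> j))"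
    and sx: "\<And>x. summable (\<lambda>j. cinner (blinfun_apply x (\<xi> j)) (\<eta> j))"
    by (rule predual_cases[OF \<phi>]) blast
  define P where "P k = blinfun_apply (phase_op (c k))" for k
  define Q where "Q k = blinfun_apply (phase_op (- c k))" for k
  define a where "a j k = norm (\<xi> j) * norm (Q k (\<eta> j) - \<eta> j) + norm (P k (\<xi> j) - \<xi> j) * norm (\<eta> j)" for j k
  have PQ: "norm (P k x - x) \<le> 2 * norm x" "norm (Q k x - x) \<le> 2 * norm x" for k x
    using norm_triangle_ineq4[of "P k x" x] norm_triangle_ineq4[of "Q k x" x]
      unitary_opD(8)[OF phase_op_unitary, of _ x] by (simp_all add: P_def Q_def)
  have a_le: "norm (a j k) \<le> 4 * (norm (\<xi> j) * norm (\<eta> j))" for j k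
    using mult_left_mono[OF PQ(2)[of k "\<eta> j"] norm_ge_zero[of "\<xi> j"]]
      mult_right_mono[OF PQ(1)[of k "\<xi> j"] norm_ge_zero[of "\<eta> j"]]
    by (simp add: a_def)
  have lim: "(\<lambda>k. \<Sum>j. a j k) \<longlonglongrightarrow> (\<Sum>j. 0)"
  proof (rule tannerys_theorem[THEN conjunct2, THEN conjunct2])
    fix j
    have "(\<lambda>k. norm (\<xi> j) * norm (Q k (\<eta> j) - \<eta> j) + norm (P k (\<xi> j) - \<xi> j) * norm (\<eta> j))
        \<longlonglongrightarrow> norm (\<xi> j) * norm (\<eta> j - \<eta> j) + norm (\<xi> j - \<xi> j) * norm (\<eta> j)"
      unfolding P_def Q_def
      by (intro tendsto_intros phase_op_tendsto c almost_invariant_uminus)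
    then show "(\<lambda>k. a j k) \<longlonglongrightarrow> 0" by (simp add: a_def)
  next
    show "\<forall>\<^sub>F (j, k) in at_top \<times>\<^sub>F sequentially. norm (a j k) \<le> 4 * (norm (\<xi> j) * norm (\<eta> j))"
      by (rule always_eventually) (auto intro: a_le[unfolded real_norm_def])
  qed (use s in \<open>auto intro: summable_mult\<close>)
  have sa: "summable (\<lambda>j. a j k)" for k
    by (rule summable_comparison_test'[OF summable_mult[OF s, of 4]]) (rule a_le)
  have bound: "cmod (\<phi> (char_op (c k) o\<^sub>L y) - \<phi> (y o\<^sub>L char_op (c k))) \<le> (\<Sum>j. a j k)"
    if y: "y \<in> crossed_product" "norm y \<le> 1" for y k
  proof -
    let ?R = "blinfun_apply (base_op (c k))"
    have t: "cmod (cinner (blinfun_apply (char_op (c k) o\<^sub>L y) (\<xi> j)) (\<eta> j)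
        - cinner (blinfun_apply (y o\<^sub>L char_op (c k)) (\<xi> j)) (\<eta> j)) \<le> a j k" for j
    proof -
      have yn: "norm (blinfun_apply y x) \<le> norm x" for x
        using norm_blinfun[of y x] mult_right_mono[OF y(2) norm_ge_zero[of x]] by simp
      have "blinfun_apply (char_op (c k) o\<^sub>L y) (\<xi> j) = P k (?R (blinfun_apply y (\<xi> j)))"
        by (simp add: char_op_factor(2) P_def)
      then have 1: "cinner (blinfun_apply (char_op (c k) o\<^sub>L y) (\<xi> j)) (\<eta> j)
          = cinner (?R (blinfun_apply y (\<xi> j))) (Q k (\<eta> j))"
        by (simp add: P_def Q_def cinner_adj[OF unitary_opD(1)[OF phase_op_unitary]] adj_phase_op)
      have 2: "blinfun_apply (y o\<^sub>L char_op (c k)) (\<xi> j) = ?R (blinfun_apply y (P k (\<xi> j)))"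
        by (simp add: char_op_factor(1) P_def M.commute_apply[OF y(1) base_op_commutant])
      have "cinner (blinfun_apply (char_op (c k) o\<^sub>L y) (\<xi> j)) (\<eta> j)
          - cinner (blinfun_apply (y o\<^sub>L char_op (c k)) (\<xi> j)) (\<eta> j)
          = cinner (?R (blinfun_apply y (\<xi> j))) (Q k (\<eta> j) - \<eta> j)
            - cinner (?R (blinfun_apply y (P k (\<xi> j) - \<xi> j))) (\<eta> j)"
        unfolding 1 2 by (simp add: cinner_diff_left cinner_diff_right blinfun.diff_right)
      also have "cmod \<dots> \<le> norm (blinfun_apply y (\<xi> j)) * norm (Q k (\<eta> j) - \<eta> j)
          + norm (blinfun_apply y (P k (\<xi> j) - \<xi> j)) * norm (\<eta> j)"
        using cmod_cinner_le[of "?R (blinfun_apply y (\<xi> j))" "Q k (\<eta> j) - \<eta> j"]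
          cmod_cinner_le[of "?R (blinfun_apply y (P k (\<xi> j) - \<xi> j))" "\<eta> j"]
        by (intro norm_triangle_le_diff add_mono) (simp_all add: norm_base_op)
      also have "\<dots> \<le> a j k"
        unfolding a_def by (intro add_mono mult_right_mono yn) auto
      finally show ?thesis .
    qed
    have "\<phi> (char_op (c k) o\<^sub>L y) - \<phi> (y o\<^sub>L char_op (c k))
        = (\<Sum>j. cinner (blinfun_apply (char_op (c k) o\<^sub>L y) (\<xi> j)) (\<eta> j)
            - cinner (blinfun_apply (y o\<^sub>L char_op (c k)) (\<xi> j)) (\<eta> j))"
      by (simp only: \<phi> M.compose_mem char_op_mem y suminf_diff[OF sx sx])
    also have "cmod \<dots> \<le> (\<Sum>j. a j k)"
      by (rule norm_suminf_le[OF t sa])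
    finally show ?thesis .
  qed
  show ?thesis
  proof (rule Lim_null_comparison)
    show "(\<lambda>k. \<Sum>j. a j k) \<longlonglongrightarrow> 0" using lim by simp
    show "\<forall>\<^sub>F k in sequentially. norm (functional_norm crossed_product
        (\<lambda>y. \<phi> (char_op (c k) o\<^sub>L y) - \<phi> (y o\<^sub>L char_op (c k)))) \<le> (\<Sum>j. a j k)"
      using functional_norm_bounds(1,2)[OF bound] by (intro always_eventually) simp
  qed
qed

lemma bounded_seqs_iff:
  "x \<in> bounded_seqs crossed_product \<longleftrightarrow> (\<forall>n. x n \<in> crossed_product) \<and> (\<exists>C. \<forall>n. norm (x n) \<le> C)"
  by (auto simp: bounded_seqs_def bounded_iff)

lemma bounded_seqs_mem: "x \<in> bounded_seqs crossed_product \<Longrightarrow> x n \<in> crossed_product"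
  by (simp add: bounded_seqs_iff)

lemma bounded_seqs_compose:
  assumes "x \<in> bounded_seqs crossed_product" "y \<in> bounded_seqs crossed_product"
  shows "(\<lambda>n. x n o\<^sub>L y n) \<in> bounded_seqs crossed_product"
proof -
  obtain B C where BC: "\<And>n. norm (x n) \<le> B" "\<And>n. norm (y n) \<le> C"
    using assms by (auto simp: bounded_seqs_iff)
  have "norm (x n o\<^sub>L y n) \<le> B * C" for n
    by (rule order_trans[OF norm_blinfun_compose]) (intro mult_mono BC order_trans[OF norm_ge_zero BC(1)], simp)
  then show ?thesis using assms by (auto simp: bounded_seqs_iff M.compose_mem)
qed

lemma bounded_seqs_add:
  assumes "x \<in> bounded_seqs crossed_product" "y \<in> bounded_seqs crossed_product"
  shows "(\<lambda>n. x n + y n) \<in> bounded_seqs crossed_product"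
    "(\<lambda>n. x n - y n) \<in> bounded_seqs crossed_product"
proof -
  obtain B C where BC: "\<And>n. norm (x n) \<le> B" "\<And>n. norm (y n) \<le> C"
    using assms by (auto simp: bounded_seqs_iff)
  have "norm (x n + y n) \<le> B + C" "norm (x n - y n) \<le> B + C" for n
    by (intro norm_triangle_mono norm_triangle_le_diff add_mono BC)+
  then show "(\<lambda>n. x n + y n) \<in> bounded_seqs crossed_product"
    "(\<lambda>n. x n - y n) \<in> bounded_seqs crossed_product"
    using assms by (auto simp: bounded_seqs_iff M.add_mem M.diff_mem)
qed

lemma bounded_seqs_adj:
  "x \<in> bounded_seqs crossed_product \<Longrightarrow> (\<lambda>n. adj (x n)) \<in> bounded_seqs crossed_product"
  by (auto simp: bounded_seqs_iff M.adj_mem norm_adj M.bounded)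

lemma norm_le_1_isometry: "(\<And>\<xi>. norm (blinfun_apply u \<xi>) = norm \<xi>) \<Longrightarrow> norm u \<le> 1"
  by (rule norm_blinfun_bound) auto

lemma bounded_seqs_char: "(\<lambda>k. char_op (c k)) \<in> bounded_seqs crossed_product"
proof -
  have "norm (char_op (c n)) \<le> 1" for n
    by (rule norm_le_1_isometry[OF M.unitary_norm[OF char_op_unitary]])
  then show ?thesis unfolding bounded_seqs_iff using char_op_mem by blast
qed

locale free_filter =
  fixes \<omega> :: "nat filter"
  assumes free: "free_ultrafilter \<omega>"
begin

lemma le_sequentially: "\<omega> \<le> sequentially"
proof (rule filter_leI)
  fix P :: "nat \<Rightarrow> bool" assume "eventually P sequentially"
  then obtain N where N: "\<And>n. n \<ge> N \<Longrightarrow> P n" by (auto simp: eventually_sequentially)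
  have "\<forall>\<^sub>F n in \<omega>. \<forall>k\<in>{..<N}. n \<noteq> k"
    using free by (intro eventually_ball_finite) (auto simp: free_ultrafilter_def)
  then show "eventually P \<omega>"
    by eventually_elim (use N not_less in blast)
qed

lemmas limit_along = tendsto_mono[OF le_sequentially]

abbreviation N :: "(nat \<Rightarrow> ltwo op) set" where
  "N \<equiv> null_seqs \<omega> crossed_product"

lemma nullD:
  assumes "e \<in> N"
  shows "e \<in> bounded_seqs crossed_product" "((\<lambda>n. blinfun_apply (e n) \<xi>) \<longlongrightarrow> 0) \<omega>"
    "((\<lambda>n. blinfun_apply (adj (e n)) \<xi>) \<longlongrightarrow> 0) \<omega>"
  using assms by (auto simp: null_seqs_def)

lemma null_add:
  assumes e: "e \<in> N" and f: "f \<in> N"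
  shows "(\<lambda>n. e n + f n) \<in> N" "(\<lambda>n. e n - f n) \<in> N"
proof -
  have b: "e n \<in> bounded_ops" "f n \<in> bounded_ops" for n
    using nullD(1)[OF e] nullD(1)[OF f] by (auto intro: M.bounded bounded_seqs_mem)
  show "(\<lambda>n. e n + f n) \<in> N"
    using bounded_seqs_add(1)[OF nullD(1)[OF e] nullD(1)[OF f]]
      tendsto_add[OF nullD(2)[OF e] nullD(2)[OF f]] tendsto_add[OF nullD(3)[OF e] nullD(3)[OF f]]
    by (simp add: null_seqs_def adj_add b blinfun.add_left)
  show "(\<lambda>n. e n - f n) \<in> N"
    using bounded_seqs_add(2)[OF nullD(1)[OF e] nullD(1)[OF f]]
      tendsto_diff[OF nullD(2)[OF e] nullD(2)[OF f]] tendsto_diff[OF nullD(3)[OF e] nullD(3)[OF f]]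
    by (simp add: null_seqs_def adj_diff b blinfun.diff_left)
qed

lemma null_adj: "e \<in> N \<Longrightarrow> (\<lambda>n. adj (e n)) \<in> N"
  by (simp add: null_seqs_def bounded_seqs_adj) (simp add: bounded_seqs_iff)

lemma null_zero: "(\<lambda>n. 0) \<in> N"
proof -
  have "adj (0 :: ltwo op) = 0" by (rule adj_eqI) simp
  then show ?thesis by (auto simp: null_seqs_def bounded_seqs_iff M.zero_mem)
qed

lemma seq_class_cong:
  assumes "(\<lambda>n. x n - y n) \<in> N"
  shows "seq_class \<omega> crossed_product x = seq_class \<omega> crossed_product y"
proof -
  have "(\<lambda>n. z n - x n) \<in> N \<longleftrightarrow> (\<lambda>n. z n - y n) \<in> N" for z
    using null_add(1)[OF _ assms, of "\<lambda>n. z n - x n"] null_add(2)[OF _ assms, of "\<lambda>n. z n - y n"]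
    by auto
  then show ?thesis by (simp add: seq_class_def)
qed

lemma central_mem_class: "x \<in> central_seqs \<omega> crossed_product \<Longrightarrow> x \<in> seq_class \<omega> crossed_product x"
  by (simp add: seq_class_def null_zero)

text \<open>The operations on classes are unions over all representatives, which collapse to one class
  when \<open>f\<close> respects null sequences.\<close>

lemma class_map_eq:
  assumes x: "x \<in> central_seqs \<omega> crossed_product"
    and f: "\<And>y. y \<in> bounded_seqs crossed_product \<Longrightarrow> (\<lambda>n. y n - x n) \<in> N \<Longrightarrow> (\<lambda>n. f (y n) - f (x n)) \<in> N"
  shows "class_map \<omega> crossed_product f (seq_class \<omega> crossed_product x)
    = seq_class \<omega> crossed_product (\<lambda>n. f (x n))"
proof -
  have "seq_class \<omega> crossed_product (\<lambda>n. f (y n)) = seq_class \<omega> crossed_product (\<lambda>n. f (x n))"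
    if "y \<in> seq_class \<omega> crossed_product x" for y
    by (rule seq_class_cong[OF f]) (use that in \<open>auto simp: seq_class_def central_seqs_def\<close>)
  then show ?thesis using central_mem_class[OF x] unfolding class_map_def by blast
qed

lemma char_central:
  assumes "almost_invariant c"
  shows "(\<lambda>k. char_op (c k)) \<in> central_seqs \<omega> crossed_product"
  unfolding central_seqs_def
  using bounded_seqs_char[of c] limit_along[OF char_op_central[OF assms]] by blast

abbreviation char_class :: "(nat \<Rightarrow> int \<times> int) \<Rightarrow> (nat \<Rightarrow> ltwo op) set" where
  "char_class c \<equiv> seq_class \<omega> crossed_product (\<lambda>k. char_op (c k))"

text \<open>A null sequence need not stay null after multiplication from the right by a sequence of
  operators. Here \<open>e\<^sub>n x\<^sub>n \<xi> = R\<^sub>n e\<^sub>n P\<^sub>n \<xi>\<close> with \<open>R\<^sub>n\<close> isometric and \<open>P\<^sub>n \<xi>\<close> close to \<open>\<xi>\<close>.\<close>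

lemma null_times_char:
  assumes c: "almost_invariant c" and e: "e \<in> bounded_seqs crossed_product"
    and e0: "\<And>\<xi>. ((\<lambda>n. blinfun_apply (e n) \<xi>) \<longlongrightarrow> 0) \<omega>"
  shows "((\<lambda>n. blinfun_apply (e n) (blinfun_apply (char_op (c n)) \<xi>)) \<longlongrightarrow> 0) \<omega>"
proof -
  obtain C where C: "\<And>n. norm (e n) \<le> C" using e by (auto simp: bounded_seqs_iff)
  define d where "d n = blinfun_apply (phase_op (c n)) \<xi> - \<xi>" for n
  have d: "(d \<longlongrightarrow> 0) \<omega>"
    unfolding d_def using phase_op_tendsto[OF c, of \<xi>] by (intro limit_along) (simp add: LIM_zero_iff)
  show ?thesis
  proof (rule Lim_null_comparison)
    have "((\<lambda>n. norm (blinfun_apply (e n) \<xi>) + C * norm (d n)) \<longlongrightarrow> norm (0 :: ltwo) + C * norm (0 :: ltwo)) \<omega>"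
      by (intro tendsto_intros e0 d)
    then show "((\<lambda>n. norm (blinfun_apply (e n) \<xi>) + C * norm (d n)) \<longlongrightarrow> 0) \<omega>" by simp
    have "norm (blinfun_apply (e n) (blinfun_apply (char_op (c n)) \<xi>))
        \<le> norm (blinfun_apply (e n) \<xi>) + C * norm (d n)" for n
    proof -
      have "norm (blinfun_apply (e n) (blinfun_apply (char_op (c n)) \<xi>))
          = norm (blinfun_apply (e n) (\<xi> + d n))"
        by (simp add: char_op_factor(1) M.commute_apply[OF bounded_seqs_mem[OF e] base_op_commutant]
            norm_base_op d_def)
      also have "\<dots> \<le> norm (blinfun_apply (e n) \<xi>) + norm (blinfun_apply (e n) (d n))"
        unfolding blinfun.add_right by (rule norm_triangle_ineq)
      also have "norm (blinfun_apply (e n) (d n)) \<le> C * norm (d n)"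
        using norm_blinfun[of "e n" "d n"] mult_right_mono[OF C norm_ge_zero[of "d n"]] order_trans by blast
      finally show ?thesis by simp
    qed
    then show "\<forall>\<^sub>F n in \<omega>. norm (blinfun_apply (e n) (blinfun_apply (char_op (c n)) \<xi>))
        \<le> norm (blinfun_apply (e n) \<xi>) + C * norm (d n)" by (intro always_eventually allI)
  qed
qed

lemma bounded_times_null:
  assumes y: "y \<in> bounded_seqs crossed_product" and e0: "((\<lambda>n. blinfun_apply (e n) \<xi>) \<longlongrightarrow> 0) \<omega>"
  shows "((\<lambda>n. blinfun_apply (y n) (blinfun_apply (e n) \<xi>)) \<longlongrightarrow> 0) \<omega>"
proof -
  obtain C where C: "\<And>n. norm (y n) \<le> C" using y by (auto simp: bounded_seqs_iff)
  show ?thesis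
  proof (rule Lim_null_comparison)
    show "((\<lambda>n. C * norm (blinfun_apply (e n) \<xi>)) \<longlongrightarrow> 0) \<omega>"
      using tendsto_mult[OF tendsto_const tendsto_norm_zero[OF e0], of C] by simp
    show "\<forall>\<^sub>F n in \<omega>. norm (blinfun_apply (y n) (blinfun_apply (e n) \<xi>)) \<le> C * norm (blinfun_apply (e n) \<xi>)"
      using order_trans[OF norm_blinfun mult_right_mono[OF C norm_ge_zero]]
      by (intro always_eventually) blast
  qed
qed

text \<open>If \<open>y = x\<^sup>* + e\<close> and \<open>z = x + f\<close> with \<open>e\<close>, \<open>f\<close> null, then \<open>y z - 1 = y f + e x\<close>, and its
  adjoint \<open>z\<^sup>* e\<^sup>* + f\<^sup>* x\<close> has the same form.\<close>

lemma char_class_mult: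
  assumes c: "almost_invariant c"
  shows "class_mult \<omega> crossed_product (char_class (\<lambda>k. - c k)) (char_class c) = class_one \<omega> crossed_product"
proof -
  have "seq_class \<omega> crossed_product (\<lambda>n. y n o\<^sub>L z n) = class_one \<omega> crossed_product"
    if y: "y \<in> char_class (\<lambda>k. - c k)" and z: "z \<in> char_class c" for y z
    unfolding class_one_def
  proof (rule seq_class_cong)
    define e where "e n = y n - char_op (- c n)" for n
    define f where "f n = z n - char_op (c n)" for n
    have e: "e \<in> N" and f: "f \<in> N" using y z by (auto simp: seq_class_def e_def[abs_def] f_def[abs_def])
    have yb: "y \<in> bounded_seqs crossed_product" and zb: "z \<in> bounded_seqs crossed_product"
      using y z by (auto simp: seq_class_def central_seqs_def)
    note mem = bounded_seqs_mem[OF yb] bounded_seqs_mem[OF zb] char_op_mem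
    note bd = mem[THEN M.bounded]
    have eq: "(y n o\<^sub>L z n) - id_blinfun = (y n o\<^sub>L f n) + (e n o\<^sub>L char_op (c n))" for n
      by (simp add: e_def f_def compose_diff_left compose_diff_right char_op_inverse)
    have adj: "adj ((y n o\<^sub>L z n) - id_blinfun) = (adj (z n) o\<^sub>L adj (e n)) + (adj (f n) o\<^sub>L char_op (c n))" for n
      by (simp add: e_def f_def adj_diff adj_compose bd bounded_ops_compose adj_char_op
          compose_diff_left compose_diff_right char_op_inverse)
    have "(\<lambda>n. id_blinfun) \<in> bounded_seqs crossed_product" by (auto simp: bounded_seqs_iff M.id_mem)
    then have "(\<lambda>n. (y n o\<^sub>L z n) - id_blinfun) \<in> bounded_seqs crossed_product"
      by (intro bounded_seqs_add(2) bounded_seqs_compose yb zb)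
    moreover have "((\<lambda>n. blinfun_apply ((y n o\<^sub>L z n) - id_blinfun) \<xi>) \<longlongrightarrow> 0) \<omega>" for \<xi>
      using tendsto_add[OF bounded_times_null[OF yb nullD(2)[OF f]] null_times_char[OF c nullD(1)[OF e] nullD(2)[OF e]], of \<xi> \<xi>]
      unfolding eq by (simp add: blinfun.add_left)
    moreover have "((\<lambda>n. blinfun_apply (adj ((y n o\<^sub>L z n) - id_blinfun)) \<xi>) \<longlongrightarrow> 0) \<omega>" for \<xi>
      using tendsto_add[OF bounded_times_null[OF bounded_seqs_adj[OF zb] nullD(3)[OF e]]
          null_times_char[OF c bounded_seqs_adj[OF nullD(1)[OF f]] nullD(3)[OF f]], of \<xi> \<xi>]
      unfolding adj by (simp add: blinfun.add_left)
    ultimately show "(\<lambda>n. (y n o\<^sub>L z n) - id_blinfun) \<in> N" by (simp add: null_seqs_def)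
  qed
  then show ?thesis
    using central_mem_class[OF char_central[OF c]]
      central_mem_class[OF char_central[OF almost_invariant_uminus[OF c]]]
    unfolding class_mult_def by blast
qed

lemma char_class_unitary:
  assumes c: "almost_invariant c"
  shows "char_class c \<in> class_unitaries \<omega> crossed_product"
proof -
  have b: "y \<in> bounded_ops" if "y \<in> crossed_product" for y using that by (rule M.bounded)
  have "class_map \<omega> crossed_product adj (char_class c) = char_class (\<lambda>k. - c k)"
    unfolding adj_char_op[symmetric]
  proof (rule class_map_eq[OF char_central[OF c]])
    fix y assume y: "y \<in> bounded_seqs crossed_product" and n: "(\<lambda>n. y n - char_op (c n)) \<in> N"
    show "(\<lambda>n. adj (y n) - adj (char_op (c n))) \<in> N"
      using null_adj[OF n] by (simp add: adj_diff M.bounded bounded_seqs_mem[OF y] char_op_mem)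
  qed
  moreover have "char_class c \<in> central_algebra \<omega> crossed_product"
    unfolding central_algebra_def using char_central[OF c] by blast
  ultimately show ?thesis
    using char_class_mult[OF c] char_class_mult[OF almost_invariant_uminus[OF c]]
    by (simp add: class_unitaries_def)
qed

end

lemma cmod_cis_minus_1: "cmod (cis x - 1) \<le> \<bar>x\<bar>"
proof -
  have "cmod (cis x - 1) = 2 * \<bar>sin (x / 2)\<bar>"
    using dist_exp_i_1[of x] by (simp add: cis_conv_exp)
  also have "\<bar>sin (x / 2)\<bar> \<le> \<bar>x / 2\<bar>" by (rule abs_sin_x_le_abs_x)
  finally show ?thesis by simp
qed

lemma theta_char:
  "theta p q t (char_op a) = cscale (cis (- (frequency p q a * t))) (char_op a)"
proof -
  have "torus_char a (x - direction p q t) = cis (- (frequency p q a * t)) * torus_char a x" for x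
    using torus_char_add[of a x "- direction p q t"]
    by (simp add: torus_char_uminus torus_char_direction cis_cnj mult.commute)
  then show ?thesis
    unfolding theta_def char_op_def Ad_translation_pi[OF torus_char_linf]
    by (simp add: cp_pi_eq cscale_mult_op pi_symbol_symbols torus_char_linf)
      (simp add: pi_symbol_def[abs_def])
qed

lemma state_cscale_id:
  assumes "faithful_normal_state crossed_product \<phi>"
  shows "\<phi> (cscale r id_blinfun) = r"
proof -
  have \<phi>: "\<phi> \<in> predual crossed_product" "\<phi> id_blinfun = 1" using assms by (auto simp: faithful_normal_state_def)
  obtain \<xi> \<eta> :: "nat \<Rightarrow> ltwo"
    where "summable (\<lambda>j. norm (\<xi> j) * norm (\<eta> j))"
      and s: "\<And>x. x \<in> crossed_product \<Longrightarrow> \<phi> x = (\<Sum>j. cinner (blinfun_apply x (\<xi> j)) (\<eta> j))"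
      and sx: "\<And>x. summable (\<lambda>j. cinner (blinfun_apply x (\<xi> j)) (\<eta> j))"
    by (rule predual_cases[OF \<phi>(1)]) blast
  have "\<phi> (cscale r id_blinfun) = (\<Sum>j. r * cinner (blinfun_apply id_blinfun (\<xi> j)) (\<eta> j))"
    by (simp add: s M.cscale_mem M.id_mem cinner_scaleC_left)
  also have "\<dots> = r * \<phi> id_blinfun"
    using suminf_mult[OF sx[of id_blinfun], of r] by (simp add: s M.id_mem)
  finally show ?thesis by (simp add: \<phi>)
qed

lemma sharp_norm_char:
  assumes "faithful_normal_state crossed_product \<phi>"
  shows "sharp_norm \<phi> (cscale d (char_op a)) = sqrt 2 * cmod d"
proof -
  have b: "char_op a \<in> bounded_ops" by (rule M.bounded[OF char_op_mem])
  have u: "adj (char_op a) o\<^sub>L char_op a = id_blinfun" "char_op a o\<^sub>L adj (char_op a) = id_blinfun"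
    using char_op_unitary[of a] by (auto simp: unitaries_def)
  have "adj (cscale d (char_op a)) o\<^sub>L cscale d (char_op a) = cscale (of_real ((cmod d)\<^sup>2)) id_blinfun"
    "cscale d (char_op a) o\<^sub>L adj (cscale d (char_op a)) = cscale (of_real ((cmod d)\<^sup>2)) id_blinfun"
    using complex_norm_square[of d]
    by (simp_all add: adj_cscale b cscale_compose_left cscale_compose_right adj_bounded_ops u cscale_cscale
        mult.commute)
  then have "sharp_norm \<phi> (cscale d (char_op a)) = sqrt (2 * (cmod d)\<^sup>2)"
    by (simp only: sharp_norm_def state_cscale_id[OF assms] plus_complex.simps Re_complex_of_real mult_2)
  then show ?thesis by (simp add: real_sqrt_mult)
qed

context free_filter
begin

lemma null_scaled_char:
  assumes "(\<lambda>n. z n) \<longlonglongrightarrow> 0"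
  shows "(\<lambda>n. cscale (z n) (char_op (c n))) \<in> N"
proof -
  have b: "char_op a \<in> bounded_ops" for a by (rule M.bounded[OF char_op_mem])
  have nc: "norm (blinfun_apply (char_op a) \<xi>) = norm \<xi>" for a \<xi>
    by (rule M.unitary_norm[OF char_op_unitary])
  obtain C where C: "\<And>n. cmod (z n) \<le> C"
    using convergent_imp_Bseq[OF convergentI[OF assms]] by (auto simp: Bseq_def)
  have "norm (cscale (z n) (char_op (c n))) \<le> C" for n
    using mult_mono[OF C[of n] norm_le_1_isometry[OF nc, of "c n"]] order_trans[OF norm_ge_zero C]
    by (simp add: norm_cscale)
  then have "(\<lambda>n. cscale (z n) (char_op (c n))) \<in> bounded_seqs crossed_product"
    by (auto simp: bounded_seqs_iff M.cscale_mem char_op_mem)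
  moreover have "((\<lambda>n. w n *\<^sub>C blinfun_apply (char_op (d n)) \<xi>) \<longlongrightarrow> 0) \<omega>" if "w \<longlonglongrightarrow> 0" for w d \<xi>
  proof (rule limit_along, rule Lim_null_comparison)
    show "(\<lambda>n. cmod (w n) * norm \<xi>) \<longlonglongrightarrow> 0"
      using tendsto_mult[OF tendsto_norm_zero[OF that] tendsto_const, of "norm \<xi>"] by simp
  qed (simp add: norm_scaleC nc)
  moreover have "(\<lambda>n. cnj (z n)) \<longlonglongrightarrow> 0" using tendsto_cnj[OF assms] by simp
  ultimately show ?thesis
    using assms by (simp add: null_seqs_def adj_cscale b adj_char_op)
qed

lemma null_theta:
  assumes e: "e \<in> N"
  shows "(\<lambda>n. theta p q t (e n)) \<in> N"
proof -
  let ?V = "translation (direction p q t)"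
  have en: "e n \<in> crossed_product" for n by (rule bounded_seqs_mem[OF nullD(1)[OF e]])
  have "norm (theta p q t (e n)) \<le> norm (e n)" for n
    by (rule M.automorphism_contractive[OF theta_automorphism en])
  moreover obtain C where "\<And>n. norm (e n) \<le> C" using nullD(1)[OF e] by (auto simp: bounded_seqs_iff)
  ultimately have "(\<lambda>n. theta p q t (e n)) \<in> bounded_seqs crossed_product"
    by (auto simp: bounded_seqs_iff M.aut_mem[OF theta_automorphism] en intro: order_trans)
  moreover have "((\<lambda>n. blinfun_apply (theta p q t (f n)) \<xi>) \<longlongrightarrow> 0) \<omega>"
    if "\<And>\<xi>. ((\<lambda>n. blinfun_apply (f n) \<xi>) \<longlongrightarrow> 0) \<omega>" for f \<xi>
  proof -
    have "((\<lambda>n. blinfun_apply ?V (blinfun_apply (f n) (blinfun_apply (adj ?V) \<xi>))) \<longlongrightarrow> blinfun_apply ?V 0) \<omega>"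
      by (intro tendsto_intros that)
    then show ?thesis by (simp add: theta_def Ad_def)
  qed
  ultimately show ?thesis
    using nullD(2,3)[OF e] by (simp add: null_seqs_def M.aut_adj[OF theta_automorphism en, symmetric])
qed

lemma null_cscale:
  assumes e: "e \<in> N"
  shows "(\<lambda>n. cscale z (e n)) \<in> N"
proof -
  have en: "e n \<in> crossed_product" for n by (rule bounded_seqs_mem[OF nullD(1)[OF e]])
  obtain C where "\<And>n. norm (e n) \<le> C" using nullD(1)[OF e] by (auto simp: bounded_seqs_iff)
  then have "norm (cscale z (e n)) \<le> cmod z * C" for n by (simp add: norm_cscale mult_left_mono)
  then have "(\<lambda>n. cscale z (e n)) \<in> bounded_seqs crossed_product"
    by (auto simp: bounded_seqs_iff M.cscale_mem en)
  moreover have "((\<lambda>n. w *\<^sub>C f n) \<longlongrightarrow> 0) \<omega>" if "(f \<longlongrightarrow> (0 :: ltwo)) \<omega>" for w f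
    using bounded_linear.tendsto[OF bounded_linear_scaleC that, of w] by simp
  ultimately show ?thesis
    using nullD(2,3)[OF e] by (simp add: null_seqs_def adj_cscale M.bounded[OF en])
qed

text \<open>A sequence of almost invariant characters with frequencies tending to \<open>r\<close> is an
  eigenvector of frequency \<open>r\<close> in the limit. Its orbit is equicontinuous even in operator norm,
  because the frequencies are bounded.\<close>

lemma rohlin_theta:
  assumes \<phi>: "faithful_normal_state crossed_product \<phi>"
    and dense: "\<And>r. \<exists>c. almost_invariant c \<and> (\<lambda>k. frequency p q (c k)) \<longlonglongrightarrow> r"
  shows "rohlin_property \<omega> \<phi> crossed_product (theta p q)"
  unfolding rohlin_property_def
proof (intro allI)
  fix r :: real
  obtain c where c: "almost_invariant c" and fr: "(\<lambda>k. frequency p q (c k)) \<longlonglongrightarrow> r"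
    using dense by blast
  have th: "theta p q t (char_op (c n)) - char_op (c n)
      = cscale (cis (- (frequency p q (c n) * t)) - 1) (char_op (c n))" for t n
    by (rule blinfun_eqI) (simp add: theta_char blinfun.diff_left scaleC_diff_left)
  have "char_class c \<in> equicontinuous_part \<omega> \<phi> crossed_product (theta p q)"
  proof -
    obtain B where B: "B > 0" "\<And>n. \<bar>frequency p q (c n)\<bar> \<le> B"
      using convergent_imp_Bseq[OF convergentI[OF fr]] by (auto simp: Bseq_def)
    have eq: "\<exists>\<delta>>0. \<forall>\<^sub>F n in \<omega>. \<forall>t. \<bar>t\<bar> < \<delta> \<longrightarrow> sharp_norm \<phi> (theta p q t (char_op (c n)) - char_op (c n)) < \<epsilon>"
      if e: "\<epsilon> > 0" for \<epsilon>
    proof (intro exI conjI always_eventually allI impI)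
      show "\<epsilon> / (2 * B) > 0" using e B by simp
      fix n t assume t: "\<bar>t\<bar> < \<epsilon> / (2 * B)"
      have "sharp_norm \<phi> (theta p q t (char_op (c n)) - char_op (c n))
          = sqrt 2 * cmod (cis (- (frequency p q (c n) * t)) - 1)"
        by (simp only: th sharp_norm_char[OF \<phi>])
      also have "\<dots> \<le> 2 * \<bar>- (frequency p q (c n) * t)\<bar>"
      proof (rule mult_mono[OF _ cmod_cis_minus_1])
        show "sqrt 2 \<le> 2" by (rule real_le_lsqrt) auto
      qed auto
      also have "\<dots> \<le> 2 * (B * \<bar>t\<bar>)" using B by (simp add: abs_mult mult_right_mono)
      also have "\<dots> < \<epsilon>" using t B by (simp add: field_simps)
      finally show "sharp_norm \<phi> (theta p q t (char_op (c n)) - char_op (c n)) < \<epsilon>" .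
    qed
    have "char_class c \<in> central_algebra \<omega> crossed_product"
      unfolding central_algebra_def using char_central[OF c] by blast
    then show ?thesis
      unfolding equicontinuous_part_def mem_Collect_eq
      by (intro conjI bexI[OF _ central_mem_class[OF char_central[OF c]]] allI impI eq)
  qed
  moreover have "class_map \<omega> crossed_product (theta p q t) (char_class c)
      = class_map \<omega> crossed_product (cscale (exp (- \<i> * of_real (r * t)))) (char_class c)" for t
  proof -
    define z where "z = exp (- \<i> * of_real (r * t))"
    have z: "z = cis (- (r * t))" by (simp add: z_def cis_conv_exp)
    have "class_map \<omega> crossed_product (theta p q t) (char_class c)
        = seq_class \<omega> crossed_product (\<lambda>n. theta p q t (char_op (c n)))"
    proof (rule class_map_eq[OF char_central[OF c]])
      fix y assume y: "y \<in> bounded_seqs crossed_product" "(\<lambda>n. y n - char_op (c n)) \<in> N"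
      show "(\<lambda>n. theta p q t (y n) - theta p q t (char_op (c n))) \<in> N"
        using null_theta[OF y(2), of p q t]
        by (simp add: M.aut_diff[OF theta_automorphism bounded_seqs_mem[OF y(1)] char_op_mem])
    qed
    also have "\<dots> = seq_class \<omega> crossed_product (\<lambda>n. cscale z (char_op (c n)))"
    proof (rule seq_class_cong)
      have "(\<lambda>n. cis (- (frequency p q (c n) * t)) - z) \<longlonglongrightarrow> cis (- (r * t)) - z"
        by (intro tendsto_intros fr)
      then have "(\<lambda>n. cscale (cis (- (frequency p q (c n) * t)) - z) (char_op (c n))) \<in> N"
        by (intro null_scaled_char) (simp add: z)
      moreover have "cscale (w - z) x = cscale w x - cscale z x" for w and x :: "ltwo op"
        by (rule blinfun_eqI) (simp add: blinfun.diff_left scaleC_diff_left)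
      ultimately show "(\<lambda>n. theta p q t (char_op (c n)) - cscale z (char_op (c n))) \<in> N"
        by (simp add: theta_char)
    qed
    also have "\<dots> = class_map \<omega> crossed_product (cscale z) (char_class c)"
    proof (rule class_map_eq[symmetric, OF char_central[OF c]])
      fix y assume y: "(\<lambda>n. y n - char_op (c n)) \<in> N"
      have "cscale z (u - v) = cscale z u - cscale z v" for u v :: "ltwo op"
        by (rule blinfun_eqI) (simp add: blinfun.diff_left scaleC_diff_right)
      with null_cscale[OF y, of z]
      show "(\<lambda>n. cscale z (y n) - cscale z (char_op (c n))) \<in> N" by simp
    qed
    finally show ?thesis by (simp add: z_def)
  qed
  ultimately show "\<exists>U\<in>equicontinuous_part \<omega> \<phi> crossed_product (theta p q) \<inter> class_unitaries \<omega> crossed_product.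
      \<forall>t. class_map \<omega> crossed_product (theta p q t) U
        = class_map \<omega> crossed_product (cscale (exp (- \<i> * of_real (r * t)))) U"
    using char_class_unitary[OF c] by blast
qed

end

section \<open>Approximately inner automorphisms\<close>

text \<open>The 2-norm of the trace.\<close>

definition trace_norm :: "ltwo op \<Rightarrow> real" where
  "trace_norm x = norm (blinfun_apply x vacuum)"

lemma trace_norm_triangle: "trace_norm (x - z) \<le> trace_norm (x - y) + trace_norm (y - z)"
proof -
  have "x - z = (x - y) + (y - z)" by simp
  then show ?thesis unfolding trace_norm_def by (metis blinfun.add_left norm_triangle_ineq)
qed

lemma trace_norm_minus_commute: "trace_norm (x - y) = trace_norm (y - x)"
  by (simp add: trace_norm_def blinfun.diff_left norm_minus_commute)

lemma trace_norm_cscale: "trace_norm (cscale c x) = cmod c * trace_norm x"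
  by (simp add: trace_norm_def norm_scaleC)

lemma trace_norm_unitary_left:
  "u \<in> unitaries crossed_product \<Longrightarrow> trace_norm (u o\<^sub>L x) = trace_norm x"
  by (simp add: trace_norm_def M.unitary_norm)

lemma trace_norm_unitary_right:
  "u \<in> unitaries crossed_product \<Longrightarrow> x \<in> crossed_product \<Longrightarrow> trace_norm (x o\<^sub>L u) = trace_norm x"
  by (simp add: trace_norm_def norm_unitary_vacuum)

lemma trace_norm_Ad:
  "u \<in> unitaries crossed_product \<Longrightarrow> x \<in> crossed_product \<Longrightarrow> trace_norm (Ad u x) = trace_norm x"
  by (simp add: Ad_def compose_assoc trace_norm_unitary_left trace_norm_unitary_right M.unitary_adj)

lemma trace_norm_theta: "trace_norm (theta p q t x) = trace_norm x"
  by (simp add: trace_norm_def theta_def Ad_def adj_translation translation_vacuum norm_translation)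

lemma Ad_compose_unitary: "u \<in> unitaries crossed_product \<Longrightarrow> Ad u y o\<^sub>L u = u o\<^sub>L y"
  by (rule blinfun_eqI) (simp add: Ad_def M.unitary_cancel)

lemma vector_functional_predual: "(\<lambda>x. cinner (blinfun_apply x \<zeta>) v) \<in> predual crossed_product"
proof -
  define \<xi> where "\<xi> j = (if j = 0 then \<zeta> else 0)" for j :: nat
  define \<eta> where "\<eta> j = (if j = 0 then v else 0)" for j :: nat
  have "summable (\<lambda>j. (norm (\<xi> j))\<^sup>2)" "summable (\<lambda>j. (norm (\<eta> j))\<^sup>2)"
    by (rule summable_finite[of "{0}"]; simp add: \<xi>_def \<eta>_def)+
  moreover have "cinner (blinfun_apply x \<zeta>) v = (\<Sum>j. cinner (blinfun_apply x (\<xi> j)) (\<eta> j))" for x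
    by (subst suminf_finite[of "{0}"]) (auto simp: \<xi>_def \<eta>_def)
  ultimately show ?thesis unfolding predual_def by blast
qed

text \<open>For unitaries, \<open>\<parallel>(\<sigma>(y) - u y u\<^sup>*) \<Omega>\<parallel>\<^sup>2 = 2 - 2 Re \<langle>u y u\<^sup>* \<Omega>, \<sigma>(y) \<Omega>\<rangle>\<close>, and the inner product
  is a normal functional of \<open>u y u\<^sup>*\<close> with the value 1 at \<open>\<sigma>(y)\<close>.\<close>

lemma approximately_inner_on_unitaries:
  assumes \<sigma>: "approximately_inner crossed_product \<sigma>"
    and Y: "finite Y" "Y \<subseteq> unitaries crossed_product" and e: "\<epsilon> > 0"
  shows "\<exists>u\<in>unitaries crossed_product. \<forall>y\<in>Y. trace_norm (\<sigma> y - Ad u y) \<le> \<epsilon>"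
proof -
  have aut: "\<sigma> \<in> automorphisms crossed_product" using \<sigma> by (simp add: approximately_inner_def)
  define f where "f y z = cinner (blinfun_apply z vacuum) (blinfun_apply (\<sigma> y) vacuum)" for y z
  have "finite (f ` Y) \<and> f ` Y \<subseteq> predual crossed_product \<and> \<epsilon>\<^sup>2 / 2 > 0"
    using Y e by (auto simp: f_def[abs_def] vector_functional_predual)
  from \<sigma>[unfolded approximately_inner_def, THEN conjunct2, rule_format, OF this]
  obtain u where u: "u \<in> unitaries crossed_product"
    and un: "\<And>y. y \<in> Y \<Longrightarrow> functional_norm crossed_product (\<lambda>x. f y (\<sigma> x) - f y (Ad u x)) < \<epsilon>\<^sup>2 / 2"
    by (auto simp: ball_simps)
  have "trace_norm (\<sigma> y - Ad u y) \<le> \<epsilon>" if yY: "y \<in> Y" for y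
  proof -
    have y: "y \<in> unitaries crossed_product" using yY Y by blast
    have yM: "y \<in> crossed_product" by (rule M.unitary_mem[OF y])
    have n1: "norm (blinfun_apply x vacuum) \<le> 1" if "norm x \<le> 1" for x
      using norm_blinfun[of x vacuum] that by (simp add: norm_vacuum)
    have "cmod (f y (\<sigma> x) - f y (Ad u x)) \<le> 2 * norm (blinfun_apply (\<sigma> y) vacuum)"
      if x: "x \<in> crossed_product" "norm x \<le> 1" for x
    proof -
      have "norm (\<sigma> x) \<le> 1" using M.automorphism_contractive[OF aut x(1)] x(2) by simp
      then have "norm (blinfun_apply (\<sigma> x) vacuum) \<le> 1" by (rule n1)
      moreover have "norm (blinfun_apply (Ad u x) vacuum) \<le> 1"
        using trace_norm_Ad[OF u x(1)] n1[OF x(2)] by (simp add: trace_norm_def)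
      ultimately have n: "norm (blinfun_apply (\<sigma> x) vacuum - blinfun_apply (Ad u x) vacuum) \<le> 2"
        using norm_triangle_ineq4[of "blinfun_apply (\<sigma> x) vacuum" "blinfun_apply (Ad u x) vacuum"] by linarith
      have "cmod (f y (\<sigma> x) - f y (Ad u x))
          \<le> norm (blinfun_apply (\<sigma> x) vacuum - blinfun_apply (Ad u x) vacuum) * norm (blinfun_apply (\<sigma> y) vacuum)"
        unfolding f_def cinner_diff_left[symmetric] by (rule cmod_cinner_le)
      also have "\<dots> \<le> 2 * norm (blinfun_apply (\<sigma> y) vacuum)" by (rule mult_right_mono[OF n]) simp
      finally show ?thesis .
    qed
    note bound = this
    have "norm y \<le> 1" by (rule norm_le_1_isometry[OF M.unitary_norm[OF y]])
    with functional_norm_bounds(3)[where \<psi>="\<lambda>x. f y (\<sigma> x) - f y (Ad u x)", OF bound yM] un[OF yY]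
    have less: "cmod (f y (\<sigma> y) - f y (Ad u y)) < \<epsilon>\<^sup>2 / 2" by linarith
    have "\<sigma> y \<in> crossed_product" by (rule M.aut_mem[OF aut yM])
    moreover have "adj (\<sigma> y) o\<^sub>L \<sigma> y = id_blinfun" "\<sigma> y o\<^sub>L adj (\<sigma> y) = id_blinfun"
      using y M.adj_mem[OF yM] yM
      by (simp_all add: M.aut_adj[OF aut, symmetric] M.aut_compose[OF aut, symmetric] M.aut_id[OF aut] unitaries_def)
    ultimately have sy: "\<sigma> y \<in> unitaries crossed_product" by (simp add: unitaries_def)
    have ns: "norm (blinfun_apply (\<sigma> y) vacuum) = 1"
      by (simp add: M.unitary_norm[OF sy] norm_vacuum)
    have nu: "norm (blinfun_apply (Ad u y) vacuum) = 1"
      using trace_norm_Ad[OF u yM] by (simp add: trace_norm_def M.unitary_norm[OF y] norm_vacuum)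
    have fy: "f y (\<sigma> y) = 1" by (simp add: f_def cinner_self ns)
    have "(trace_norm (\<sigma> y - Ad u y))\<^sup>2 = 2 - 2 * Re (f y (Ad u y))"
      using norm_sub_square[of "blinfun_apply (Ad u y) vacuum" "blinfun_apply (\<sigma> y) vacuum"]
      by (simp add: trace_norm_def blinfun.diff_left ns nu f_def norm_minus_commute)
    also have "\<dots> = 2 * Re (f y (\<sigma> y) - f y (Ad u y))" by (simp add: fy)
    also have "\<dots> \<le> \<epsilon>\<^sup>2" using complex_Re_le_cmod[of "f y (\<sigma> y) - f y (Ad u y)"] less by linarith
    finally show ?thesis by (rule power2_le_imp_le) (use e in simp)
  qed
  with u show ?thesis by blast
qed

text \<open>Multiply the commutator by \<open>u\<close> from the left and compare with \<open>(Ad u y - Ad v y) v\<close>.\<close>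

lemma trace_norm_commutator:
  assumes u: "u \<in> unitaries crossed_product" and v: "v \<in> unitaries crossed_product"
    and y: "y \<in> crossed_product"
  shows "trace_norm ((y o\<^sub>L (adj u o\<^sub>L v)) - ((adj u o\<^sub>L v) o\<^sub>L y)) = trace_norm (Ad u y - Ad v y)"
proof -
  have "trace_norm (Ad u y - Ad v y) = trace_norm ((Ad u y - Ad v y) o\<^sub>L v)"
    by (rule trace_norm_unitary_right[symmetric, OF v M.diff_mem[OF M.Ad_mem[OF u y] M.Ad_mem[OF v y]]])
  also have "(Ad u y - Ad v y) o\<^sub>L v = u o\<^sub>L ((y o\<^sub>L (adj u o\<^sub>L v)) - ((adj u o\<^sub>L v) o\<^sub>L y))"
    by (rule blinfun_eqI)
      (simp add: Ad_def blinfun.diff_left blinfun.diff_right M.unitary_cancel[OF u] M.unitary_cancel[OF v])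
  finally show ?thesis by (simp add: trace_norm_unitary_left[OF u])
qed

lemma conj_op_vacuum:
  assumes w: "w \<in> crossed_product"
  shows "norm (blinfun_apply (conj_op h) (blinfun_apply w vacuum) - blinfun_apply w vacuum)
    = trace_norm ((cp_lambda h o\<^sub>L w) - (w o\<^sub>L cp_lambda h))"
proof -
  have h: "cp_lambda (f2_inv h) \<in> unitaries crossed_product" by (rule cp_lambda_unitary)
  have canc: "blinfun_apply (cp_lambda h) (blinfun_apply (cp_lambda (f2_inv h)) \<xi>) = \<xi>" for \<xi>
    using unitary_opD(6)[OF cp_lambda_unitary_op[of h]] by (simp add: adj_cp_lambda)
  have "blinfun_apply (conj_op h) (blinfun_apply w vacuum)
      = blinfun_apply (cp_lambda h) (blinfun_apply w (blinfun_apply (cp_lambda (f2_inv h)) vacuum))"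
    by (simp add: conj_op_def lambda_vacuum M.commute_apply[OF w rho_commutant])
  then have "blinfun_apply (conj_op h) (blinfun_apply w vacuum) - blinfun_apply w vacuum
      = blinfun_apply (((cp_lambda h o\<^sub>L w) - (w o\<^sub>L cp_lambda h)) o\<^sub>L cp_lambda (f2_inv h)) vacuum"
    by (simp add: blinfun.diff_left canc)
  then show ?thesis
    using trace_norm_unitary_right[OF h, of "(cp_lambda h o\<^sub>L w) - (w o\<^sub>L cp_lambda h)"]
    by (simp add: trace_norm_def M.diff_mem M.compose_mem w cp_lambda_mem)
qed

text \<open>Since \<open>\<pi>(\<chi>) \<Omega> = R \<Omega>\<close> with \<open>R\<close> in the commutant, both products contain \<open>R\<close> and only
  \<open>\<pi>(\<chi>) w \<Omega>\<close> contains the phases.\<close>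

lemma char_commutator_vacuum:
  assumes w: "w \<in> crossed_product"
  shows "trace_norm ((char_op a o\<^sub>L w) - (w o\<^sub>L char_op a))
    = norm (blinfun_apply (phase_op a) (blinfun_apply w vacuum) - blinfun_apply w vacuum)"
proof -
  let ?\<zeta> = "blinfun_apply w vacuum"
  have "blinfun_apply (char_op a) vacuum = blinfun_apply (base_op a) vacuum"
    by (simp add: char_op_def base_op_def pi_vacuum torus_char_linf)
  then have "blinfun_apply (w o\<^sub>L char_op a) vacuum = blinfun_apply (base_op a) ?\<zeta>"
    by (simp add: M.commute_apply[OF w base_op_commutant])
  moreover have "blinfun_apply (char_op a o\<^sub>L w) vacuum = blinfun_apply (base_op a) (blinfun_apply (phase_op a) ?\<zeta>)"
    by (simp add: char_op_factor(1))
  ultimately have "blinfun_apply ((char_op a o\<^sub>L w) - (w o\<^sub>L char_op a)) vacuum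
      = blinfun_apply (base_op a) (blinfun_apply (phase_op a) ?\<zeta> - ?\<zeta>)"
    by (simp add: blinfun.diff_left blinfun.diff_right)
  then show ?thesis by (simp add: trace_norm_def norm_base_op)
qed

text \<open>The phase at the neutral element is 1.\<close>

lemma phase_op_mass: "norm (blinfun_apply (phase_op a) \<zeta> - \<zeta>) \<le> 2 * mass (- {1}) \<zeta>"
proof -
  obtain \<xi> where z: "\<zeta> = to_ltwo \<xi>" and \<xi>: "square_integrable \<xi>" by (rule ltwo_cases)
  define \<eta> where "\<eta> = blinfun_apply (restrict_op (- {1})) \<zeta>"
  have sq: "square_integrable (\<lambda>z. indicator (- {1}) (fst z) * \<xi> z)"
    by (rule mult_op_apply(2)[OF restrict_symbols \<xi>])
  have "blinfun_apply (phase_op a) \<zeta> - \<zeta> = blinfun_apply (phase_op a) \<eta> - \<eta>"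
    using mult_op_apply[OF phase_symbols \<xi>, of a] mult_op_apply[OF phase_symbols sq, of a]
      mult_op_apply(1)[OF restrict_symbols \<xi>, of "- {1}"] sq \<xi>
    by (simp add: \<eta>_def z phase_op_def restrict_op_def minus_to_ltwo)
      (rule arg_cong[where f=to_ltwo], auto simp: fun_eq_iff indicator_def)
  also have "norm \<dots> \<le> norm (blinfun_apply (phase_op a) \<eta>) + norm \<eta>" by (rule norm_triangle_ineq4)
  also have "\<dots> = 2 * mass (- {1}) \<zeta>"
    by (simp add: unitary_opD(8)[OF phase_op_unitary] mass_def \<eta>_def)
  finally show ?thesis .
qed

text \<open>The unitary \<open>u\<close> is chosen for the generators alone. For a given character a second unitary
  \<open>v\<close> is chosen for the generators and this character; by the spectral gap \<open>u\<^sup>* v\<close> almost commutes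
  with every character, so \<open>Ad u\<close> is as good as \<open>Ad v\<close>.\<close>

lemma approximately_inner_uniform_on_characters:
  assumes \<sigma>: "approximately_inner crossed_product \<sigma>" and e: "\<epsilon> > 0"
  shows "\<exists>u\<in>unitaries crossed_product. \<forall>a. trace_norm (\<sigma> (char_op a) - Ad u (char_op a)) \<le> \<epsilon>"
proof -
  \<comment> \<open>The error is \<open>\<delta>\<close> from \<open>v\<close> at the character, and \<open>2 * (14 * (2 * \<delta>))\<close> from comparing \<open>v\<close> with
    \<open>u\<close>: the spectral gap applied to commutators of size \<open>2 * \<delta>\<close>, doubled by \<open>phase_op_mass\<close>.\<close>
  define \<delta> where "\<delta> = \<epsilon> / 57"
  have d: "\<delta> > 0" using e by (simp add: \<delta>_def)
  let ?G = "{cp_lambda f2_a, cp_lambda f2_b}"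
  have G: "finite ?G" "?G \<subseteq> unitaries crossed_product" by (auto simp: cp_lambda_unitary)
  obtain u where u: "u \<in> unitaries crossed_product"
    and uG: "\<And>y. y \<in> ?G \<Longrightarrow> trace_norm (\<sigma> y - Ad u y) \<le> \<delta>"
    using approximately_inner_on_unitaries[OF \<sigma> G d] by blast
  have "trace_norm (\<sigma> (char_op a) - Ad u (char_op a)) \<le> \<epsilon>" for a
  proof -
    have G': "finite (insert (char_op a) ?G)" "insert (char_op a) ?G \<subseteq> unitaries crossed_product"
      using G char_op_unitary by auto
    obtain v where v: "v \<in> unitaries crossed_product"
      and vG: "\<And>y. y \<in> insert (char_op a) ?G \<Longrightarrow> trace_norm (\<sigma> y - Ad v y) \<le> \<delta>"
      using approximately_inner_on_unitaries[OF \<sigma> G' d] by blast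
    define w where "w = adj u o\<^sub>L v"
    have w: "w \<in> crossed_product"
      unfolding w_def by (intro M.compose_mem M.adj_mem M.unitary_mem u v)
    have gap: "norm (blinfun_apply (conj_op h) (blinfun_apply w vacuum) - blinfun_apply w vacuum) \<le> 2 * \<delta>"
      if h: "cp_lambda h \<in> ?G" for h
    proof -
      have "norm (blinfun_apply (conj_op h) (blinfun_apply w vacuum) - blinfun_apply w vacuum)
          = trace_norm (Ad u (cp_lambda h) - Ad v (cp_lambda h))"
        unfolding conj_op_vacuum[OF w] unfolding w_def
        by (rule trace_norm_commutator[OF u v cp_lambda_mem])
      also have "\<dots> \<le> trace_norm (Ad u (cp_lambda h) - \<sigma> (cp_lambda h)) + trace_norm (\<sigma> (cp_lambda h) - Ad v (cp_lambda h))"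
        by (rule trace_norm_triangle)
      also have "\<dots> \<le> 2 * \<delta>"
        using uG[OF h] vG[of "cp_lambda h"] h by (simp add: trace_norm_minus_commute)
      finally show ?thesis .
    qed
    have "trace_norm (Ad u (char_op a) - Ad v (char_op a))
        = norm (blinfun_apply (phase_op a) (blinfun_apply w vacuum) - blinfun_apply w vacuum)"
      using trace_norm_commutator[OF u v char_op_mem[of a]] char_commutator_vacuum[OF w, of a]
      by (simp add: w_def)
    also have "\<dots> \<le> 2 * mass (- {1}) (blinfun_apply w vacuum)" by (rule phase_op_mass)
    also have "\<dots> \<le> 2 * (14 * (2 * \<delta>))"
      using spectral_gap[OF gap gap] by simp
    finally have "trace_norm (Ad v (char_op a) - Ad u (char_op a)) \<le> 56 * \<delta>"
      by (simp add: trace_norm_minus_commute)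
    moreover have "trace_norm (\<sigma> (char_op a) - Ad v (char_op a)) \<le> \<delta>" by (rule vG) simp
    ultimately show ?thesis
      using trace_norm_triangle[of "\<sigma> (char_op a)" "Ad u (char_op a)" "Ad v (char_op a)"]
      by (simp add: \<delta>_def)
  qed
  with u show ?thesis by blast
qed

lemma Ad_char_tendsto:
  assumes u: "u \<in> unitaries crossed_product" and c: "almost_invariant c"
  shows "(\<lambda>k. trace_norm (Ad u (char_op (c k)) - char_op (c k))) \<longlonglongrightarrow> 0"
proof -
  have "trace_norm (Ad u (char_op (c k)) - char_op (c k))
      = norm (blinfun_apply (phase_op (c k)) (blinfun_apply u vacuum) - blinfun_apply u vacuum)" for k
  proof -
    have "trace_norm (Ad u (char_op (c k)) - char_op (c k))
        = trace_norm ((Ad u (char_op (c k)) - char_op (c k)) o\<^sub>L u)"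
      by (rule trace_norm_unitary_right[symmetric, OF u M.diff_mem[OF M.Ad_mem[OF u char_op_mem] char_op_mem]])
    also have "\<dots> = trace_norm ((char_op (c k) o\<^sub>L u) - (u o\<^sub>L char_op (c k)))"
      by (simp add: compose_diff_left Ad_compose_unitary[OF u] trace_norm_minus_commute)
    finally show ?thesis unfolding char_commutator_vacuum[OF M.unitary_mem[OF u]] .
  qed
  moreover have "(\<lambda>k. blinfun_apply (phase_op (c k)) (blinfun_apply u vacuum) - blinfun_apply u vacuum) \<longlonglongrightarrow> 0"
    using phase_op_tendsto[OF c] by (simp add: LIM_zero_iff)
  ultimately show ?thesis by (simp add: tendsto_norm_zero)
qed

lemma approximately_inner_char_tendsto:
  assumes \<sigma>: "approximately_inner crossed_product \<sigma>" and c: "almost_invariant c"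
  shows "(\<lambda>k. trace_norm (\<sigma> (char_op (c k)) - char_op (c k))) \<longlonglongrightarrow> 0"
proof (rule LIMSEQ_I)
  fix r :: real assume r: "r > 0"
  then obtain u where u: "u \<in> unitaries crossed_product"
    and ua: "\<And>a. trace_norm (\<sigma> (char_op a) - Ad u (char_op a)) \<le> r / 2"
    using approximately_inner_uniform_on_characters[OF \<sigma>, of "r / 2"] by auto
  from LIMSEQ_D[OF Ad_char_tendsto[OF u c], of "r / 2"] r obtain N
    where N: "\<And>k. k \<ge> N \<Longrightarrow> \<bar>trace_norm (Ad u (char_op (c k)) - char_op (c k))\<bar> < r / 2" by auto
  have "norm (trace_norm (\<sigma> (char_op (c k)) - char_op (c k)) - 0) < r" if "k \<ge> N" for k
  proof -
    have "trace_norm (\<sigma> (char_op (c k)) - char_op (c k)) \<ge> 0" by (simp add: trace_norm_def)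
    then show ?thesis
      using trace_norm_triangle[of "\<sigma> (char_op (c k))" "char_op (c k)" "Ad u (char_op (c k))"]
        ua[of "c k"] N[OF that] by simp
  qed
  then show "\<exists>N. \<forall>k\<ge>N. norm (trace_norm (\<sigma> (char_op (c k)) - char_op (c k)) - 0) < r" by blast
qed

section \<open>A flow and its reversal\<close>

lemma frequency_minus: "frequency (- p) (- q) a = - frequency p q a"
  by (simp add: frequency_def algebra_simps)

lemma trace_norm_char: "trace_norm (char_op a) = 1"
  by (simp add: trace_norm_def M.unitary_norm[OF char_op_unitary] norm_vacuum)

text \<open>With \<open>\<theta>\<^sub>t(x\<^sub>k) = z\<^sub>k x\<^sub>k\<close>, the relation between the flows at \<open>\<sigma>(x\<^sub>k)\<close> forces \<open>z\<^sub>k\<close> and its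
  conjugate to have the same limit.\<close>

lemma not_strongly_cocycle_conjugate_reverse:
  assumes c: "almost_invariant c" and fr: "(\<lambda>k. frequency p q (c k)) \<longlonglongrightarrow> 1"
  shows "\<not> strongly_cocycle_conjugate crossed_product (theta p q) (theta (- p) (- q))"
proof
  assume "strongly_cocycle_conjugate crossed_product (theta p q) (theta (- p) (- q))"
  then obtain U \<sigma> where "conjugates crossed_product (theta p q) (theta (- p) (- q)) U \<sigma>"
    and inner: "approximately_inner crossed_product \<sigma>"
    unfolding strongly_cocycle_conjugate_def by blast
  then have aut: "\<sigma> \<in> automorphisms crossed_product"
    and U: "\<And>t. U t \<in> unitaries crossed_product"
    and rel: "\<And>t x. x \<in> crossed_product \<Longrightarrow>
      Ad (U t) (theta (- p) (- q) t x) = \<sigma> (theta p q t (inv_into crossed_product \<sigma> x))"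
    by (auto simp: conjugates_def cocycle_def)
  \<comment> \<open>The limit of \<open>z\<^sub>k\<close> is then \<open>-i\<close>, as far from its conjugate as possible.\<close>
  define t where "t = pi / 2"
  define X where "X k = char_op (c k)" for k
  define Y where "Y k = \<sigma> (X k)" for k
  define z where "z k = cis (- (frequency p q (c k) * t))" for k
  have XM: "X k \<in> crossed_product" and YM: "Y k \<in> crossed_product" for k
    by (simp_all add: X_def Y_def char_op_mem M.aut_mem[OF aut])
  define V where "V x = Ad (U t) (theta (- p) (- q) t x)" for x
  have VY: "V (Y k) = cscale (z k) (Y k)" for k
    unfolding V_def rel[OF YM]
    by (simp only: Y_def M.aut_inv(3)[OF aut XM])
      (simp add: X_def theta_char z_def M.aut_cscale[OF aut char_op_mem])
  have VX: "V (X k) = cscale (cnj (z k)) (Ad (U t) (X k))" for k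
  proof -
    have "U t \<in> unitaries bounded_ops" using U[of t] by (simp add: unitaries_def M.bounded)
    then show ?thesis
      by (simp add: V_def X_def theta_char frequency_minus z_def Ad_cscale cis_cnj)
  qed
  have Vdiff: "trace_norm (V (Y k) - V (X k)) = trace_norm (Y k - X k)" for k
  proof -
    have "V (Y k) - V (X k) = Ad (U t) (theta (- p) (- q) t (Y k - X k))"
      by (simp add: V_def theta_def Ad_diff)
    then show ?thesis
      by (simp add: trace_norm_Ad[OF U] M.aut_mem[OF theta_automorphism] M.diff_mem XM YM trace_norm_theta)
  qed
  have diffs: "cscale a (x - y) = cscale a x - cscale a y" "cscale (a - b) x = cscale a x - cscale b x"
    for a b and x y :: "ltwo op"
    by (rule blinfun_eqI, simp add: blinfun.diff_left scaleC_diff_right scaleC_diff_left)+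
  have le: "cmod (z k - cnj (z k)) \<le> 2 * trace_norm (Y k - X k) + trace_norm (Ad (U t) (X k) - X k)" for k
  proof -
    have "cmod (z k - cnj (z k)) = trace_norm (cscale (z k) (X k) - cscale (cnj (z k)) (X k))"
      using trace_norm_cscale[of "z k - cnj (z k)" "X k"] by (simp add: diffs X_def trace_norm_char)
    also have "\<dots> \<le> trace_norm (cscale (z k) (X k) - V (Y k)) + trace_norm (V (Y k) - cscale (cnj (z k)) (X k))"
      by (rule trace_norm_triangle)
    also have "trace_norm (V (Y k) - cscale (cnj (z k)) (X k))
        \<le> trace_norm (V (Y k) - V (X k)) + trace_norm (V (X k) - cscale (cnj (z k)) (X k))"
      by (rule trace_norm_triangle)
    also have "trace_norm (cscale (z k) (X k) - V (Y k)) = trace_norm (Y k - X k)"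
      unfolding VY diffs(1)[symmetric] trace_norm_cscale by (simp add: z_def trace_norm_minus_commute)
    also have "trace_norm (V (X k) - cscale (cnj (z k)) (X k)) = trace_norm (Ad (U t) (X k) - X k)"
      unfolding VX diffs(1)[symmetric] trace_norm_cscale by (simp add: z_def)
    finally show ?thesis by (simp add: Vdiff)
  qed
  have lim: "(\<lambda>k. 2 * trace_norm (Y k - X k) + trace_norm (Ad (U t) (X k) - X k)) \<longlonglongrightarrow> 2 * 0 + 0"
    unfolding X_def Y_def
    by (intro tendsto_intros approximately_inner_char_tendsto inner Ad_char_tendsto U c)
  have "(\<lambda>k. z k - cnj (z k)) \<longlonglongrightarrow> 0"
  proof (rule Lim_null_comparison)
    show "\<forall>\<^sub>F k in sequentially. norm (z k - cnj (z k))
        \<le> 2 * trace_norm (Y k - X k) + trace_norm (Ad (U t) (X k) - X k)"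
      by (intro always_eventually allI le)
    show "(\<lambda>k. 2 * trace_norm (Y k - X k) + trace_norm (Ad (U t) (X k) - X k)) \<longlonglongrightarrow> 0"
      using lim by (simp only: mult_zero_right add_0_right)
  qed
  moreover have "(\<lambda>k. z k - cnj (z k)) \<longlonglongrightarrow> cis (- (1 * t)) - cnj (cis (- (1 * t)))"
    unfolding z_def by (intro tendsto_intros fr)
  ultimately have "cis (- (1 * t)) - cnj (cis (- (1 * t))) = 0" using LIMSEQ_unique by blast
  then show False by (simp add: t_def complex_eq_iff)
qed

theorem theorem4p5:
  fixes \<omega> :: "nat filter" and \<phi> :: "ltwo op \<Rightarrow> complex"
  assumes "free_ultrafilter \<omega>"
    and "faithful_normal_state crossed_product \<phi>"
  shows "\<exists>l\<^sub>1 m\<^sub>1 p\<^sub>1 q\<^sub>1 l\<^sub>2 m\<^sub>2 p\<^sub>2 q\<^sub>2 :: real. \<exists>\<theta>\<^sub>1 \<theta>\<^sub>2.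
    theta_flow l\<^sub>1 m\<^sub>1 p\<^sub>1 q\<^sub>1 \<theta>\<^sub>1 \<and> theta_flow l\<^sub>2 m\<^sub>2 p\<^sub>2 q\<^sub>2 \<theta>\<^sub>2
    \<and> rohlin_property \<omega> \<phi> crossed_product \<theta>\<^sub>1
    \<and> rohlin_property \<omega> \<phi> crossed_product \<theta>\<^sub>2
    \<and> cocycle_conjugate crossed_product \<theta>\<^sub>1 \<theta>\<^sub>2
    \<and> \<not> strongly_cocycle_conjugate crossed_product \<theta>\<^sub>1 \<theta>\<^sub>2"
proof -
  interpret free_filter \<omega> by (rule free_filter.intro[OF assms(1)])
  let ?p = "sqrt 3" and ?q = "1 :: real"
  have "\<exists>c. almost_invariant c \<and> (\<lambda>k. frequency (- ?p) (- ?q) (c k)) \<longlonglongrightarrow> r" for r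
  proof -
    obtain c where "almost_invariant c" "(\<lambda>k. frequency ?p ?q (c k)) \<longlonglongrightarrow> - r"
      using ex_almost_invariant[of "- r"] by blast
    then show ?thesis
      using tendsto_minus[of "\<lambda>k. frequency ?p ?q (c k)" "- r" sequentially]
      unfolding frequency_minus by auto
  qed
  then have "rohlin_property \<omega> \<phi> crossed_product (theta (- ?p) (- ?q))"
    by (rule rohlin_theta[OF assms(2)])
  moreover have "rohlin_property \<omega> \<phi> crossed_product (theta ?p ?q)"
    by (rule rohlin_theta[OF assms(2) ex_almost_invariant])
  moreover have "\<not> strongly_cocycle_conjugate crossed_product (theta ?p ?q) (theta (- ?p) (- ?q))"
    using ex_almost_invariant[of 1] not_strongly_cocycle_conjugate_reverse by blast
  ultimately show ?thesis
    using theta_flow_theta[of ?p ?q] theta_flow_theta[of "- ?p" "- ?q"]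
      cocycle_conjugate_reverse[of ?p ?q]
    by blast
qed

end
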